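(* Let $h_1,h_2,h_3\in\mathbb R$, $v_{12},v_{23}\in\mathbb C\setminus\{0\}$, $$H_0=\begin{pmatrix}h_1&0&0\\0&h_2&0\\0&0&h_3\end{pmatrix},\qquad V=\begin{pmatrix}0&v_{12}&0\\ \overline{v_{12}}&0&v_{23}\\0&\overline{v_{23}}&0\end{pmatrix},$$ $\omega_1=h_2-h_1$, $\omega_2=h_3-h_2$, let $\lambda_1>\lambda_3>\lambda_2$ be real, $O=\mathrm{diag}(\lambda_1,\lambda_2,\lambda_3)$, $\rho_0=\mathrm{diag}(0,0,1)$, $T>0$, $\mathfrak H^0=L_2([0,T],\mathbb R)$, and $J_O\colon\mathfrak H^0\to\mathbb R$, $J_O(f)=\mathrm{Tr}[U_T^f\rho_0(U_T^f)^\dagger O]$. Let $$\mathfrak H^1=\Big\{f\in\mathfrak H^0:\int_0^Te^{-i\omega_2t}f(t)\,dt=0\Big\}.$$ Then the Taylor expansion of $J_O$ at the zero control $f_0\equiv0$ has the form $$J_O(f_0+\delta f)=J_O(f_0)+\frac1{2}J_O^{(2)}(f_0)(\delta f,\delta f)+\frac1{4!}J_O^{(4)}(f_0)(\delta f,\ldots,\delta f)+o(\|\delta f\|^5)\quad\text{as }\|\delta f\|\to0,$$ where $J_O^{(2)}(f_0)(\delta f,\delta f)<0$ for all $\delta f\in\mathfrak H^0\setminus\mathfrak H^1$, and $J_O^{(2)}(f_0)(\delta f,\delta f)=0$ and $J_O^{(4)}(f_0)(\delta f,\ldots,\delta f)\ge0$ for all $\delta f\in\mathfrak H^1$. Suppose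 in addition that the system is anharmonic, i.e. $\omega_1\neq\omega_2$. Then: (1) if $\omega_2=0$, then for any $T>0$ there exists $\delta f\in\mathfrak H^1$ with $J_O^{(4)}(f_0)(\delta f,\ldots,\delta f)>0$; (2) if $|\omega_2|>0$, then for any $T\ge\frac{2\pi}{|\omega_2|}$ there exists $\delta f\in\mathfrak H^1$ with $J_O^{(4)}(f_0)(\delta f,\ldots,\delta f)>0$. Thus, for such $T$, $f_0$ is a trap of the third order for $J_O$.
   Context: For $f\in L_2([0,T],\mathbb R)$, $U_t^f$ denotes the unique absolutely continuous solution on $[0,T]$ of $i\,\frac{dU_t^f}{dt}=(H_0+f(t)V)U_t^f$, $U_0^f=\mathbb I$. $J_O^{(j)}(f)$ is the $j$-th Fréchet differential of $J_O$ at $f$. Definition (trap of $n$-th order). A control $f\in L_2([0,T],\mathbb R)$ is a trap of the $n$-th order for $J_O$ if: (i) $f$ is not a point of global maximum of $J_O$; (ii) the Taylor expansion of $J_O$ at $f$ has the form $$J_O(f+\delta f)=J_O(f)+\sum_{j=2}^n\frac1{j!}J_O^{(j)}(f)(\delta f,\ldots,\delta f)+o(\|\delta f\|^n)\quad\text{as }\|\delta f\|\to0$$ (so the first-order term vanishes), and the functional $R(\delta f):=\sum_{j=2}^n\frac1{j!}J_O^{(j)}(f)(\delta f,\ldots,\delta f)$ satisfies: (a) $R$ is not identically zero; (b) for every $\delta f\in L_2([0,T],\mathbb R)$ there is $\varepsilon>0$ such that $R(t\,\delta f)\le0$ for all $t\in(-\varepsilon,\varepsilon)$. *)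

theory Defs
  imports "HOL-Analysis.Analysis" "HOL-Library.Landau_Symbols"
begin

text \<open>
  Elements of \<open>L\<^sub>2([0,T], \<real>)\<close> are represented by square-integrable functions rather than by classes
  modulo null sets, so the norm below is only a seminorm. Values outside of \<open>[0,T]\<close> are irrelevant.
\<close>

definition L2 :: "real \<Rightarrow> (real \<Rightarrow> real) set" where
  "L2 T = {f. f \<in> borel_measurable (lebesgue_on {0..T}) \<and>
              integrable (lebesgue_on {0..T}) (\<lambda>t. (f t)\<^sup>2)}"

definition L2_norm :: "real \<Rightarrow> (real \<Rightarrow> real) \<Rightarrow> real" where
  "L2_norm T f = sqrt (LINT t|lebesgue_on {0..T}. (f t)\<^sup>2)"

text \<open>The filter of neighbourhoods of zero, zero included, so that \<open>\<forall>\<^sub>F h in L2_nhds_zero T. P h\<close>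
  means that \<open>P h\<close> holds for all \<open>h\<close> in \<open>L\<^sub>2([0,T], \<real>)\<close> of sufficiently small norm.\<close>

definition L2_nhds_zero :: "real \<Rightarrow> (real \<Rightarrow> real) filter" where
  "L2_nhds_zero T = inf (filtercomap (L2_norm T) (nhds 0)) (principal (L2 T))"


text \<open>A \<open>k\<close>-linear form is a function of argument lists; only lists of length \<open>k\<close> with entries in
  \<open>L2 T\<close> matter.\<close>

definition bounded_multilinear_form ::
    "real \<Rightarrow> nat \<Rightarrow> ((real \<Rightarrow> real) list \<Rightarrow> real) \<Rightarrow> bool" where
  "bounded_multilinear_form T k M \<longleftrightarrow>
     (\<forall>hs\<in>lists (L2 T). \<forall>i<k. \<forall>g\<in>L2 T. \<forall>h\<in>L2 T. \<forall>a b. length hs = k \<longrightarrow>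
        M (hs[i := \<lambda>t. a * g t + b * h t]) = a * M (hs[i := g]) + b * M (hs[i := h])) \<and>
     (\<exists>C. \<forall>hs\<in>lists (L2 T). length hs = k \<longrightarrow> \<bar>M hs\<bar> \<le> C * prod_list (map (L2_norm T) hs))"

text \<open>
  \<open>has_frechet_differential T J k f M\<close>: \<open>M\<close> is the \<open>k\<close>-th Frechet differential of \<open>J\<close> at \<open>f\<close>. The
  differential of order \<open>k + 1\<close> is the derivative at \<open>f\<close>, in the operator norm of \<open>k\<close>-linear forms,
  of the differential \<open>D\<close> of order \<open>k\<close>, which has to exist in a neighbourhood of \<open>f\<close>. The new
  direction is the first argument of \<open>M\<close>.
\<close>

primrec has_frechet_differential ::
    "real \<Rightarrow> ((real \<Rightarrow> real) \<Rightarrow> real) \<Rightarrow> nat \<Rightarrow> (real \<Rightarrow> real) \<Rightarrow>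
       ((real \<Rightarrow> real) list \<Rightarrow> real) \<Rightarrow> bool" where
  "has_frechet_differential T J 0 = (\<lambda>f M. M [] = J f)"
| "has_frechet_differential T J (Suc k) = (\<lambda>f M.
     bounded_multilinear_form T (Suc k) M \<and>
     (\<exists>D. (\<forall>\<^sub>F h in L2_nhds_zero T.
             has_frechet_differential T J k (\<lambda>t. f t + h t) (D (\<lambda>t. f t + h t))) \<and>
          (\<forall>\<epsilon>>0. \<forall>\<^sub>F h in L2_nhds_zero T. \<forall>hs\<in>lists (L2 T). length hs = k \<longrightarrow>
             \<bar>D (\<lambda>t. f t + h t) hs - D f hs - M (h # hs)\<bar>
               \<le> \<epsilon> * L2_norm T h * prod_list (map (L2_norm T) hs))))"

definition frechet_differentiable ::
    "real \<Rightarrow> ((real \<Rightarrow> real) \<Rightarrow> real) \<Rightarrow> nat \<Rightarrow> (real \<Rightarrow> real) \<Rightarrow> bool" where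
  "frechet_differentiable T J k f \<longleftrightarrow> (\<exists>M. has_frechet_differential T J k f M)"

text \<open>The choice is unique on lists of length \<open>k\<close> over \<open>L2 T\<close>.\<close>

definition frechet_differential ::
    "real \<Rightarrow> ((real \<Rightarrow> real) \<Rightarrow> real) \<Rightarrow> nat \<Rightarrow> (real \<Rightarrow> real) \<Rightarrow>
       (real \<Rightarrow> real) list \<Rightarrow> real" where
  "frechet_differential T J k f = (SOME M. has_frechet_differential T J k f M)"


definition trap_remainder ::
    "real \<Rightarrow> ((real \<Rightarrow> real) \<Rightarrow> real) \<Rightarrow> nat \<Rightarrow> (real \<Rightarrow> real) \<Rightarrow> (real \<Rightarrow> real) \<Rightarrow> real" where
  "trap_remainder T J n f d =
     (\<Sum>j = 2..n. 1 / fact j * frechet_differential T J j f (replicate j d))"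

definition is_trap ::
    "real \<Rightarrow> ((real \<Rightarrow> real) \<Rightarrow> real) \<Rightarrow> nat \<Rightarrow> (real \<Rightarrow> real) \<Rightarrow> bool" where
  "is_trap T J n f \<longleftrightarrow>
     f \<in> L2 T \<and>
     \<not> (\<forall>g\<in>L2 T. J g \<le> J f) \<and>
     (\<forall>j\<le>n. frechet_differentiable T J j f) \<and>
     (\<lambda>d. J (\<lambda>t. f t + d t) - (J f + trap_remainder T J n f d))
        \<in> o[L2_nhds_zero T](\<lambda>d. L2_norm T d ^ n) \<and>
     (\<exists>d\<in>L2 T. trap_remainder T J n f d \<noteq> 0) \<and>
     (\<forall>d\<in>L2 T. \<exists>\<epsilon>>0. \<forall>s\<in>{-\<epsilon><..<\<epsilon>}. trap_remainder T J n f (\<lambda>t. s * d t) \<le> 0)"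


text \<open>Absolute continuity on a real interval; \<open>Inf K\<close> and \<open>Sup K\<close> are the endpoints of the compact
  interval \<open>K\<close>.\<close>

definition absolutely_continuous_on :: "real set \<Rightarrow> (real \<Rightarrow> 'a::real_normed_vector) \<Rightarrow> bool" where
  "absolutely_continuous_on S g \<longleftrightarrow>
     (\<forall>\<epsilon>>0. \<exists>\<delta>>0. \<forall>\<D> X. \<D> division_of X \<and> X \<subseteq> S \<and> (\<Sum>K\<in>\<D>. Sup K - Inf K) < \<delta> \<longrightarrow>
        (\<Sum>K\<in>\<D>. norm (g (Sup K) - g (Inf K))) < \<epsilon>)"

text \<open>The product with \<open>mat \<i>\<close> is multiplication by the scalar \<open>\<i>\<close>.\<close>

definition schroedinger_solution ::
    "real \<Rightarrow> complex^'n^'n \<Rightarrow> complex^'n^'n \<Rightarrow> (real \<Rightarrow> real) \<Rightarrow> (real \<Rightarrow> complex^'n^'n) \<Rightarrow> bool" where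
  "schroedinger_solution T H0 V f U \<longleftrightarrow>
     absolutely_continuous_on {0..T} U \<and> U 0 = mat 1 \<and>
     (AE t in lebesgue_on {0..T}. \<exists>U'. (U has_vector_derivative U') (at t within {0..T}) \<and>
        mat \<i> ** U' = (H0 + f t *\<^sub>R V) ** U t)"

text \<open>The choice is unique on \<open>[0,T]\<close>.\<close>

definition propagator ::
    "real \<Rightarrow> complex^'n^'n \<Rightarrow> complex^'n^'n \<Rightarrow> (real \<Rightarrow> real) \<Rightarrow> real \<Rightarrow> complex^'n^'n" where
  "propagator T H0 V f = (SOME U. schroedinger_solution T H0 V f U)"

definition adjoint_matrix :: "complex^'n^'m \<Rightarrow> complex^'m^'n" where
  "adjoint_matrix A = (\<chi> i j. cnj (A $ j $ i))"

text \<open>The trace is real for Hermitian \<open>\<rho>0\<close> and \<open>Ob\<close>; \<open>Re\<close> only adapts the type.\<close>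

definition objective ::
    "real \<Rightarrow> complex^'n^'n \<Rightarrow> complex^'n^'n \<Rightarrow> complex^'n^'n \<Rightarrow> complex^'n^'n \<Rightarrow>
       (real \<Rightarrow> real) \<Rightarrow> real" where
  "objective T H0 V \<rho>0 Ob f =
     Re (trace (propagator T H0 V f T ** \<rho>0 ** adjoint_matrix (propagator T H0 V f T) ** Ob))"


definition diag3 :: "real \<Rightarrow> real \<Rightarrow> real \<Rightarrow> complex^3^3" where
  "diag3 a b c =
     vector [vector [of_real a, 0, 0],
             vector [0, of_real b, 0],
             vector [0, 0, of_real c]]"

definition ladder_coupling :: "complex \<Rightarrow> complex \<Rightarrow> complex^3^3" where
  "ladder_coupling v12 v23 =
     vector [vector [0, v12, 0],
             vector [cnj v12, 0, v23],
             vector [0, cnj v23, 0]]"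

definition resonance_free :: "real \<Rightarrow> real \<Rightarrow> (real \<Rightarrow> real) set" where
  "resonance_free T \<omega> =
     {f \<in> L2 T. (LINT t|lebesgue_on {0..T}. exp (- (\<i> * of_real \<omega> * of_real t)) * of_real (f t)) = 0}"

end

theory Submission
  imports Defs
begin

text \<open>
  In the interaction picture the evolution \<open>W\<close> solves \<open>W' = - \<i> f B W\<close>, and \<open>\<sigma> = W \<rho>\<^sub>0 W\<^sup>*\<close> solves
  the linear equation \<open>\<sigma>' = - \<i> f [B, \<sigma>]\<close>. So \<open>J f\<close> is a bounded linear functional of
  \<open>(1 - K f)\<inverse> \<rho>\<^sub>0\<close>, where \<open>K f\<close> is a Volterra operator that depends linearly on \<open>f\<close>, and the
  differentials of the resolvent at \<open>0\<close> are \<open>n! (K d)\<^sup>n\<close> on the diagonal. Their values come from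
  comparison with the Dyson series of the third column of \<open>W\<close>: conservation of the norm gives
  \<open>J = \<lambda>\<^sub>3 + (\<lambda>\<^sub>1 - \<lambda>\<^sub>3) |W\<^sub>1\<^sub>3|\<^sup>2 + (\<lambda>\<^sub>2 - \<lambda>\<^sub>3) |W\<^sub>2\<^sub>3|\<^sup>2\<close>, where \<open>W\<^sub>1\<^sub>3\<close> is even and \<open>W\<^sub>2\<^sub>3\<close> is odd in
  the control. On \<open>H\<^sup>1\<close> the first-order term of \<open>W\<^sub>2\<^sub>3\<close> vanishes, and the fourth-order term of \<open>J\<close> is
  \<open>(\<lambda>\<^sub>1 - \<lambda>\<^sub>3) |A\<^sub>2|\<^sup>2\<close> with \<open>A\<^sub>2\<close> the second-order term of \<open>W\<^sub>1\<^sub>3\<close>. For \<open>d = g'' + \<omega>\<^sub>2\<^sup>2 g\<close> with a short bump \<open>g\<close>,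
  \<open>A\<^sub>2\<close> is a multiple of \<open>(\<omega>\<^sub>1 - \<omega>\<^sub>2) \<integral> exp (- \<i> (\<omega>\<^sub>1 + \<omega>\<^sub>2) t) (g' + \<i> \<omega>\<^sub>2 g)\<^sup>2\<close>, which is dominated by \<open>\<integral> g'\<^sup>2\<close>.
\<close>

section \<open>Uniqueness of Frechet differentials\<close>

text \<open>\<open>J\<close> is quadratic in \<open>W\<close> but linear in \<sigma>. Differentials
  are therefore read off the equation for \<sigma>, while their signs show only in the amplitudes of
  \<open>W\<close>; so both equations are solved, and two expansions of s \<mapsto> J (s d) are
  compared coefficientwise. Differentiability of order k + 1 involves order k at all nearby
  controls, which calls for derivatives of the resolvent on a neighbourhood of 0 with bounds uniform
  in the base point. The fixed point argument needs a small control. This suffices because every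
  claim is local at 0: even a control better than the zero control is found among small multiples of
  one direction. Why \<open>d\<close> has its form: with G = exp (-i \<omega>2 t) (g' + i \<omega>2
  g), the product exp (-i \<omega>2 t) d equals G', so the resonance integral vanishes once g and g'
  vanish at both ends of the bump. The integrand of the second-order amplitude becomes exp (-i
  (\<omega>1 - \<omega>2) t) G G', and integration by parts brings out the factor \<omega>1 -
  \<omega>2. Shortening the bump makes g' dominate g and keeps the remaining phase near 1.\<close>

lemma L2_norm_nonneg [simp]: "0 \<le> L2_norm T h"
  by (simp add: L2_norm_def)

lemma L2_norm_scale: "L2_norm T (\<lambda>t. a * h t) = \<bar>a\<bar> * L2_norm T h"
  by (simp add: L2_norm_def power_mult_distrib real_sqrt_mult)

lemma L2_zero [simp]: "(\<lambda>_. 0) \<in> L2 T"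
  by (simp add: L2_def)

lemma L2_norm_zero [simp]: "L2_norm T (\<lambda>_. 0) = 0"
  by (simp add: L2_norm_def)

lemma L2_scale:
  assumes "h \<in> L2 T"
  shows "(\<lambda>t. a * h t) \<in> L2 T"
  using assms by (auto simp: L2_def power_mult_distrib)

lemma L2_add:
  assumes g: "g \<in> L2 T" and h: "h \<in> L2 T"
  shows "(\<lambda>t. g t + h t) \<in> L2 T"
proof -
  have m: "g \<in> borel_measurable (lebesgue_on {0..T})" "h \<in> borel_measurable (lebesgue_on {0..T})"
    using g h by (auto simp: L2_def)
  have "integrable (lebesgue_on {0..T}) (\<lambda>t. 2 * (g t)\<^sup>2 + 2 * (h t)\<^sup>2)"
    using g h by (auto simp: L2_def)
  then have "integrable (lebesgue_on {0..T}) (\<lambda>t. (g t + h t)\<^sup>2)"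
  proof (rule Bochner_Integration.integrable_bound)
    show "(\<lambda>t. (g t + h t)\<^sup>2) \<in> borel_measurable (lebesgue_on {0..T})"
      using m by measurable
    have "(x + y)\<^sup>2 \<le> 2 * x\<^sup>2 + 2 * y\<^sup>2" for x y :: real
      using sum_squares_bound[of x y] by (simp add: power2_sum)
    then show "AE t in lebesgue_on {0..T}. norm ((g t + h t)\<^sup>2) \<le> norm (2 * (g t)\<^sup>2 + 2 * (h t)\<^sup>2)"
      by (intro always_eventually allI) simp
  qed
  with m show ?thesis by (auto simp: L2_def)
qed

lemma L2_lincomb:
  assumes "g \<in> L2 T" and "h \<in> L2 T"
  shows "(\<lambda>t. a * g t + b * h t) \<in> L2 T"
  using assms by (intro L2_add L2_scale)

lemma eventually_L2_nhds_zero: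
  "eventually P (L2_nhds_zero T) \<longleftrightarrow> (\<exists>\<delta>>0. \<forall>h\<in>L2 T. L2_norm T h < \<delta> \<longrightarrow> P h)"
proof
  assume "eventually P (L2_nhds_zero T)"
  then obtain Q where Q: "eventually Q (nhds (0::real))"
    "\<And>h. Q (L2_norm T h) \<Longrightarrow> h \<in> L2 T \<Longrightarrow> P h"
    by (auto simp: L2_nhds_zero_def eventually_inf_principal eventually_filtercomap)
  then obtain \<delta> where "\<delta> > 0" "\<And>x. dist x 0 < \<delta> \<Longrightarrow> Q x"
    by (auto simp: eventually_nhds_metric)
  with Q(2) show "\<exists>\<delta>>0. \<forall>h\<in>L2 T. L2_norm T h < \<delta> \<longrightarrow> P h"
    by (intro exI[of _ \<delta>]) auto
next
  assume "\<exists>\<delta>>0. \<forall>h\<in>L2 T. L2_norm T h < \<delta> \<longrightarrow> P h"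
  then obtain \<delta> where \<delta>: "\<delta> > 0" "\<And>h. h \<in> L2 T \<Longrightarrow> L2_norm T h < \<delta> \<Longrightarrow> P h"
    by blast
  have "eventually (\<lambda>x. x < \<delta>) (nhds (0::real))"
    using order_tendstoD(2)[OF filterlim_ident \<delta>(1)] .
  with \<delta>(2) show "eventually P (L2_nhds_zero T)"
    unfolding L2_nhds_zero_def eventually_inf_principal eventually_filtercomap by blast
qed

text \<open>By induction the lower-order differentials agree at all controls near \<open>f\<close>,
  which is why the base point must be arbitrary. Hence two candidates differ by a form that is
  linear in the new direction and small-o of its norm, and homogeneity forces it to vanish. This is
  what makes the choice in \<open>frechet_differential\<close> harmless.\<close>

lemma has_frechet_differential_unique:
  assumes "has_frechet_differential T J k f M" and "has_frechet_differential T J k f M'"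
    and "hs \<in> lists (L2 T)" and "length hs = k"
  shows "M hs = M' hs"
  using assms
proof (induction k arbitrary: f M M' hs)
  case 0
  then show ?case by simp
next
  case (Suc k)
  obtain h gs where hs: "hs = h # gs" and h: "h \<in> L2 T" and gs: "gs \<in> lists (L2 T)" "length gs = k"
    using Suc.prems(3,4) by (cases hs) auto
  let ?P = "prod_list (map (L2_norm T) gs)"
  have P: "0 \<le> ?P"
    by (induction gs) auto
  obtain D where D: "\<forall>\<^sub>F h in L2_nhds_zero T.
             has_frechet_differential T J k (\<lambda>t. f t + h t) (D (\<lambda>t. f t + h t))"
    and D': "\<And>\<epsilon>. \<epsilon> > 0 \<Longrightarrow> \<forall>\<^sub>F h in L2_nhds_zero T. \<forall>hs\<in>lists (L2 T). length hs = k \<longrightarrow>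
             \<bar>D (\<lambda>t. f t + h t) hs - D f hs - M (h # hs)\<bar>
               \<le> \<epsilon> * L2_norm T h * prod_list (map (L2_norm T) hs)"
    using Suc.prems(1) by auto
  obtain E where E: "\<forall>\<^sub>F h in L2_nhds_zero T.
             has_frechet_differential T J k (\<lambda>t. f t + h t) (E (\<lambda>t. f t + h t))"
    and E': "\<And>\<epsilon>. \<epsilon> > 0 \<Longrightarrow> \<forall>\<^sub>F h in L2_nhds_zero T. \<forall>hs\<in>lists (L2 T). length hs = k \<longrightarrow>
             \<bar>E (\<lambda>t. f t + h t) hs - E f hs - M' (h # hs)\<bar>
               \<le> \<epsilon> * L2_norm T h * prod_list (map (L2_norm T) hs)"
    using Suc.prems(2) by auto
  have scale: "N ((\<lambda>t. s * h t) # gs) = s * N (h # gs)"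
    if "bounded_multilinear_form T (Suc k) N" for N s
  proof -
    have "h # gs \<in> lists (L2 T)" "length (h # gs) = Suc k"
      using h gs by auto
    then have "N ((h # gs)[0 := \<lambda>t. s * h t + 0 * h t])
        = s * N ((h # gs)[0 := h]) + 0 * N ((h # gs)[0 := h])"
      using that h unfolding bounded_multilinear_form_def by blast
    then show ?thesis by simp
  qed
  have main: "\<bar>M hs - M' hs\<bar> \<le> \<epsilon>" if "\<epsilon> > 0" for \<epsilon>
  proof -
    \<comment> \<open>The factor 2 accounts for two error terms; the summand 1 is there because the
      seminorms may vanish.\<close>
    define \<eta> where "\<eta> = \<epsilon> / (2 * (L2_norm T h * ?P + 1))"
    have pos: "L2_norm T h * ?P + 1 > 0" using P by (simp add: add_nonneg_pos)
    have "\<eta> > 0" using that pos by (simp add: \<eta>_def)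
    have "\<forall>\<^sub>F h in L2_nhds_zero T. \<bar>M (h # gs) - M' (h # gs)\<bar> \<le> 2 * \<eta> * L2_norm T h * ?P"
      using D E D'[OF \<open>\<eta> > 0\<close>] E'[OF \<open>\<eta> > 0\<close>]
    proof eventually_elim
      case (elim g)
      have e1: "D (\<lambda>t. f t + g t) gs = E (\<lambda>t. f t + g t) gs"
        using Suc.IH elim(1,2) gs by blast
      \<comment> \<open>The zero direction lies in every neighbourhood, so \<open>D f\<close> and
        \<open>E f\<close> are themselves differentials at \<open>f\<close> and the induction
        hypothesis applies to them too.\<close>
      have at_zero: "P (\<lambda>_. 0)" if "eventually P (L2_nhds_zero T)" for P
        using that unfolding eventually_L2_nhds_zero by force
      have "has_frechet_differential T J k f (D f)" "has_frechet_differential T J k f (E f)"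
        using at_zero[OF D] at_zero[OF E] by simp_all
      then have e2: "D f gs = E f gs"
        using Suc.IH gs by auto
      have "\<bar>D (\<lambda>t. f t + g t) gs - D f gs - M (g # gs)\<bar> \<le> \<eta> * L2_norm T g * ?P"
        "\<bar>E (\<lambda>t. f t + g t) gs - E f gs - M' (g # gs)\<bar> \<le> \<eta> * L2_norm T g * ?P"
        using elim(3,4) gs by auto
      then show ?case using e1 e2 by linarith
    qed
    then obtain \<delta> where \<delta>: "\<delta> > 0" "\<And>g. g \<in> L2 T \<Longrightarrow> L2_norm T g < \<delta> \<Longrightarrow>
        \<bar>M (g # gs) - M' (g # gs)\<bar> \<le> 2 * \<eta> * L2_norm T g * ?P"
      unfolding eventually_L2_nhds_zero by blast
    \<comment> \<open>Shrinks \<open>h\<close> into the ball of radius \<delta>; the factor cancels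
      again by linearity in the first argument.\<close>
    define s where "s = \<delta> / (L2_norm T h + 1)"
    have s: "s > 0" using \<delta>(1) by (simp add: s_def add_nonneg_pos)
    have "s * L2_norm T h < s * (L2_norm T h + 1)" using s by simp
    also have "\<dots> = \<delta>"
      using add_nonneg_pos[OF L2_norm_nonneg[of T h] zero_less_one] by (simp add: s_def)
    finally have "L2_norm T (\<lambda>t. s * h t) < \<delta>" using s by (simp add: L2_norm_scale)
    then have "\<bar>M ((\<lambda>t. s * h t) # gs) - M' ((\<lambda>t. s * h t) # gs)\<bar>
        \<le> 2 * \<eta> * L2_norm T (\<lambda>t. s * h t) * ?P"
      using \<delta>(2) h L2_scale by blast
    moreover have "M ((\<lambda>t. s * h t) # gs) - M' ((\<lambda>t. s * h t) # gs) = s * (M hs - M' hs)"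
      using Suc.prems(1,2) scale[of M s] scale[of M' s] by (simp add: hs right_diff_distrib)
    moreover have "L2_norm T (\<lambda>t. s * h t) = s * L2_norm T h"
      using s by (simp add: L2_norm_scale)
    ultimately have "s * \<bar>M hs - M' hs\<bar> \<le> s * (2 * \<eta> * (L2_norm T h * ?P))"
      using s by (simp only: abs_mult abs_of_pos mult_ac)
    then have "\<bar>M hs - M' hs\<bar> \<le> 2 * \<eta> * (L2_norm T h * ?P)"
      using s by simp
    also have "\<dots> \<le> 2 * \<eta> * (L2_norm T h * ?P + 1)"
      using \<open>\<eta> > 0\<close> by simp
    also have "\<dots> = \<epsilon>"
    proof -
      have "2 * (\<epsilon> / (2 * q)) * q = \<epsilon>" if "q > 0" for q
        using that by simp
      from this[OF pos] show ?thesis unfolding \<eta>_def .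
    qed
    finally show ?thesis .
  qed
  have "\<bar>M hs - M' hs\<bar> \<le> 0"
    by (rule field_le_epsilon) (simp add: main)
  then show ?case by simp
qed

lemma frechet_differential_eq:
  assumes "has_frechet_differential T J k f M" and "hs \<in> lists (L2 T)" and "length hs = k"
  shows "frechet_differential T J k f hs = M hs"
  unfolding frechet_differential_def
  by (rule has_frechet_differential_unique[OF someI[of "has_frechet_differential T J k f", OF assms(1)] assms])

section \<open>Lists of directions with one entry removed\<close>

definition delete_nth :: "nat \<Rightarrow> 'a list \<Rightarrow> 'a list" where
  "delete_nth i xs = take i xs @ drop (Suc i) xs"

lemma delete_nth_Cons_0 [simp]: "delete_nth 0 (x # xs) = xs"
  by (simp add: delete_nth_def)

lemma delete_nth_Cons_Suc [simp]: "delete_nth (Suc i) (x # xs) = x # delete_nth i xs"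
  by (simp add: delete_nth_def)

lemma length_delete_nth: "i < length xs \<Longrightarrow> length (delete_nth i xs) = length xs - 1"
  by (simp add: delete_nth_def)

lemma delete_nth_in_lists: "xs \<in> lists A \<Longrightarrow> delete_nth i xs \<in> lists A"
  by (auto simp: delete_nth_def dest: in_set_takeD in_set_dropD)

lemma delete_nth_replicate: "i \<le> n \<Longrightarrow> delete_nth i (replicate (Suc n) x) = replicate n x"
proof (induction n arbitrary: i)
  case (Suc n)
  then show ?case by (cases i) auto
qed simp

lemma delete_nth_update_same: "delete_nth i (xs[i := a]) = delete_nth i xs"
  by (simp add: delete_nth_def)

text \<open>Removing an entry to the left of position \<open>i\<close> shifts that position by one.
  Needed for multilinearity, where one direction is replaced while the recursion removes
  another.\<close>

lemma delete_nth_update: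
  "i \<noteq> j \<Longrightarrow> j < length xs \<Longrightarrow> delete_nth j (xs[i := a]) = (delete_nth j xs)[(if i < j then i else i - 1) := a]"
proof (induction xs arbitrary: i j)
  case (Cons x xs)
  then show ?case by (cases i; cases j; cases "i - 1") auto
qed simp

lemma prod_list_delete_nth:
  fixes g :: "'a \<Rightarrow> 'b::comm_monoid_mult"
  shows "i < length xs \<Longrightarrow> g (xs ! i) * prod_list (map g (delete_nth i xs)) = prod_list (map g xs)"
proof (induction xs arbitrary: i)
  case (Cons x xs)
  then show ?case by (cases i) (auto simp: ac_simps)
qed simp

section \<open>Differentials of a resolvent\<close>

text \<open>Smallness of a control is measured by \<nu>, the error estimates by the L2 norm. Of
  \<nu> only subadditivity and the comparison with the L2 norm matter; for the Volterra operators
  below it is a multiple of the L1 norm.\<close>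

locale resolvent_family =
  fixes T :: real and K :: "(real \<Rightarrow> real) \<Rightarrow> 'x::{real_normed_vector,complete_space} \<Rightarrow> 'x"
    and \<nu> :: "(real \<Rightarrow> real) \<Rightarrow> real" and C :: real
  assumes linear_K: "f \<in> L2 T \<Longrightarrow> linear (K f)"
    and K_lincomb: "g \<in> L2 T \<Longrightarrow> h \<in> L2 T \<Longrightarrow> K (\<lambda>t. a * g t + b * h t) x = a *\<^sub>R K g x + b *\<^sub>R K h x"
    and norm_K: "f \<in> L2 T \<Longrightarrow> norm (K f x) \<le> \<nu> f * norm x"
    and \<nu>_add: "f \<in> L2 T \<Longrightarrow> h \<in> L2 T \<Longrightarrow> \<nu> (\<lambda>t. f t + h t) \<le> \<nu> f + \<nu> h"
    and \<nu>_le: "f \<in> L2 T \<Longrightarrow> \<nu> f \<le> C * L2_norm T f"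
    and \<nu>_nonneg: "f \<in> L2 T \<Longrightarrow> 0 \<le> \<nu> f"
    and C_nonneg: "0 \<le> C"
begin

definition res :: "(real \<Rightarrow> real) \<Rightarrow> 'x \<Rightarrow> 'x" where
  "res f x = (THE y. y = x + K f y)"

lemma ex1_res:
  assumes f: "f \<in> L2 T" and "\<nu> f < 1"
  shows "\<exists>!y. y = x + K f y"
proof -
  have "dist (x + K f y) (x + K f z) \<le> \<nu> f * dist y z" for y z
    using norm_K[OF f, of "y - z"] linear_diff[OF linear_K[OF f]] by (simp add: dist_norm)
  then have "\<exists>!y. x + K f y = y"
    using banach_fix_type[of "\<nu> f" "\<lambda>y. x + K f y"] assms \<nu>_nonneg by simp
  then show ?thesis by metis
qed

lemma res_eq: "f \<in> L2 T \<Longrightarrow> \<nu> f < 1 \<Longrightarrow> res f x = x + K f (res f x)"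
  unfolding res_def by (rule theI'[OF ex1_res])

lemma res_unique: "f \<in> L2 T \<Longrightarrow> \<nu> f < 1 \<Longrightarrow> y = x + K f y \<Longrightarrow> res f x = y"
  using ex1_res res_eq by metis

text \<open>From |y| \<le> |x| + |y| / 2. The threshold 1/2, in place of the 1 that existence
  requires, makes the bound independent of \<open>f\<close>; all uniform estimates for the
  derivatives rest on it.\<close>

lemma norm_res:
  assumes f: "f \<in> L2 T" and \<nu>: "\<nu> f < 1/2"
  shows "norm (res f x) \<le> 2 * norm x"
proof -
  have "norm (res f x) \<le> norm x + norm (K f (res f x))"
    using res_eq[OF f, of x] \<nu> norm_triangle_ineq[of x "K f (res f x)"] by simp
  also have "\<dots> \<le> norm x + 1/2 * norm (res f x)"
    using norm_K[OF f, of "res f x"] \<nu> mult_right_mono[of "\<nu> f" "1/2" "norm (res f x)"] by simp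
  finally show ?thesis by simp
qed

lemma linear_res:
  assumes f: "f \<in> L2 T" and \<nu>: "\<nu> f < 1"
  shows "linear (res f)"
proof (rule linearI)
  fix x y c
  show "res f (x + y) = res f x + res f y"
  proof (rule res_unique[OF f \<nu>])
    have "res f x + res f y = (x + K f (res f x)) + (y + K f (res f y))"
      by (rule arg_cong2[where f = "(+)"]) (rule res_eq[OF f \<nu>])+
    also have "\<dots> = x + y + (K f (res f x) + K f (res f y))"
      by simp
    finally show "res f x + res f y = x + y + K f (res f x + res f y)"
      unfolding linear_add[OF linear_K[OF f]] .
  qed
  show "res f (c *\<^sub>R x) = c *\<^sub>R res f x"
  proof (rule res_unique[OF f \<nu>])
    have "c *\<^sub>R res f x = c *\<^sub>R (x + K f (res f x))"
      by (rule arg_cong[where f = "scaleR c"]) (rule res_eq[OF f \<nu>])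
    then show "c *\<^sub>R res f x = c *\<^sub>R x + K f (c *\<^sub>R res f x)"
      unfolding linear_scale[OF linear_K[OF f]] scaleR_add_right .
  qed
qed

lemma K_add: "f \<in> L2 T \<Longrightarrow> h \<in> L2 T \<Longrightarrow> K (\<lambda>t. f t + h t) x = K f x + K h x"
  using K_lincomb[of f h 1 1 x] by simp

lemma norm_K_le: "f \<in> L2 T \<Longrightarrow> norm (K f x) \<le> C * L2_norm T f * norm x"
  by (meson norm_K \<nu>_le order_trans mult_right_mono norm_ge_zero)

text \<open>Differentiating \<open>y = x + K f y\<close> in the directions \<open>hs\<close> gives
  \<open>D y hs = K f (D y hs) + (\<Sum>i. K (hs ! i) (D y (hs without its i-th entry)))\<close>.\<close>

primrec res_deriv :: "nat \<Rightarrow> 'x \<Rightarrow> (real \<Rightarrow> real) \<Rightarrow> (real \<Rightarrow> real) list \<Rightarrow> 'x" where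
  "res_deriv 0 x f hs = res f x"
| "res_deriv (Suc n) x f hs = res f (\<Sum>i\<le>n. K (hs ! i) (res_deriv n x f (delete_nth i hs)))"

lemma nth_in_L2: "hs \<in> lists (L2 T) \<Longrightarrow> i < length hs \<Longrightarrow> hs ! i \<in> L2 T"
  by auto

lemma prod_list_L2_norm_nonneg [simp]: "0 \<le> prod_list (map (L2_norm T) hs)"
  by (induction hs) auto

text \<open>In each summand \<open>K\<close> restores the norm of exactly the direction that was
  deleted, so the product of all norms comes back.\<close>

lemma norm_sum_K_le:
  assumes hs: "hs \<in> lists (L2 T)" "length hs = Suc n" and B: "0 \<le> B"
    and z: "\<And>i. i \<le> n \<Longrightarrow> norm (z i) \<le> B * prod_list (map (L2_norm T) (delete_nth i hs))"
  shows "norm (\<Sum>i\<le>n. K (hs ! i) (z i)) \<le> real (Suc n) * C * B * prod_list (map (L2_norm T) hs)"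
proof -
  have "norm (\<Sum>i\<le>n. K (hs ! i) (z i)) \<le> (\<Sum>i\<le>n. C * B * prod_list (map (L2_norm T) hs))"
  proof (rule sum_norm_le)
    fix i assume "i \<in> {..n}"
    then have i: "i < length hs" "i \<le> n" using hs by auto
    have "norm (K (hs ! i) (z i)) \<le> C * L2_norm T (hs ! i) * norm (z i)"
      using norm_K_le nth_in_L2 hs(1) i by blast
    also have "\<dots> \<le> C * L2_norm T (hs ! i) * (B * prod_list (map (L2_norm T) (delete_nth i hs)))"
      using z[OF i(2)] C_nonneg by (intro mult_left_mono) auto
    also have "\<dots> = C * B * prod_list (map (L2_norm T) hs)"
      using prod_list_delete_nth[OF i(1), of "L2_norm T"] by (simp add: mult_ac)
    finally show "norm (K (hs ! i) (z i)) \<le> C * B * prod_list (map (L2_norm T) hs)" .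
  qed
  then show ?thesis by (simp add: mult_ac)
qed

text \<open>The order of quantifiers matters: one constant has to serve at \<open>f\<close> and at
  every nearby control, since the difference estimates evaluate derivatives at both.\<close>

lemma norm_res_deriv:
  "\<exists>B\<ge>0. \<forall>f\<in>L2 T. \<forall>hs\<in>lists (L2 T). \<nu> f < 1/2 \<longrightarrow> length hs = n \<longrightarrow>
     norm (res_deriv n x f hs) \<le> B * prod_list (map (L2_norm T) hs)"
proof (induction n)
  case 0
  show ?case
    by (rule exI[of _ "2 * norm x"]) (auto intro: norm_res)
next
  case (Suc n)
  then obtain B where B: "B \<ge> 0" "\<And>f hs. f \<in> L2 T \<Longrightarrow> hs \<in> lists (L2 T) \<Longrightarrow> \<nu> f < 1/2 \<Longrightarrow>
      length hs = n \<Longrightarrow> norm (res_deriv n x f hs) \<le> B * prod_list (map (L2_norm T) hs)"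
    by blast
  show ?case
  proof (intro exI[of _ "2 * (real (Suc n) * C * B)"] conjI ballI impI)
    fix f hs assume f: "f \<in> L2 T" "\<nu> f < 1/2" and hs: "hs \<in> lists (L2 T)" "length hs = Suc n"
    have "norm (\<Sum>i\<le>n. K (hs ! i) (res_deriv n x f (delete_nth i hs)))
        \<le> real (Suc n) * C * B * prod_list (map (L2_norm T) hs)"
      using hs f by (intro norm_sum_K_le B delete_nth_in_lists) (auto simp: length_delete_nth)
    then show "norm (res_deriv (Suc n) x f hs) \<le> 2 * (real (Suc n) * C * B) * prod_list (map (L2_norm T) hs)"
      using norm_res[OF f, of "\<Sum>i\<le>n. K (hs ! i) (res_deriv n x f (delete_nth i hs))"]
      by (simp only: res_deriv.simps mult.assoc)
  qed (use B C_nonneg in auto)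
qed

text \<open>In the recursion, the summand that removes position \<open>i\<close> is linear in the
  new entry because \<open>K\<close> is linear in the control; every other summand is linear by
  induction, since \<open>K\<close> is linear in its argument.\<close>

lemma res_deriv_lincomb:
  assumes f: "f \<in> L2 T" "\<nu> f < 1"
    and "hs \<in> lists (L2 T)" "length hs = n" "i < n" and g: "g \<in> L2 T" and h: "h \<in> L2 T"
  shows "res_deriv n x f (hs[i := \<lambda>t. a * g t + b * h t])
       = a *\<^sub>R res_deriv n x f (hs[i := g]) + b *\<^sub>R res_deriv n x f (hs[i := h])"
  using assms(3-5)
proof (induction n arbitrary: hs i)
  case 0
  then show ?case by simp
next
  case (Suc n)
  define u where "u = (\<lambda>t. a * g t + b * h t)"
  define S where "S v j = K (hs[i := v] ! j) (res_deriv n x f (delete_nth j (hs[i := v])))" for v j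
  have "S u j = a *\<^sub>R S g j + b *\<^sub>R S h j" if "j \<le> n" for j
  proof (cases "j = i")
    case True
    then show ?thesis
      using Suc.prems that by (simp add: S_def u_def delete_nth_update_same K_lincomb[OF g h])
  next
    case False
    define i' where "i' = (if i < j then i else i - 1)"
    have i': "i' < n" using False Suc.prems that by (auto simp: i'_def)
    have del: "delete_nth j (hs[i := v]) = (delete_nth j hs)[i' := v]" for v
      unfolding i'_def using False Suc.prems that by (intro delete_nth_update) auto
    have "hs ! j \<in> L2 T" using Suc.prems that by (intro nth_in_L2) auto
    note K = linear_K[OF this]
    have "res_deriv n x f ((delete_nth j hs)[i' := u])
        = a *\<^sub>R res_deriv n x f ((delete_nth j hs)[i' := g]) + b *\<^sub>R res_deriv n x f ((delete_nth j hs)[i' := h])"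
      unfolding u_def using Suc.prems that i'
      by (intro Suc.IH) (auto simp: length_delete_nth intro!: delete_nth_in_lists)
    then show ?thesis
      using False by (simp add: S_def del linear_add[OF K] linear_scale[OF K])
  qed
  then have "(\<Sum>j\<le>n. S u j) = a *\<^sub>R (\<Sum>j\<le>n. S g j) + b *\<^sub>R (\<Sum>j\<le>n. S h j)"
    by (simp add: sum.distrib scaleR_sum_right)
  then show ?case
    unfolding u_def[symmetric] res_deriv.simps S_def[symmetric]
    by (simp add: linear_add[OF linear_res[OF f]] linear_scale[OF linear_res[OF f]])
qed

text \<open>Resolvent identity: the term with \<open>K h\<close> at the perturbed solution is moved
  to the inhomogeneity of the unperturbed equation.\<close>

lemma res_add:
  assumes f: "f \<in> L2 T" "\<nu> f < 1" and h: "h \<in> L2 T" and fh: "\<nu> (\<lambda>t. f t + h t) < 1"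
  shows "res (\<lambda>t. f t + h t) x = res f (x + K h (res (\<lambda>t. f t + h t) x))"
proof -
  have "res (\<lambda>t. f t + h t) x = x + K (\<lambda>t. f t + h t) (res (\<lambda>t. f t + h t) x)"
    using f h fh by (intro res_eq L2_add)
  then show ?thesis
    using K_add[OF f(1) h] by (intro sym[OF res_unique[OF f]]) (simp add: algebra_simps)
qed

text \<open>By \<open>res_add\<close> the difference of the two values is the resolvent at
  \<open>f\<close> of the lower-order differences plus \<open>K h\<close> applied to the perturbed
  value. Induction controls the former, and the uniform bound \<open>norm_res_deriv\<close> the
  latter.\<close>

lemma res_deriv_lipschitz:
  "\<exists>B\<ge>0. \<forall>f\<in>L2 T. \<forall>h\<in>L2 T. \<forall>hs\<in>lists (L2 T). \<nu> f < 1/2 \<longrightarrow> \<nu> (\<lambda>t. f t + h t) < 1/2 \<longrightarrow> length hs = n \<longrightarrow>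
     norm (res_deriv n x (\<lambda>t. f t + h t) hs - res_deriv n x f hs)
       \<le> B * L2_norm T h * prod_list (map (L2_norm T) hs)"
proof (induction n)
  case 0
  show ?case
  proof (intro exI[of _ "2 * (C * (2 * norm x))"] conjI ballI impI)
    fix f h and hs :: "(real \<Rightarrow> real) list"
    assume f: "f \<in> L2 T" "\<nu> f < 1/2" and h: "h \<in> L2 T"
      and fh: "\<nu> (\<lambda>t. f t + h t) < 1/2" and hs: "length hs = 0"
    define y where "y = res (\<lambda>t. f t + h t) x"
    have f1: "\<nu> f < 1" using f by simp
    have "y = res f (x + K h y)"
      unfolding y_def using f h fh by (intro res_add) auto
    then have "y - res f x = res f (K h y)"
      by (metis add_diff_cancel_left' linear_add[OF linear_res[OF f(1) f1]])
    then have "norm (y - res f x) \<le> 2 * norm (K h y)"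
      using norm_res[OF f] by metis
    also have "\<dots> \<le> 2 * (C * L2_norm T h * norm y)"
      using norm_K_le[OF h] by simp
    also have "\<dots> \<le> 2 * (C * L2_norm T h * (2 * norm x))"
      unfolding y_def using C_nonneg fh norm_res[OF L2_add[OF f(1) h] fh]
      by (intro mult_left_mono) auto
    finally show "norm (res_deriv 0 x (\<lambda>t. f t + h t) hs - res_deriv 0 x f hs)
      \<le> 2 * (C * (2 * norm x)) * L2_norm T h * prod_list (map (L2_norm T) hs)"
      using hs by (simp add: y_def mult_ac)
  qed (use C_nonneg in auto)
next
  case (Suc n)
  then obtain B where B: "B \<ge> 0" "\<And>f h hs. f \<in> L2 T \<Longrightarrow> h \<in> L2 T \<Longrightarrow> hs \<in> lists (L2 T) \<Longrightarrow> \<nu> f < 1/2 \<Longrightarrow>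
      \<nu> (\<lambda>t. f t + h t) < 1/2 \<Longrightarrow> length hs = n \<Longrightarrow>
      norm (res_deriv n x (\<lambda>t. f t + h t) hs - res_deriv n x f hs)
       \<le> B * L2_norm T h * prod_list (map (L2_norm T) hs)"
    by blast
  obtain A where A: "A \<ge> 0" "\<And>f hs. f \<in> L2 T \<Longrightarrow> hs \<in> lists (L2 T) \<Longrightarrow> \<nu> f < 1/2 \<Longrightarrow>
      length hs = Suc n \<Longrightarrow> norm (res_deriv (Suc n) x f hs) \<le> A * prod_list (map (L2_norm T) hs)"
    using norm_res_deriv[of "Suc n" x] by blast
  show ?case
  proof (intro exI[of _ "2 * (real (Suc n) * C * B + C * A)"] conjI ballI impI)
    fix f h hs assume f: "f \<in> L2 T" "\<nu> f < 1/2" and h: "h \<in> L2 T"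
      and fh: "\<nu> (\<lambda>t. f t + h t) < 1/2" and hs: "hs \<in> lists (L2 T)" "length hs = Suc n"
    let ?P = "prod_list (map (L2_norm T) hs)"
    let ?fh = "\<lambda>t. f t + h t"
    define y where "y = res_deriv (Suc n) x ?fh hs"
    define d where "d i = res_deriv n x ?fh (delete_nth i hs) - res_deriv n x f (delete_nth i hs)" for i
    have f1: "\<nu> f < 1" using f by simp
    note lin = linear_res[OF f(1) f1]
    have K: "linear (K (hs ! i))" if "i \<le> n" for i
      using that hs by (intro linear_K nth_in_L2) auto
    have y: "y = res f ((\<Sum>i\<le>n. K (hs ! i) (res_deriv n x ?fh (delete_nth i hs))) + K h y)"
      unfolding y_def res_deriv.simps using f h fh by (intro res_add) auto
    have "(\<Sum>i\<le>n. K (hs ! i) (d i)) + K h y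
        = (\<Sum>i\<le>n. K (hs ! i) (res_deriv n x ?fh (delete_nth i hs))) + K h y
          - (\<Sum>i\<le>n. K (hs ! i) (res_deriv n x f (delete_nth i hs)))"
      by (simp add: d_def linear_diff[OF K] sum_subtractf)
    then have eq: "y - res_deriv (Suc n) x f hs = res f ((\<Sum>i\<le>n. K (hs ! i) (d i)) + K h y)"
      by (subst y) (simp only: linear_diff[OF lin] res_deriv.simps)
    have "norm (y - res_deriv (Suc n) x f hs) \<le> 2 * norm ((\<Sum>i\<le>n. K (hs ! i) (d i)) + K h y)"
      unfolding eq by (rule norm_res[OF f])
    also have "\<dots> \<le> 2 * (norm (\<Sum>i\<le>n. K (hs ! i) (d i)) + norm (K h y))"
      by (intro mult_left_mono norm_triangle_ineq) simp
    also have "norm (\<Sum>i\<le>n. K (hs ! i) (d i)) \<le> real (Suc n) * C * (B * L2_norm T h) * ?P"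
      unfolding d_def using hs f h fh B
      by (intro norm_sum_K_le) (auto simp: length_delete_nth intro!: delete_nth_in_lists B(2))
    also have "norm (K h y) \<le> C * L2_norm T h * (A * ?P)"
      using norm_K_le[OF h, of y] A(2)[OF L2_add[OF f(1) h] hs(1) fh hs(2)] C_nonneg
        mult_left_mono[of "norm y" "A * ?P" "C * L2_norm T h"]
      by (simp add: y_def)
    finally show "norm (res_deriv (Suc n) x ?fh hs - res_deriv (Suc n) x f hs)
        \<le> 2 * (real (Suc n) * C * B + C * A) * L2_norm T h * ?P"
      by (simp add: y_def algebra_simps)
  qed (use A B C_nonneg in auto)
qed

text \<open>The remainder again solves an equation at \<open>f\<close>. Its source consists of the
  remainders of lower order, which are quadratic by induction, and of \<open>K h\<close> applied to
  a difference of values, where the Lipschitz estimate supplies the second factor of the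
  norm.\<close>

lemma res_deriv_has_derivative:
  "\<exists>B\<ge>0. \<forall>f\<in>L2 T. \<forall>h\<in>L2 T. \<forall>hs\<in>lists (L2 T). \<nu> f < 1/2 \<longrightarrow> \<nu> (\<lambda>t. f t + h t) < 1/2 \<longrightarrow> length hs = n \<longrightarrow>
     norm (res_deriv n x (\<lambda>t. f t + h t) hs - res_deriv n x f hs - res_deriv (Suc n) x f (h # hs))
       \<le> B * (L2_norm T h)\<^sup>2 * prod_list (map (L2_norm T) hs)"
proof (induction n)
  case 0
  obtain B where B: "B \<ge> 0" "\<And>f h hs. f \<in> L2 T \<Longrightarrow> h \<in> L2 T \<Longrightarrow> hs \<in> lists (L2 T) \<Longrightarrow> \<nu> f < 1/2 \<Longrightarrow>
      \<nu> (\<lambda>t. f t + h t) < 1/2 \<Longrightarrow> length hs = 0 \<Longrightarrow>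
      norm (res_deriv 0 x (\<lambda>t. f t + h t) hs - res_deriv 0 x f hs)
       \<le> B * L2_norm T h * prod_list (map (L2_norm T) hs)"
    using res_deriv_lipschitz[of 0 x] by blast
  show ?case
  proof (intro exI[of _ "2 * (C * B)"] conjI ballI impI)
    fix f h and hs :: "(real \<Rightarrow> real) list"
    assume f: "f \<in> L2 T" "\<nu> f < 1/2" and h: "h \<in> L2 T"
      and fh: "\<nu> (\<lambda>t. f t + h t) < 1/2" and hs: "length hs = 0"
    define y where "y = res (\<lambda>t. f t + h t) x"
    have f1: "\<nu> f < 1" using f by simp
    note lin = linear_res[OF f(1) f1]
    have "y = res f (x + K h y)"
      unfolding y_def using f h fh by (intro res_add) auto
    then have "y - res f x = res f (K h y)"
      by (metis add_diff_cancel_left' linear_add[OF lin])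
    then have "y - res f x - res f (K h (res f x)) = res f (K h y) - res f (K h (res f x))"
      by simp
    also have "\<dots> = res f (K h (y - res f x))"
      by (simp only: linear_diff[OF lin] linear_diff[OF linear_K[OF h]])
    finally have eq: "y - res f x - res f (K h (res f x)) = res f (K h (y - res f x))" .
    have "norm (y - res f x - res f (K h (res f x))) \<le> 2 * norm (K h (y - res f x))"
      unfolding eq by (rule norm_res[OF f])
    also have "\<dots> \<le> 2 * (C * L2_norm T h * norm (y - res f x))"
      using norm_K_le[OF h] by simp
    also have "\<dots> \<le> 2 * (C * L2_norm T h * (B * L2_norm T h))"
      unfolding y_def using C_nonneg B(2)[OF f(1) h _ f(2) fh, of "[]"]
      by (intro mult_left_mono) auto
    finally show "norm (res_deriv 0 x (\<lambda>t. f t + h t) hs - res_deriv 0 x f hs - res_deriv (Suc 0) x f (h # hs))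
      \<le> 2 * (C * B) * (L2_norm T h)\<^sup>2 * prod_list (map (L2_norm T) hs)"
      using hs by (simp add: y_def mult_ac power2_eq_square)
  qed (use C_nonneg B in auto)
next
  case (Suc n)
  then obtain B where B: "B \<ge> 0" "\<And>f h hs. f \<in> L2 T \<Longrightarrow> h \<in> L2 T \<Longrightarrow> hs \<in> lists (L2 T) \<Longrightarrow> \<nu> f < 1/2 \<Longrightarrow>
      \<nu> (\<lambda>t. f t + h t) < 1/2 \<Longrightarrow> length hs = n \<Longrightarrow>
      norm (res_deriv n x (\<lambda>t. f t + h t) hs - res_deriv n x f hs - res_deriv (Suc n) x f (h # hs))
       \<le> B * (L2_norm T h)\<^sup>2 * prod_list (map (L2_norm T) hs)"
    by blast
  obtain A where A: "A \<ge> 0" "\<And>f h hs. f \<in> L2 T \<Longrightarrow> h \<in> L2 T \<Longrightarrow> hs \<in> lists (L2 T) \<Longrightarrow> \<nu> f < 1/2 \<Longrightarrow>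
      \<nu> (\<lambda>t. f t + h t) < 1/2 \<Longrightarrow> length hs = Suc n \<Longrightarrow>
      norm (res_deriv (Suc n) x (\<lambda>t. f t + h t) hs - res_deriv (Suc n) x f hs)
       \<le> A * L2_norm T h * prod_list (map (L2_norm T) hs)"
    using res_deriv_lipschitz[of "Suc n" x] by blast
  show ?case
  proof (intro exI[of _ "2 * (real (Suc n) * C * B + C * A)"] conjI ballI impI)
    fix f h hs assume f: "f \<in> L2 T" "\<nu> f < 1/2" and h: "h \<in> L2 T"
      and fh: "\<nu> (\<lambda>t. f t + h t) < 1/2" and hs: "hs \<in> lists (L2 T)" "length hs = Suc n"
    let ?P = "prod_list (map (L2_norm T) hs)"
    let ?fh = "\<lambda>t. f t + h t"
    define y where "y = res_deriv (Suc n) x ?fh hs"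
    define y0 where "y0 = res_deriv (Suc n) x f hs"
    define d where "d i = res_deriv n x ?fh (delete_nth i hs) - res_deriv n x f (delete_nth i hs)
      - res_deriv (Suc n) x f (h # delete_nth i hs)" for i
    have f1: "\<nu> f < 1" using f by simp
    note lin = linear_res[OF f(1) f1]
    have K: "linear (K (hs ! i))" if "i \<le> n" for i
      using that hs by (intro linear_K nth_in_L2) auto
    have y: "y = res f ((\<Sum>i\<le>n. K (hs ! i) (res_deriv n x ?fh (delete_nth i hs))) + K h y)"
      unfolding y_def res_deriv.simps(2)[of n x ?fh] using f h fh by (intro res_add) auto
    have y0: "y0 = res f (\<Sum>i\<le>n. K (hs ! i) (res_deriv n x f (delete_nth i hs)))"
      by (simp add: y0_def)
    \<comment> \<open>Index 0 removes the new direction \<open>h\<close> itself and leaves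
      \<open>y0\<close>; the remaining indices keep \<open>h\<close> at the head, as the induction
      hypothesis requires.\<close>
    have y1: "res_deriv (Suc (Suc n)) x f (h # hs)
        = res f (K h y0 + (\<Sum>i\<le>n. K (hs ! i) (res_deriv (Suc n) x f (h # delete_nth i hs))))"
      unfolding res_deriv.simps(2)[of "Suc n"] y0_def
      by (simp only: sum.atMost_Suc_shift nth_Cons_0 nth_Cons_Suc delete_nth_Cons_0 delete_nth_Cons_Suc)
    have "(\<Sum>i\<le>n. K (hs ! i) (d i)) = (\<Sum>i\<le>n. K (hs ! i) (res_deriv n x ?fh (delete_nth i hs)))
      - (\<Sum>i\<le>n. K (hs ! i) (res_deriv n x f (delete_nth i hs)))
      - (\<Sum>i\<le>n. K (hs ! i) (res_deriv (Suc n) x f (h # delete_nth i hs)))"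
      by (simp add: d_def linear_diff[OF K] sum_subtractf del: res_deriv.simps)
    then have "res f ((\<Sum>i\<le>n. K (hs ! i) (d i)) + K h (y - y0))
        = y - y0 - res_deriv (Suc (Suc n)) x f (h # hs)"
      unfolding y1 by (subst y, subst y0)
        (simp add: linear_add[OF lin] linear_diff[OF lin] linear_diff[OF linear_K[OF h]] del: res_deriv.simps)
    then have "norm (y - y0 - res_deriv (Suc (Suc n)) x f (h # hs))
        \<le> 2 * norm ((\<Sum>i\<le>n. K (hs ! i) (d i)) + K h (y - y0))"
      using norm_res[OF f] by metis
    also have "\<dots> \<le> 2 * (norm (\<Sum>i\<le>n. K (hs ! i) (d i)) + norm (K h (y - y0)))"
      by (intro mult_left_mono norm_triangle_ineq) simp
    also have "norm (\<Sum>i\<le>n. K (hs ! i) (d i)) \<le> real (Suc n) * C * (B * (L2_norm T h)\<^sup>2) * ?P"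
      unfolding d_def using hs f h fh B(1)
      by (intro norm_sum_K_le B(2) delete_nth_in_lists) (auto simp: length_delete_nth)
    also have "norm (K h (y - y0)) \<le> C * L2_norm T h * (A * L2_norm T h * ?P)"
      using norm_K_le[OF h, of "y - y0"] A(2)[OF f(1) h hs(1) f(2) fh hs(2)] C_nonneg
        mult_left_mono[of "norm (y - y0)" "A * L2_norm T h * ?P" "C * L2_norm T h"]
      unfolding y_def y0_def by simp
    finally show "norm (res_deriv (Suc n) x ?fh hs - res_deriv (Suc n) x f hs - res_deriv (Suc (Suc n)) x f (h # hs))
        \<le> 2 * (real (Suc n) * C * B + C * A) * (L2_norm T h)\<^sup>2 * ?P"
      by (simp add: y_def y0_def algebra_simps power2_eq_square del: res_deriv.simps)
  qed (use A B C_nonneg in auto)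
qed

lemma bounded_multilinear_res_deriv:
  fixes l :: "'x \<Rightarrow> real"
  assumes l: "bounded_linear l" and f: "f \<in> L2 T" "\<nu> f < 1/2"
  shows "bounded_multilinear_form T n (\<lambda>hs. l (res_deriv n x f hs))"
proof -
  have f1: "\<nu> f < 1" using f by simp
  obtain B where B: "\<And>hs. hs \<in> lists (L2 T) \<Longrightarrow> length hs = n \<Longrightarrow>
      norm (res_deriv n x f hs) \<le> B * prod_list (map (L2_norm T) hs)"
    using norm_res_deriv[of n x] f by blast
  obtain c where c: "\<And>x. norm (l x) \<le> norm x * c" "c \<ge> 0"
    using bounded_linear.nonneg_bounded[OF l] by blast
  have "\<bar>l (res_deriv n x f hs)\<bar> \<le> c * B * prod_list (map (L2_norm T) hs)"
    if "hs \<in> lists (L2 T)" "length hs = n" for hs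
  proof -
    have "\<bar>l (res_deriv n x f hs)\<bar> \<le> norm (res_deriv n x f hs) * c"
      using c(1) by simp
    also have "\<dots> \<le> B * prod_list (map (L2_norm T) hs) * c"
      using B[OF that] c(2) by (rule mult_right_mono)
    finally show ?thesis by (simp add: mult_ac)
  qed
  then show ?thesis
    unfolding bounded_multilinear_form_def
    using res_deriv_lincomb[OF f(1) f1]
    by (auto simp: linear_add[OF bounded_linear.linear[OF l]] linear_scale[OF bounded_linear.linear[OF l]])
qed

lemma eventually_\<nu>_less:
  assumes f: "f \<in> L2 T" and \<nu>: "\<nu> f < r"
  shows "\<forall>\<^sub>F h in L2_nhds_zero T. \<nu> (\<lambda>t. f t + h t) < r"
  unfolding eventually_L2_nhds_zero
proof (intro exI[of _ "(r - \<nu> f) / (C + 1)"] conjI ballI impI)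
  fix h assume h: "h \<in> L2 T" and small: "L2_norm T h < (r - \<nu> f) / (C + 1)"
  have "C * L2_norm T h \<le> (C + 1) * L2_norm T h"
    by (simp add: mult_right_mono)
  also have "\<dots> < r - \<nu> f"
    using small C_nonneg by (simp add: field_simps)
  finally show "\<nu> (\<lambda>t. f t + h t) < r"
    using \<nu>_add[OF f h] \<nu>_le[OF h] by linarith
qed (use \<nu> C_nonneg in auto)

lemma eventually_in_L2: "\<forall>\<^sub>F h in L2_nhds_zero T. h \<in> L2 T"
  unfolding eventually_L2_nhds_zero by (intro exI[of _ 1]) simp

text \<open>The condition on \<nu> is open, so the explicit candidate is available at all nearby
  controls, and induction over arbitrary base points matches the recursive definition. The quadratic
  remainder of \<open>res_deriv_has_derivative\<close> gives the derivative in operator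
  norm.\<close>

lemma has_frechet_differential_res:
  fixes l :: "'x \<Rightarrow> real"
  assumes l: "bounded_linear l"
    and J: "\<And>f. f \<in> L2 T \<Longrightarrow> \<nu> f < 1/2 \<Longrightarrow> J f = l (res f x)"
    and f: "f \<in> L2 T" "\<nu> f < 1/2"
  shows "has_frechet_differential T J n f (\<lambda>hs. l (res_deriv n x f hs))"
  using f
proof (induction n arbitrary: f)
  case 0
  then show ?case by (simp add: J)
next
  case (Suc n)
  obtain B where B: "B \<ge> 0" "\<And>h hs. h \<in> L2 T \<Longrightarrow> hs \<in> lists (L2 T) \<Longrightarrow>
      \<nu> (\<lambda>t. f t + h t) < 1/2 \<Longrightarrow> length hs = n \<Longrightarrow>
      norm (res_deriv n x (\<lambda>t. f t + h t) hs - res_deriv n x f hs - res_deriv (Suc n) x f (h # hs))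
       \<le> B * (L2_norm T h)\<^sup>2 * prod_list (map (L2_norm T) hs)"
    using res_deriv_has_derivative[of n x] Suc.prems by blast
  obtain c where c: "\<And>x. norm (l x) \<le> norm x * c" "c \<ge> 0"
    using bounded_linear.nonneg_bounded[OF l] by blast
  note ev = eventually_in_L2 eventually_\<nu>_less[OF Suc.prems]
  show ?case
    unfolding has_frechet_differential.simps(2)
  proof (intro conjI exI[of _ "\<lambda>f hs. l (res_deriv n x f hs)"] allI impI)
    show "bounded_multilinear_form T (Suc n) (\<lambda>hs. l (res_deriv (Suc n) x f hs))"
      using bounded_multilinear_res_deriv[OF l Suc.prems] .
    show "\<forall>\<^sub>F h in L2_nhds_zero T. has_frechet_differential T J n (\<lambda>t. f t + h t)
            (\<lambda>hs. l (res_deriv n x (\<lambda>t. f t + h t) hs))"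
      using ev by eventually_elim (intro Suc.IH L2_add Suc.prems)
    fix \<epsilon> :: real assume "\<epsilon> > 0"
    have "\<forall>\<^sub>F h in L2_nhds_zero T. L2_norm T h < \<epsilon> / (B * c + 1)"
      unfolding eventually_L2_nhds_zero using \<open>\<epsilon> > 0\<close> B(1) c(2)
      by (intro exI[of _ "\<epsilon> / (B * c + 1)"]) (auto simp: add_nonneg_pos)
    with ev show "\<forall>\<^sub>F h in L2_nhds_zero T. \<forall>hs\<in>lists (L2 T). length hs = n \<longrightarrow>
        \<bar>l (res_deriv n x (\<lambda>t. f t + h t) hs) - l (res_deriv n x f hs) - l (res_deriv (Suc n) x f (h # hs))\<bar>
          \<le> \<epsilon> * L2_norm T h * prod_list (map (L2_norm T) hs)"
    proof eventually_elim
      case (elim h)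
      have \<epsilon>: "B * c * L2_norm T h \<le> \<epsilon>"
      proof -
        have "B * c * L2_norm T h \<le> (B * c + 1) * L2_norm T h"
          by (simp add: mult_right_mono)
        also have "\<dots> < \<epsilon>"
          using elim(3) B(1) c(2) by (simp add: pos_less_divide_eq add_nonneg_pos mult.commute)
        finally show ?thesis by simp
      qed
      show ?case
      proof (intro ballI impI)
        fix hs assume hs: "hs \<in> lists (L2 T)" "length hs = n"
        let ?P = "prod_list (map (L2_norm T) hs)"
        let ?v = "res_deriv n x (\<lambda>t. f t + h t) hs - res_deriv n x f hs - res_deriv (Suc n) x f (h # hs)"
        have "\<bar>l ?v\<bar> \<le> norm ?v * c"
          using c(1)[of ?v] by (simp del: res_deriv.simps)
        also have "\<dots> \<le> B * (L2_norm T h)\<^sup>2 * ?P * c"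
          using B(2)[OF elim(1) hs(1) elim(2) hs(2)] c(2) by (rule mult_right_mono)
        also have "\<dots> = B * c * L2_norm T h * (L2_norm T h * ?P)"
          by (simp add: power2_eq_square mult_ac)
        also have "\<dots> \<le> \<epsilon> * (L2_norm T h * ?P)"
          using \<epsilon> by (rule mult_right_mono) simp
        finally show "\<bar>l (res_deriv n x (\<lambda>t. f t + h t) hs) - l (res_deriv n x f hs)
              - l (res_deriv (Suc n) x f (h # hs))\<bar> \<le> \<epsilon> * L2_norm T h * ?P"
          by (simp only: linear_diff[OF bounded_linear.linear[OF l]] mult.assoc)
      qed
    qed
  qed
qed

section \<open>Neumann expansion at the zero control\<close>

lemma K_zero: "K (\<lambda>_. 0) x = 0"
  using K_lincomb[OF L2_zero L2_zero, of 0 0 x] by simp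

lemma \<nu>_zero: "\<nu> (\<lambda>_. 0) = 0"
  using \<nu>_le[OF L2_zero] \<nu>_nonneg[OF L2_zero] by simp

lemma res_zero: "res (\<lambda>_. 0) x = x"
  by (rule res_unique) (simp_all add: \<nu>_zero K_zero)

text \<open>At the zero control the resolvent is the identity, and with equal directions all n + 1
  summands of the recursion coincide; their number builds up the factorial.\<close>

lemma res_deriv_zero_diagonal:
  assumes d: "d \<in> L2 T"
  shows "res_deriv n x (\<lambda>_. 0) (replicate n d) = fact n *\<^sub>R (K d ^^ n) x"
proof (induction n)
  case 0
  show ?case by (simp add: res_zero)
next
  case (Suc n)
  have "res_deriv (Suc n) x (\<lambda>_. 0) (replicate (Suc n) d)
      = (\<Sum>i\<le>n. K d (fact n *\<^sub>R (K d ^^ n) x))"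
    unfolding res_deriv.simps res_zero
    using Suc by (intro sum.cong) (auto simp: delete_nth_replicate simp del: replicate.simps)
  also have "\<dots> = fact (Suc n) *\<^sub>R (K d ^^ Suc n) x"
    by (simp add: linear_scale[OF linear_K[OF d]] scaleR_conv_of_real algebra_simps)
      (simp add: sum_constant_scaleR algebra_simps)
  finally show ?case .
qed

text \<open>Substituting the equation into itself gives the Neumann series with an exact remainder,
  so no limit is taken.\<close>

lemma res_expansion:
  assumes f: "f \<in> L2 T" "\<nu> f < 1"
  shows "res f x = (\<Sum>i<n. (K f ^^ i) x) + (K f ^^ n) (res f x)"
proof (induction n)
  case 0
  show ?case by simp
next
  case (Suc n)
  have lin: "linear (K f ^^ n)"
  proof (induction n)
    case (Suc n)
    show ?case
      using linear_compose[OF Suc linear_K[OF f(1)]] by (simp add: o_def)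
  qed (simp add: linearI)
  have "(K f ^^ n) (res f x) = (K f ^^ n) (x + K f (res f x))"
    by (rule arg_cong[OF res_eq[OF f]])
  also have "\<dots> = (K f ^^ n) x + (K f ^^ Suc n) (res f x)"
    by (simp add: linear_add[OF lin] funpow_swap1)
  finally show ?case using Suc by (simp add: add.assoc)
qed

lemma norm_K_power:
  assumes f: "f \<in> L2 T"
  shows "norm ((K f ^^ n) x) \<le> (C * L2_norm T f) ^ n * norm x"
proof (induction n)
  case (Suc n)
  have "norm ((K f ^^ Suc n) x) \<le> C * L2_norm T f * norm ((K f ^^ n) x)"
    using norm_K_le[OF f] by simp
  also have "\<dots> \<le> C * L2_norm T f * ((C * L2_norm T f) ^ n * norm x)"
    using Suc C_nonneg by (intro mult_left_mono) auto
  finally show ?case by (simp add: mult_ac)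
qed simp

lemma K_power_scale:
  assumes f: "f \<in> L2 T"
  shows "(K (\<lambda>t. s * f t) ^^ n) x = s ^ n *\<^sub>R (K f ^^ n) x"
proof (induction n)
  case (Suc n)
  have "K (\<lambda>t. s * f t) y = s *\<^sub>R K f y" for y
    using K_lincomb[OF f f, of s 0 y] by simp
  with Suc show ?case by (simp add: linear_scale[OF linear_K[OF f]])
qed simp

end

section \<open>Absolutely continuous functions and integrals\<close>

lemma absolutely_continuous_onE:
  assumes "absolutely_continuous_on S g" and "e > 0"
  obtains \<delta> where "\<delta> > 0" "\<And>\<D> X. \<D> division_of X \<Longrightarrow> X \<subseteq> S \<Longrightarrow> (\<Sum>K\<in>\<D>. Sup K - Inf K) < \<delta> \<Longrightarrow>
        (\<Sum>K\<in>\<D>. norm (g (Sup K) - g (Inf K))) < e"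
proof -
  have "\<exists>\<delta>>0. \<forall>\<D> X. \<D> division_of X \<and> X \<subseteq> S \<and> (\<Sum>K\<in>\<D>. Sup K - Inf K) < \<delta> \<longrightarrow>
        (\<Sum>K\<in>\<D>. norm (g (Sup K) - g (Inf K))) < e"
    using assms(1) unfolding absolutely_continuous_on_def by (elim allE) (erule mp, rule assms(2))
  then show thesis
    by (elim exE conjE) (rule that, assumption, blast)
qed

text \<open>A gauge argument. At tags outside \<open>N\<close> the derivative matches each Riemann
  term with the increment of \<open>F\<close>. At tags in \<open>N\<close> the gauge confines the
  intervals to an open set of small measure, where absolute continuity bounds the sum of the
  increments.\<close>

lemma fundamental_theorem_of_calculus_AC:
  fixes F :: "real \<Rightarrow> 'a::banach"
  assumes "a \<le> b" and ac: "absolutely_continuous_on {a..b} F" and N: "negligible N"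
    and der: "\<And>t. t \<in> {a..b} - N \<Longrightarrow> (F has_vector_derivative F' t) (at t within {a..b})"
  shows "(F' has_integral (F b - F a)) {a..b}"
proof -
  \<comment> \<open>Changing the integrand on a null set is free; the value 0 leaves only the
    increments of \<open>F\<close> at tags in \<open>N\<close>.\<close>
  define g where "g t = (if t \<in> N then 0 else F' t)" for t
  have "(g has_integral (F b - F a)) {a..b}"
    unfolding has_integral_real
  proof (intro allI impI)
    fix e :: real assume e: "e > 0"
    obtain \<delta> where \<delta>: "\<delta> > 0" "\<And>\<D> X. \<D> division_of X \<Longrightarrow> X \<subseteq> {a..b} \<Longrightarrow> (\<Sum>K\<in>\<D>. Sup K - Inf K) < \<delta> \<Longrightarrow>
        (\<Sum>K\<in>\<D>. norm (F (Sup K) - F (Inf K))) < e / 2"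
      by (rule absolutely_continuous_onE[OF ac half_gt_zero[OF e]]) (rule that, assumption, blast)
    \<comment> \<open>Since \<open>N\<close> has measure 0, the whole of \<open>G\<close> has
      measure below \<delta>, and it can serve as the gauge at every point of
      \<open>N\<close>.\<close>
    obtain G where G: "open G" "N \<subseteq> G" "G - N \<in> lmeasurable" "emeasure lebesgue (G - N) < ennreal \<delta>"
      using sets_lebesgue_outer_open[OF negligible_imp_sets[OF N] \<delta>(1)] by blast
    have Neq: "N \<union> (G - N) = G" using G by blast
    have G': "G \<in> lmeasurable" "measure lebesgue G < \<delta>"
    proof -
      show "G \<in> lmeasurable"
        using fmeasurable.Un[OF negligible_imp_measurable[OF N] G(3)] Neq by simp
      have "measure lebesgue G \<le> measure lebesgue N + measure lebesgue (G - N)"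
        using measure_Un_le[of N lebesgue "G - N"] negligible_imp_sets[OF N] G(3) Neq by auto
      also have "\<dots> < \<delta>"
        using G(3,4) \<delta>(1) negligible_imp_measure0[OF N] by (simp add: emeasure_eq_measure2 ennreal_less_iff)
      finally show "measure lebesgue G < \<delta>" .
    qed
    \<comment> \<open>Chosen so that the error over intervals with tags outside \<open>N\<close>
      totals at most e / 2; the summand 1 covers a = b.\<close>
    define e' where "e' = e / (4 * (b - a + 1))"
    have e': "e' > 0" using e \<open>a \<le> b\<close> by (simp add: e'_def)
    have "\<exists>d>0. t \<in> {a..b} - N \<longrightarrow> (\<forall>y\<in>{a..b}. \<bar>y - t\<bar> < d \<longrightarrow>
        norm (F y - F t - (y - t) *\<^sub>R F' t) \<le> e' * \<bar>y - t\<bar>)" for t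
    proof (cases "t \<in> {a..b} - N")
      case True
      then show ?thesis
        using der[OF True] e' unfolding has_vector_derivative_def has_derivative_within_alt by auto
    qed (auto intro: exI[of _ 1])
    then obtain d where d: "\<And>t. d t > 0" "\<And>t y. t \<in> {a..b} - N \<Longrightarrow> y \<in> {a..b} \<Longrightarrow> \<bar>y - t\<bar> < d t \<Longrightarrow>
        norm (F y - F t - (y - t) *\<^sub>R F' t) \<le> e' * \<bar>y - t\<bar>"
      by metis
    define \<gamma> where "\<gamma> t = (if t \<in> N then G else ball t (d t))" for t
    have gauge: "gauge \<gamma>"
      using G d(1) by (auto simp: gauge_def \<gamma>_def)
    have main: "norm ((\<Sum>(x, K)\<in>p. measure lborel K *\<^sub>R g x) - (F b - F a)) < e"
      if p: "p tagged_division_of {a..b}" and fine: "\<gamma> fine p" for p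
    proof -
      note p' = tagged_division_ofD[OF p]
      define q where "q = {(x, K) \<in> p. x \<in> N}"
      let ?\<Delta> = "\<lambda>K. F (Sup K) - F (Inf K)"
      have "finite p" using p' by blast
      have fin: "finite q" "q \<subseteq> p"
        using finite_subset[OF _ \<open>finite p\<close>, of q] by (auto simp: q_def)
      have K: "\<exists>u v. K = {u..v} \<and> u \<le> x \<and> x \<le> v \<and> a \<le> u \<and> v \<le> b" if "(x, K) \<in> p" for x K
      proof -
        obtain u v where "K = cbox u v" using p'(4) \<open>(x, K) \<in> p\<close> by blast
        then show ?thesis using p'(2,3) \<open>(x, K) \<in> p\<close> by fastforce
      qed
      have "(\<Sum>(x, K)\<in>p. measure lborel K *\<^sub>R g x) - (F b - F a)
          = (\<Sum>(x, K)\<in>p. measure lborel K *\<^sub>R g x - ?\<Delta> K)"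
        using additive_tagged_division_1[OF \<open>a \<le> b\<close> p, of F]
        by (simp add: sum_subtractf split_def)
      also have "\<dots> = (\<Sum>(x, K)\<in>p - q. measure lborel K *\<^sub>R g x - ?\<Delta> K) + (\<Sum>(x, K)\<in>q. measure lborel K *\<^sub>R g x - ?\<Delta> K)"
        using \<open>finite p\<close> fin by (simp add: sum.subset_diff)
      also have "norm \<dots> \<le> (\<Sum>(x, K)\<in>p - q. e' * measure lborel K) + (\<Sum>(x, K)\<in>q. norm (?\<Delta> K))"
      proof (rule norm_triangle_le, rule add_mono)
        show "norm (\<Sum>(x, K)\<in>p - q. measure lborel K *\<^sub>R g x - ?\<Delta> K) \<le> (\<Sum>(x, K)\<in>p - q. e' * measure lborel K)"
        proof (rule sum_norm_le, clarify)
          fix x K assume xK: "(x, K) \<in> p" "(x, K) \<notin> q"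
          obtain u v where uv: "K = {u..v}" "u \<le> x" "x \<le> v" "a \<le> u" "v \<le> b" using K xK(1) by blast
          have x: "x \<in> {a..b} - N" using xK uv by (auto simp: q_def)
          have "K \<subseteq> ball x (d x)" using fineD[OF fine xK(1)] x by (simp add: \<gamma>_def)
          moreover have "u \<in> K" "v \<in> K" using uv by auto
          ultimately have "u \<in> ball x (d x)" "v \<in> ball x (d x)" by blast+
          then have "norm (F v - F x - (v - x) *\<^sub>R F' x) \<le> e' * (v - x)"
            "norm (F u - F x - (u - x) *\<^sub>R F' x) \<le> e' * (x - u)"
            using d(2)[OF x, of v] d(2)[OF x, of u] uv by (auto simp: dist_real_def abs_minus_commute)
          then have "norm ((F u - F x - (u - x) *\<^sub>R F' x) - (F v - F x - (v - x) *\<^sub>R F' x)) \<le> e' * (v - u)"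
            using norm_triangle_ineq4[of "F u - F x - (u - x) *\<^sub>R F' x" "F v - F x - (v - x) *\<^sub>R F' x"]
            by (simp add: algebra_simps)
          then show "norm (measure lborel K *\<^sub>R g x - ?\<Delta> K) \<le> e' * measure lborel K"
            using uv x by (simp add: g_def algebra_simps)
        qed
        have "norm (measure lborel K *\<^sub>R g x - ?\<Delta> K) = norm (?\<Delta> K)" if "(x, K) \<in> q" for x K
          using that by (simp add: q_def g_def norm_minus_commute)
        then show "norm (\<Sum>(x, K)\<in>q. measure lborel K *\<^sub>R g x - ?\<Delta> K) \<le> (\<Sum>(x, K)\<in>q. norm (?\<Delta> K))"
          by (intro sum_norm_le) auto
      qed
      also have "(\<Sum>(x, K)\<in>p - q. e' * measure lborel K) \<le> (\<Sum>(x, K)\<in>p. e' * measure lborel K)"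
        using \<open>finite p\<close> e' by (intro sum_mono2) auto
      also have "\<dots> = e' * (b - a)"
        using additive_content_tagged_division[of p a b] p \<open>a \<le> b\<close>
        by (simp add: split_def flip: sum_distrib_left)
      also have "\<dots> \<le> e / 2"
      proof -
        have "e' * (b - a) \<le> e' * (2 * (b - a + 1))"
          using e' \<open>a \<le> b\<close> by (intro mult_left_mono) auto
        also have "\<dots> = e / 2"
          using \<open>a \<le> b\<close> by (simp add: e'_def field_simps)
        finally show ?thesis .
      qed
      also have "(\<Sum>(x, K)\<in>q. norm (?\<Delta> K)) < e / 2"
      proof -
        define X where "X = \<Union>(snd ` q)"
        have qpart: "q tagged_partial_division_of {a..b}"
          using p fin(2) tagged_partial_division_subset unfolding tagged_division_of_def by blast
        have q: "q tagged_division_of X"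
          unfolding X_def by (rule tagged_partial_division_of_Union_self[OF qpart])
        have div: "snd ` q division_of X"
          by (rule division_of_tagged_division[OF q])
        have X: "X \<subseteq> {a..b}" "X \<subseteq> G"
          using K fin(2) fineD[OF fine] by (fastforce simp: X_def q_def \<gamma>_def)+
        have "Sup L - Inf L = measure lebesgue L" if L: "L \<in> snd ` q" for L
        proof -
          obtain x where "(x, L) \<in> p"
            using L fin(2) by auto
          from K[OF this] obtain u v where "L = {u..v}" "u \<le> x" "x \<le> v"
            by blast
          then show ?thesis by simp
        qed
        then have "(\<Sum>K\<in>snd ` q. Sup K - Inf K) = (\<Sum>K\<in>snd ` q. measure lebesgue K)"
          by (rule sum.cong[OF refl])
        also have "\<dots> = measure lebesgue X"
          using content_division[OF div] .
        also have "\<dots> \<le> measure lebesgue G"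
          using X(2) G'(1) lmeasurable_division[OF div]
          by (intro measure_mono_fmeasurable) (auto simp: fmeasurable_def)
        finally have "(\<Sum>K\<in>snd ` q. norm (?\<Delta> K)) < e / 2"
          using G'(2) \<delta>(2)[OF div X(1)] by linarith
        moreover have "(\<Sum>(x, K)\<in>q. norm (?\<Delta> K)) = (\<Sum>K\<in>snd ` q. norm (?\<Delta> K))"
        proof -
          \<comment> \<open>Two tags may share a degenerate interval, so the sums over tags and over
            intervals agree only because such intervals have increment 0. The patch concerns the
            empty set, where \<open>Sup\<close> and \<open>Inf\<close> are unspecified
            values.\<close>
          define D where "D K = (if K = {} then 0 else norm (?\<Delta> K))" for K
          have DK: "D K = norm (?\<Delta> K)" if "(x, K) \<in> q" for x K
            using K[of x K] that fin(2) by (force simp: D_def)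
          have "(\<Sum>(x, K)\<in>q. D K) = (\<Sum>K\<in>snd ` q. D K)"
            by (rule sum.over_tagged_division_lemma[OF q]) (auto simp: D_def not_less)
          moreover have "(\<Sum>K\<in>snd ` q. D K) = (\<Sum>K\<in>snd ` q. norm (?\<Delta> K))"
            using DK by (intro sum.cong) auto
          moreover have "(\<Sum>(x, K)\<in>q. D K) = (\<Sum>(x, K)\<in>q. norm (?\<Delta> K))"
            using DK by (intro sum.cong) auto
          ultimately show ?thesis by simp
        qed
        ultimately show ?thesis by simp
      qed
      finally show ?thesis by simp
    qed
    show "\<exists>\<gamma>. gauge \<gamma> \<and> (\<forall>p. p tagged_division_of {a..b} \<and> \<gamma> fine p \<longrightarrow>
        norm ((\<Sum>(x, K)\<in>p. measure lborel K *\<^sub>R g x) - (F b - F a)) < e)"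
    proof (intro exI[of _ \<gamma>] conjI allI impI)
      fix p assume "p tagged_division_of {a..b} \<and> \<gamma> fine p"
      then show "norm ((\<Sum>(x, K)\<in>p. measure lborel K *\<^sub>R g x) - (F b - F a)) < e"
        by (elim conjE) (rule main)
    qed (rule gauge)
  qed
  then show ?thesis
    by (rule has_integral_spike[OF N, rotated]) (simp add: g_def)
qed

text \<open>Square integrability gives a direct proof by Young's inequality p \<le> \<eta> p^2 + 1 /
  (4 \<eta>): over any division the first terms add up to at most \<eta> times a fixed integral, and
  the second ones to the total length over 4 \<eta>.\<close>

lemma absolutely_continuous_on_if_integral_bound:
  fixes U :: "real \<Rightarrow> 'a::real_normed_vector" and p :: "real \<Rightarrow> real"
  assumes p: "p integrable_on {a..b}" and p2: "(\<lambda>t. (p t)\<^sup>2) integrable_on {a..b}"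
    and bound: "\<And>u v. a \<le> u \<Longrightarrow> u \<le> v \<Longrightarrow> v \<le> b \<Longrightarrow> norm (U v - U u) \<le> integral {u..v} p"
  shows "absolutely_continuous_on {a..b} U"
  unfolding absolutely_continuous_on_def
proof (intro allI impI)
  fix e :: real assume e: "e > 0"
  define Q where "Q = integral {a..b} (\<lambda>t. (p t)\<^sup>2)"
  have Q: "Q \<ge> 0" unfolding Q_def by (rule integral_nonneg[OF p2]) simp
  \<comment> \<open>Makes \<eta> Q at most e / 2; a total length below 2 \<eta> e then contributes
    less than e / 2 through the second terms.\<close>
  define \<eta> where "\<eta> = e / (2 * (Q + 1))"
  have \<eta>: "\<eta> > 0" using e Q by (simp add: \<eta>_def)
  show "\<exists>\<delta>>0. \<forall>\<D> X. \<D> division_of X \<and> X \<subseteq> {a..b} \<and> (\<Sum>K\<in>\<D>. Sup K - Inf K) < \<delta> \<longrightarrow>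
        (\<Sum>K\<in>\<D>. norm (U (Sup K) - U (Inf K))) < e"
  proof (intro exI[of _ "2 * \<eta> * e"] conjI allI impI)
    show "2 * \<eta> * e > 0" using e \<eta> by simp
    fix \<D> X assume D: "\<D> division_of X \<and> X \<subseteq> {a..b} \<and> (\<Sum>K\<in>\<D>. Sup K - Inf K) < 2 * \<eta> * e"
    have "norm (U (Sup K) - U (Inf K)) \<le> \<eta> * integral K (\<lambda>t. (p t)\<^sup>2) + (Sup K - Inf K) / (4 * \<eta>)"
      if K: "K \<in> \<D>" for K
    proof -
      obtain u v where uv: "K = {u..v}" "u \<le> v" "a \<le> u" "v \<le> b"
        using division_ofD(2-4)[of \<D> X K] D K
        by (metis atLeastatMost_empty_iff2 atLeastatMost_subset_iff box_real(2) order_trans)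
      have int: "p integrable_on {u..v}" "(\<lambda>t. (p t)\<^sup>2) integrable_on {u..v}"
        using p p2 uv by (auto intro: integrable_subinterval_real)
      have "p t \<le> \<eta> * (p t)\<^sup>2 + 1 / (4 * \<eta>)" for t
      proof -
        have "0 \<le> (2 * \<eta> * p t - 1)\<^sup>2 / (4 * \<eta>)" using \<eta> by simp
        also have "\<dots> = \<eta> * (p t)\<^sup>2 + 1 / (4 * \<eta>) - p t"
          using \<eta> by (simp add: power2_eq_square field_simps)
        finally show ?thesis by simp
      qed
      then have "integral {u..v} p \<le> integral {u..v} (\<lambda>t. \<eta> * (p t)\<^sup>2 + 1 / (4 * \<eta>))"
        using int by (intro integral_le integrable_add integrable_on_mult_right integrable_const_ivl) auto
      also have "\<dots> = \<eta> * integral {u..v} (\<lambda>t. (p t)\<^sup>2) + (v - u) / (4 * \<eta>)"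
        using int uv by (subst integral_add) (auto intro: integrable_on_mult_right)
      finally show ?thesis using bound[of u v] uv by simp
    qed
    then have "(\<Sum>K\<in>\<D>. norm (U (Sup K) - U (Inf K)))
        \<le> (\<Sum>K\<in>\<D>. \<eta> * integral K (\<lambda>t. (p t)\<^sup>2) + (Sup K - Inf K) / (4 * \<eta>))"
      by (rule sum_mono)
    also have "\<dots> = \<eta> * (\<Sum>K\<in>\<D>. integral K (\<lambda>t. (p t)\<^sup>2)) + (\<Sum>K\<in>\<D>. Sup K - Inf K) / (4 * \<eta>)"
      by (simp add: sum.distrib sum_distrib_left sum_divide_distrib)
    also have "(\<Sum>K\<in>\<D>. integral K (\<lambda>t. (p t)\<^sup>2)) \<le> Q"
    proof -
      have X: "(\<lambda>t. (p t)\<^sup>2) integrable_on X"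
        using integrable_on_subdivision[of \<D> X "\<lambda>t. (p t)\<^sup>2" "{a..b}"] D p2 by blast
      have "(\<Sum>K\<in>\<D>. integral K (\<lambda>t. (p t)\<^sup>2)) = integral X (\<lambda>t. (p t)\<^sup>2)"
        using integral_combine_division_topdown[OF X, of \<D>] D by simp
      also have "\<dots> \<le> Q"
        unfolding Q_def using D X p2 by (intro integral_subset_le) auto
      finally show ?thesis .
    qed
    also have "(\<Sum>K\<in>\<D>. Sup K - Inf K) / (4 * \<eta>) < 2 * \<eta> * e / (4 * \<eta>)"
      using D \<eta> by (intro divide_strict_right_mono) auto
    also have "\<eta> * Q + 2 * \<eta> * e / (4 * \<eta>) \<le> e"
    proof -
      have "\<eta> * Q \<le> \<eta> * (Q + 1)" using \<eta> by simp
      also have "\<dots> = e / 2" using Q by (simp add: \<eta>_def field_simps)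
      finally show ?thesis using \<eta> by simp
    qed
    finally show "(\<Sum>K\<in>\<D>. norm (U (Sup K) - U (Inf K))) < e" using \<eta> by simp
  qed
qed

lemma absolutely_continuous_on_imp_continuous_on:
  fixes F :: "real \<Rightarrow> 'a::real_normed_vector"
  assumes ac: "absolutely_continuous_on {a..b} F"
  shows "continuous_on {a..b} F"
  unfolding continuous_on_iff
proof (intro ballI allI impI)
  fix x e :: real assume x: "x \<in> {a..b}" and e: "e > 0"
  obtain \<delta> where \<delta>: "\<delta> > 0" "\<And>\<D> X. \<D> division_of X \<Longrightarrow> X \<subseteq> {a..b} \<Longrightarrow> (\<Sum>K\<in>\<D>. Sup K - Inf K) < \<delta> \<Longrightarrow>
        (\<Sum>K\<in>\<D>. norm (F (Sup K) - F (Inf K))) < e"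
    by (rule absolutely_continuous_onE[OF ac e]) (rule that, assumption, blast)
  have *: "norm (F v - F u) < e" if "u \<le> v" "u \<in> {a..b}" "v \<in> {a..b}" "v - u < \<delta>" for u v
  proof -
    have "{{u..v}} division_of {u..v}"
      using that division_of_self[of u v] by simp
    from \<delta>(2)[OF this] show ?thesis using that by simp
  qed
  show "\<exists>d>0. \<forall>y\<in>{a..b}. dist y x < d \<longrightarrow> dist (F y) (F x) < e"
  proof (intro exI[of _ \<delta>] conjI ballI impI)
    fix y assume "y \<in> {a..b}" "dist y x < \<delta>"
    then show "dist (F y) (F x) < e"
      using *[of x y] *[of y x] x by (cases "x \<le> y") (auto simp: dist_norm norm_minus_commute)
  qed (rule \<delta>)
qed

lemma (in bounded_bilinear) absolutely_continuous_on_prod: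
  fixes F :: "real \<Rightarrow> 'a" and G :: "real \<Rightarrow> 'b"
  assumes F: "absolutely_continuous_on {a..b} F" and G: "absolutely_continuous_on {a..b} G"
  shows "absolutely_continuous_on {a..b} (\<lambda>t. prod (F t) (G t))"
  unfolding absolutely_continuous_on_def
proof (intro allI impI)
  fix e :: real assume e: "e > 0"
  obtain k where k: "k > 0" "\<And>x y. norm (prod x y) \<le> norm x * norm y * k"
    using pos_bounded by blast
  have "bounded (F ` {a..b})" "bounded (G ` {a..b})"
    using F G by (auto intro!: compact_imp_bounded compact_continuous_image absolutely_continuous_on_imp_continuous_on)
  then obtain A B where AB: "\<And>t. t \<in> {a..b} \<Longrightarrow> norm (F t) \<le> A" "\<And>t. t \<in> {a..b} \<Longrightarrow> norm (G t) \<le> B"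
    unfolding bounded_iff by blast
  define M where "M = max 1 (max A B)"
  have M: "M > 0" "\<And>t. t \<in> {a..b} \<Longrightarrow> norm (F t) \<le> M" "\<And>t. t \<in> {a..b} \<Longrightarrow> norm (G t) \<le> M"
    using AB by (simp_all add: M_def le_max_iff_disj)
  define e' where "e' = e / (2 * M * k)"
  have e': "e' > 0" using e M k by (simp add: e'_def)
  obtain \<delta> where \<delta>: "\<delta> > 0" "\<And>\<D> X. \<D> division_of X \<Longrightarrow> X \<subseteq> {a..b} \<Longrightarrow> (\<Sum>K\<in>\<D>. Sup K - Inf K) < \<delta> \<Longrightarrow>
        (\<Sum>K\<in>\<D>. norm (F (Sup K) - F (Inf K))) < e'"
    by (rule absolutely_continuous_onE[OF F e']) (rule that, assumption, blast)
  obtain \<delta>' where \<delta>': "\<delta>' > 0" "\<And>\<D> X. \<D> division_of X \<Longrightarrow> X \<subseteq> {a..b} \<Longrightarrow> (\<Sum>K\<in>\<D>. Sup K - Inf K) < \<delta>' \<Longrightarrow>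
        (\<Sum>K\<in>\<D>. norm (G (Sup K) - G (Inf K))) < e'"
    by (rule absolutely_continuous_onE[OF G e']) (rule that, assumption, blast)
  show "\<exists>\<delta>>0. \<forall>\<D> X. \<D> division_of X \<and> X \<subseteq> {a..b} \<and> (\<Sum>K\<in>\<D>. Sup K - Inf K) < \<delta> \<longrightarrow>
        (\<Sum>K\<in>\<D>. norm (prod (F (Sup K)) (G (Sup K)) - prod (F (Inf K)) (G (Inf K)))) < e"
  proof (intro exI[of _ "min \<delta> \<delta>'"] conjI allI impI)
    show "min \<delta> \<delta>' > 0" using \<delta> \<delta>' by simp
    fix \<D> X assume D: "\<D> division_of X \<and> X \<subseteq> {a..b} \<and> (\<Sum>K\<in>\<D>. Sup K - Inf K) < min \<delta> \<delta>'"
    have "norm (prod (F (Sup K)) (G (Sup K)) - prod (F (Inf K)) (G (Inf K)))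
        \<le> M * k * (norm (F (Sup K) - F (Inf K)) + norm (G (Sup K) - G (Inf K)))" if K: "K \<in> \<D>" for K
    proof -
      obtain u v where uv: "K = {u..v}" "u \<le> v" "a \<le> u" "v \<le> b"
        using division_ofD(2-4)[of \<D> X K] D K
        by (metis atLeastatMost_empty_iff2 atLeastatMost_subset_iff box_real(2) order_trans)
      have "norm (prod (F v) (G v) - prod (F u) (G u)) = norm (prod (F v - F u) (G v) + prod (F u) (G v - G u))"
        by (simp add: diff_left diff_right)
      also have "\<dots> \<le> norm (F v - F u) * norm (G v) * k + norm (F u) * norm (G v - G u) * k"
        by (intro norm_triangle_le add_mono k)
      also have "\<dots> \<le> norm (F v - F u) * M * k + M * norm (G v - G u) * k"
        using k(1) M uv by (intro add_mono mult_mono) auto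
      finally show ?thesis using uv by (simp add: algebra_simps)
    qed
    then have "(\<Sum>K\<in>\<D>. norm (prod (F (Sup K)) (G (Sup K)) - prod (F (Inf K)) (G (Inf K))))
        \<le> (\<Sum>K\<in>\<D>. M * k * (norm (F (Sup K) - F (Inf K)) + norm (G (Sup K) - G (Inf K))))"
      by (rule sum_mono)
    also have "\<dots> = M * k * ((\<Sum>K\<in>\<D>. norm (F (Sup K) - F (Inf K))) + (\<Sum>K\<in>\<D>. norm (G (Sup K) - G (Inf K))))"
      by (simp only: sum_distrib_left[symmetric] sum.distrib)
    also have "\<dots> < M * k * (e' + e')"
      using D \<delta>(2)[of \<D> X] \<delta>'(2)[of \<D> X] M(1) k(1) by (intro mult_strict_left_mono add_strict_mono) auto
    also have "\<dots> = e" using M k by (simp add: e'_def)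
    finally show "(\<Sum>K\<in>\<D>. norm (prod (F (Sup K)) (G (Sup K)) - prod (F (Inf K)) (G (Inf K)))) < e" .
  qed
qed

text \<open>Averages to the right of a point converge to the value off a null set. Averages to the
  left are those to the right of the reflected function, hence the second null set and its mirror
  image.\<close>

lemma indefinite_integral_has_derivative_AE:
  fixes g :: "real \<Rightarrow> 'b::euclidean_space"
  assumes g: "g integrable_on {a..b}"
  obtains N where "negligible N" "\<And>t. t \<in> {a..b} - N \<Longrightarrow>
     ((\<lambda>x. integral {a..x} g) has_vector_derivative g t) (at t within {a..b})"
proof -
  \<comment> \<open>The averages are taken over intervals starting at arbitrary points, which may
    leave \<open>{a..b}\<close>; extension by 0 keeps them meaningful.\<close>
  define g0 where "g0 x = (if x \<in> {a..b} then g x else 0)" for x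
  have g0: "g0 integrable_on UNIV"
    using g unfolding g0_def integrable_restrict_UNIV .
  then have int: "g0 integrable_on cbox u v" for u v
    using integrable_on_subcbox by blast
  then have int': "(\<lambda>x. g0 (- x)) integrable_on cbox u v" for u v
    using Henstock_Kurzweil_Integration.integrable_reflect_real[where f = g0 and a = "-v" and b = "-u"] by simp
  obtain N1 where N1: "negligible N1" "\<And>x e. x \<notin> N1 \<Longrightarrow> 0 < e \<Longrightarrow>
       \<exists>d>0. \<forall>h. 0 < h \<and> h < d \<longrightarrow> norm (integral (cbox x (x + h *\<^sub>R One)) g0 /\<^sub>R h ^ DIM(real) - g0 x) < e"
    using integrable_ccontinuous_explicit[of g0, OF int] by blast
  obtain N2 where N2: "negligible N2" "\<And>x e. x \<notin> N2 \<Longrightarrow> 0 < e \<Longrightarrow>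
       \<exists>d>0. \<forall>h. 0 < h \<and> h < d \<longrightarrow> norm (integral (cbox x (x + h *\<^sub>R One)) (\<lambda>x. g0 (- x)) /\<^sub>R h ^ DIM(real) - g0 (- x)) < e"
    using integrable_ccontinuous_explicit[of "\<lambda>x. g0 (- x)", OF int'] by blast
  show thesis
  proof
    show "negligible (N1 \<union> uminus ` N2)"
      using N1(1) negligible_differentiable_image_negligible[OF order_refl N2(1), of uminus]
      by (auto intro!: differentiable_on_minus differentiable_on_ident)
    fix t assume t: "t \<in> {a..b} - (N1 \<union> uminus ` N2)"
    then have t1: "t \<notin> N1" and t2: "- t \<notin> N2"
      by (auto simp: image_iff)
    have sub: "integral {a..v} g - integral {a..u} g = integral {u..v} g0"
      if "a \<le> u" "u \<le> v" "v \<le> b" for u v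
    proof -
      have "g integrable_on {a..v}" using g that by (auto intro: integrable_subinterval_real)
      then have "integral {a..v} g = integral {a..u} g + integral {u..v} g"
        using Henstock_Kurzweil_Integration.integral_combine[of a u v g] that by simp
      moreover have "integral {u..v} g0 = integral {u..v} g"
        using that by (intro integral_cong) (auto simp: g0_def)
      ultimately show ?thesis by simp
    qed
    show "((\<lambda>x. integral {a..x} g) has_vector_derivative g t) (at t within {a..b})"
      unfolding has_vector_derivative_def has_derivative_within_alt
    proof (intro conjI allI impI)
      fix e :: real assume e: "e > 0"
      obtain d1 where d1: "d1 > 0" "\<And>h. 0 < h \<Longrightarrow> h < d1 \<Longrightarrow> norm (integral {t..t + h} g0 /\<^sub>R h - g0 t) < e"
        using N1(2)[OF t1 e] by auto
      obtain d2 where d2: "d2 > 0" "\<And>h. 0 < h \<Longrightarrow> h < d2 \<Longrightarrow> norm (integral {-t..-t + h} (\<lambda>x. g0 (- x)) /\<^sub>R h - g0 t) < e"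
        using N2(2)[OF t2 e] by auto
      have scale: "norm (I - h *\<^sub>R c) \<le> e * h" if "norm (I /\<^sub>R h - c) < e" "h > 0" for I c :: 'b and h
      proof -
        have "I - h *\<^sub>R c = h *\<^sub>R (I /\<^sub>R h - c)"
          using that(2) by (simp add: algebra_simps)
        then have "norm (I - h *\<^sub>R c) = h * norm (I /\<^sub>R h - c)"
          using that(2) by simp
        then show ?thesis
          using that by (simp add: mult.commute)
      qed
      show "\<exists>d>0. \<forall>y\<in>{a..b}. norm (y - t) < d \<longrightarrow>
          norm (integral {a..y} g - integral {a..t} g - (y - t) *\<^sub>R g t) \<le> e * norm (y - t)"
      proof (intro exI[of _ "min d1 d2"] conjI ballI impI)
        fix y assume y: "y \<in> {a..b}" "norm (y - t) < min d1 d2"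
        consider "y = t" | "y > t" | "y < t" by linarith
        then show "norm (integral {a..y} g - integral {a..t} g - (y - t) *\<^sub>R g t) \<le> e * norm (y - t)"
        proof cases
          case 2
          then show ?thesis
            using scale[OF d1(2)[of "y - t"]] y t by (simp add: sub g0_def)
        next
          case 3
          have "norm (integral {-t..-y} (\<lambda>x. g0 (- x)) - (t - y) *\<^sub>R g0 t) \<le> e * (t - y)"
            using scale[OF d2(2)[of "t - y"]] y 3 by simp
          then have "norm (integral {y..t} g0 - (t - y) *\<^sub>R g0 t) \<le> e * (t - y)"
            using Henstock_Kurzweil_Integration.integral_reflect_real[where f = g0 and a = y and b = t] by simp
          moreover have "integral {a..y} g - integral {a..t} g - (y - t) *\<^sub>R g t
              = - (integral {y..t} g0 - (t - y) *\<^sub>R g0 t)"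
            using sub[of y t] y t 3 by (simp add: g0_def algebra_simps)
          ultimately show ?thesis using 3 by (simp add: norm_minus_commute)
        qed simp
      qed (use d1 d2 in auto)
    qed (simp add: bounded_linear_scaleR_left)
  qed
qed

section \<open>Volterra equations with square-integrable coefficients\<close>

lemma L2_integrable_square:
  assumes "f \<in> L2 T"
  shows "(\<lambda>t. (f t)\<^sup>2) integrable_on {0..T}"
    and "integral {0..T} (\<lambda>t. (f t)\<^sup>2) = (L2_norm T f)\<^sup>2"
proof -
  have int: "integrable (lebesgue_on {0..T}) (\<lambda>t. (f t)\<^sup>2)"
    using assms by (auto simp: L2_def)
  then show "(\<lambda>t. (f t)\<^sup>2) integrable_on {0..T}"
    by (rule integrable_on_lebesgue_on) simp
  show "integral {0..T} (\<lambda>t. (f t)\<^sup>2) = (L2_norm T f)\<^sup>2"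
    unfolding L2_norm_def by (subst lebesgue_integral_eq_integral[OF int, symmetric]) auto
qed

lemma L2_absolutely_integrable:
  assumes f: "f \<in> L2 T"
  shows "f absolutely_integrable_on {0..T}"
proof -
  have m: "f \<in> borel_measurable (lebesgue_on {0..T})" and int: "integrable (lebesgue_on {0..T}) (\<lambda>t. (f t)\<^sup>2)"
    using f by (auto simp: L2_def)
  have fin: "finite_measure (lebesgue_on {0..T})"
    by (rule finite_measureI) (simp add: space_restrict_space emeasure_restrict_space emeasure_lborel_Icc_eq)
  have "integrable (lebesgue_on {0..T}) (\<lambda>t. 1 + (f t)\<^sup>2)"
    using finite_measure.integrable_const[OF fin] int by (rule Bochner_Integration.integrable_add)
  then have "integrable (lebesgue_on {0..T}) f"
  proof (rule Bochner_Integration.integrable_bound[OF _ m])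
    have "\<bar>x\<bar> \<le> 1 + x\<^sup>2" for x :: real
    proof -
      have "0 \<le> (\<bar>x\<bar> - 1)\<^sup>2" by simp
      then have "2 * \<bar>x\<bar> \<le> 1 + x\<^sup>2" by (simp add: power2_diff)
      then show ?thesis using zero_le_power2[of x] by linarith
    qed
    then show "AE t in lebesgue_on {0..T}. norm (f t) \<le> norm (1 + (f t)\<^sup>2)"
      by (intro always_eventually allI) simp
  qed
  then show ?thesis
    by (simp add: set_integrable_eq)
qed

definition L1_norm :: "real \<Rightarrow> (real \<Rightarrow> real) \<Rightarrow> real" where
  "L1_norm T f = integral {0..T} (\<lambda>t. \<bar>f t\<bar>)"

lemma L2_abs_integrable: "f \<in> L2 T \<Longrightarrow> (\<lambda>t. \<bar>f t\<bar>) integrable_on {0..T}"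
  by (intro set_lebesgue_integral_eq_integral(1) set_integrable_abs L2_absolutely_integrable)

lemma L1_norm_nonneg: "f \<in> L2 T \<Longrightarrow> 0 \<le> L1_norm T f"
  unfolding L1_norm_def by (intro integral_nonneg L2_abs_integrable) auto

lemma L1_norm_add:
  assumes f: "f \<in> L2 T" and h: "h \<in> L2 T"
  shows "L1_norm T (\<lambda>t. f t + h t) \<le> L1_norm T f + L1_norm T h"
proof -
  have "L1_norm T (\<lambda>t. f t + h t) \<le> integral {0..T} (\<lambda>t. \<bar>f t\<bar> + \<bar>h t\<bar>)"
    unfolding L1_norm_def
    by (intro integral_le integrable_add L2_abs_integrable f h L2_add) (auto simp: abs_triangle_ineq)
  also have "\<dots> = L1_norm T f + L1_norm T h"
    unfolding L1_norm_def by (intro integral_add L2_abs_integrable f h)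
  finally show ?thesis .
qed

lemma L1_norm_scale: "L1_norm T (\<lambda>t. s * d t) = \<bar>s\<bar> * L1_norm T d"
  unfolding L1_norm_def abs_mult by simp

lemma L1_norm_le_L2_norm:
  assumes f: "f \<in> L2 T" and T: "T > 0"
  shows "L1_norm T f \<le> sqrt T * L2_norm T f"
proof -
  \<comment> \<open>The mean of |f|, which minimises the integral of (|f| - m)^2; that this integral
    is nonnegative is the Cauchy-Schwarz inequality against the constant function.\<close>
  define m where "m = L1_norm T f / T"
  have int: "(\<lambda>t. (f t)\<^sup>2) integrable_on {0..T}" "(\<lambda>t. \<bar>f t\<bar>) integrable_on {0..T}"
    using f by (auto intro: L2_integrable_square L2_abs_integrable)
  have "((\<lambda>t. (f t)\<^sup>2 - 2 * m * \<bar>f t\<bar> + m\<^sup>2) has_integral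
      ((L2_norm T f)\<^sup>2 - 2 * m * L1_norm T f + (T - 0) *\<^sub>R m\<^sup>2)) {0..T}"
    using int T L2_integrable_square(2)[OF f] has_integral_const_real[of "m\<^sup>2" 0 T]
    by (intro has_integral_add has_integral_diff has_integral_mult_right)
      (auto simp: L1_norm_def has_integral_iff)
  then have "0 \<le> (L2_norm T f)\<^sup>2 - 2 * m * L1_norm T f + (T - 0) *\<^sub>R m\<^sup>2"
  proof (rule has_integral_nonneg)
    fix t
    have "0 \<le> (\<bar>f t\<bar> - m)\<^sup>2" by simp
    then show "0 \<le> (f t)\<^sup>2 - 2 * m * \<bar>f t\<bar> + m\<^sup>2"
      by (simp add: power2_diff algebra_simps)
  qed
  then have "(L1_norm T f)\<^sup>2 \<le> T * (L2_norm T f)\<^sup>2"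
    using T by (simp add: m_def power2_eq_square field_simps)
  then have "L1_norm T f \<le> sqrt (T * (L2_norm T f)\<^sup>2)"
    by (rule real_le_rsqrt)
  then show ?thesis by (simp add: real_sqrt_mult)
qed

section \<open>Volterra operators on bounded continuous functions\<close>

locale volterra =
  fixes T M :: real and L :: "real \<Rightarrow> 'e::euclidean_space \<Rightarrow> 'e"
  assumes T_pos: "0 < T" and M_nonneg: "0 \<le> M"
    and linear_L: "t \<in> {0..T} \<Longrightarrow> linear (L t)"
    and norm_L: "t \<in> {0..T} \<Longrightarrow> norm (L t x) \<le> M * norm x"
    and continuous_L: "continuous_on {0..T} Y \<Longrightarrow> continuous_on {0..T} (\<lambda>t. L t (Y t))"
begin

text \<open>Bounded continuous functions live on the whole line. Precomposing with this retraction
  extends a function on \<open>{0..T}\<close> by its end values, so that their Banach space can be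
  used.\<close>

definition clip :: "real \<Rightarrow> real" where
  "clip t = max 0 (min T t)"

lemma clip_in: "clip t \<in> {0..T}"
  using T_pos by (auto simp: clip_def)

lemma clip_eq: "t \<in> {0..T} \<Longrightarrow> clip t = t"
  by (auto simp: clip_def)

lemma continuous_clip: "continuous_on S clip"
  unfolding clip_def by (intro continuous_intros)

lemma kernel_absolutely_integrable:
  assumes f: "f \<in> L2 T" and x: "continuous_on {0..T} x"
  shows "(\<lambda>s. f s *\<^sub>R L s (x s)) absolutely_integrable_on {0..T}"
proof -
  have c: "continuous_on {0..T} (\<lambda>s. L s (x s))"
    by (rule continuous_L[OF x])
  have "bilinear (\<lambda>(y :: 'e) (r :: real). r *\<^sub>R y)"
    unfolding bilinear_conv_bounded_bilinear by (rule bounded_bilinear.flip[OF bounded_bilinear_scaleR])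
  then show ?thesis
  proof (rule absolutely_integrable_bounded_measurable_product[where h = "\<lambda>y r. r *\<^sub>R y"])
    show "(\<lambda>s. L s (x s)) \<in> borel_measurable (lebesgue_on {0..T})"
      by (rule continuous_imp_measurable_on_sets_lebesgue[OF c]) simp
    show "bounded ((\<lambda>s. L s (x s)) ` {0..T})"
      by (rule compact_imp_bounded[OF compact_continuous_image[OF c]]) simp
  qed (use f L2_absolutely_integrable in auto)
qed

lemma kernel_integrable:
  assumes f: "f \<in> L2 T" and x: "continuous_on {0..T} x" and uv: "0 \<le> u" "v \<le> T"
  shows "(\<lambda>s. f s *\<^sub>R L s (x s)) integrable_on {u..v}"
proof -
  have "(\<lambda>s. f s *\<^sub>R L s (x s)) integrable_on {0..T}"
    using kernel_absolutely_integrable[OF f x] by (rule set_lebesgue_integral_eq_integral)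
  then show ?thesis
    by (rule integrable_subinterval_real) (use uv in auto)
qed

lemma norm_kernel_integral:
  assumes f: "f \<in> L2 T" and x: "continuous_on {0..T} x" and uv: "0 \<le> u" "v \<le> T"
    and bound: "\<And>s. s \<in> {u..v} \<Longrightarrow> norm (x s) \<le> c"
  shows "norm (integral {u..v} (\<lambda>s. f s *\<^sub>R L s (x s))) \<le> integral {u..v} (\<lambda>s. M * c * \<bar>f s\<bar>)"
proof (rule integral_norm_bound_integral)
  show "(\<lambda>s. f s *\<^sub>R L s (x s)) integrable_on {u..v}"
    by (rule kernel_integrable[OF f x uv])
  have "(\<lambda>s. \<bar>f s\<bar>) integrable_on {u..v}"
    by (rule integrable_subinterval_real[OF L2_abs_integrable[OF f]]) (use uv in auto)
  then show "(\<lambda>s. M * c * \<bar>f s\<bar>) integrable_on {u..v}"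
    by (rule integrable_on_mult_right)
  fix s assume s: "s \<in> {u..v}"
  have "norm (L s (x s)) \<le> M * norm (x s)"
    using norm_L[of s "x s"] s uv by simp
  also have "\<dots> \<le> M * c"
    using bound[OF s] M_nonneg by (rule mult_left_mono)
  finally have "\<bar>f s\<bar> * norm (L s (x s)) \<le> \<bar>f s\<bar> * (M * c)"
    by (rule mult_left_mono) simp
  then show "norm (f s *\<^sub>R L s (x s)) \<le> M * c * \<bar>f s\<bar>"
    by (simp add: mult_ac)
qed

text \<open>Only meaningful for \<open>f \<in> L2 T\<close>; otherwise the argument of \<open>Bcontfun\<close> need not be continuous.\<close>

definition K :: "(real \<Rightarrow> real) \<Rightarrow> (real \<Rightarrow>\<^sub>C 'e) \<Rightarrow> (real \<Rightarrow>\<^sub>C 'e)" where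
  "K f x = Bcontfun (\<lambda>t. integral {0..clip t} (\<lambda>s. f s *\<^sub>R L s (apply_bcontfun x s)))"

lemma clipped_in_bcontfun:
  fixes Y :: "real \<Rightarrow> 'e"
  assumes "continuous_on {0..T} Y"
  shows "(\<lambda>t. Y (clip t)) \<in> bcontfun"
  unfolding bcontfun_def mem_Collect_eq
proof
  show "continuous_on UNIV (\<lambda>t. Y (clip t))"
    using assms continuous_clip clip_in
    by (intro continuous_on_compose2[OF assms continuous_clip]) auto
  have "bounded (Y ` {0..T})"
    by (rule compact_imp_bounded[OF compact_continuous_image[OF assms]]) simp
  then show "bounded (range (\<lambda>t. Y (clip t)))"
    by (rule bounded_subset) (use clip_in in auto)
qed

lemma apply_K:
  assumes f: "f \<in> L2 T"
  shows "apply_bcontfun (K f x) t = integral {0..clip t} (\<lambda>s. f s *\<^sub>R L s (apply_bcontfun x s))"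
proof -
  have "continuous_on {0..T} (\<lambda>t. integral {0..t} (\<lambda>s. f s *\<^sub>R L s (apply_bcontfun x s)))"
    by (rule indefinite_integral_continuous_1[OF kernel_integrable[OF f]]) auto
  from clipped_in_bcontfun[OF this] show ?thesis
    by (simp add: K_def Bcontfun_inverse)
qed

lemma norm_K_L1: "f \<in> L2 T \<Longrightarrow> norm (K f x) \<le> M * L1_norm T f * norm x"
proof (rule norm_bound)
  fix t assume f: "f \<in> L2 T"
  have int: "(\<lambda>s. M * norm x * \<bar>f s\<bar>) integrable_on {0..T}"
    by (rule integrable_on_mult_right[OF L2_abs_integrable[OF f]])
  have "norm (apply_bcontfun (K f x) t) \<le> integral {0..clip t} (\<lambda>s. M * norm x * \<bar>f s\<bar>)"
    unfolding apply_K[OF f] using clip_in[of t] by (intro norm_kernel_integral f) (auto simp: norm_bounded)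
  also have "\<dots> \<le> integral {0..T} (\<lambda>s. M * norm x * \<bar>f s\<bar>)"
    using clip_in[of t] M_nonneg int
    by (intro integral_subset_le) (auto intro: integrable_subinterval_real)
  finally show "norm (apply_bcontfun (K f x) t) \<le> M * L1_norm T f * norm x"
    by (simp add: L1_norm_def mult_ac)
qed

lemma linear_K_L2:
  assumes f: "f \<in> L2 T"
  shows "linear (K f)"
proof (rule linearI)
  have cl: "0 \<le> clip t" "clip t \<le> T" for t
    using clip_in[of t] by auto
  note int = kernel_integrable[OF f continuous_on_apply_bcontfun order_refl cl(2)]
  fix x y :: "real \<Rightarrow>\<^sub>C 'e" and c :: real
  show "K f (x + y) = K f x + K f y"
  proof (rule bcontfun_eqI)
    fix t
    have "integral {0..clip t} (\<lambda>s. f s *\<^sub>R L s (apply_bcontfun x s + apply_bcontfun y s))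
        = integral {0..clip t} (\<lambda>s. f s *\<^sub>R L s (apply_bcontfun x s) + f s *\<^sub>R L s (apply_bcontfun y s))"
      using cl[of t] by (intro integral_cong) (simp add: linear_add[OF linear_L] scaleR_add_right)
    then show "apply_bcontfun (K f (x + y)) t = apply_bcontfun (K f x + K f y) t"
      by (simp add: apply_K[OF f] integral_add int)
  qed
  show "K f (c *\<^sub>R x) = c *\<^sub>R K f x"
  proof (rule bcontfun_eqI)
    fix t
    have "integral {0..clip t} (\<lambda>s. f s *\<^sub>R L s (c *\<^sub>R apply_bcontfun x s))
        = integral {0..clip t} (\<lambda>s. c *\<^sub>R (f s *\<^sub>R L s (apply_bcontfun x s)))"
      using cl[of t] by (intro integral_cong) (simp add: linear_scale[OF linear_L])
    then show "apply_bcontfun (K f (c *\<^sub>R x)) t = apply_bcontfun (c *\<^sub>R K f x) t"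
      by (simp add: apply_K[OF f] del: scaleR_scaleR)
  qed
qed

lemma K_lincomb_L2:
  assumes g: "g \<in> L2 T" and h: "h \<in> L2 T"
  shows "K (\<lambda>t. a * g t + b * h t) x = a *\<^sub>R K g x + b *\<^sub>R K h x"
proof (rule bcontfun_eqI)
  fix t
  have cl: "clip t \<le> T"
    using clip_in[of t] by auto
  have int: "(\<lambda>s. f s *\<^sub>R L s (apply_bcontfun x s)) integrable_on {0..clip t}" if "f \<in> L2 T" for f
    using that cl by (intro kernel_integrable) auto
  have "integral {0..clip t} (\<lambda>s. (a * g s + b * h s) *\<^sub>R L s (apply_bcontfun x s))
      = integral {0..clip t} (\<lambda>s. a *\<^sub>R (g s *\<^sub>R L s (apply_bcontfun x s)) + b *\<^sub>R (h s *\<^sub>R L s (apply_bcontfun x s)))"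
    by (simp add: scaleR_add_left)
  also have "\<dots> = integral {0..clip t} (\<lambda>s. a *\<^sub>R (g s *\<^sub>R L s (apply_bcontfun x s)))
      + integral {0..clip t} (\<lambda>s. b *\<^sub>R (h s *\<^sub>R L s (apply_bcontfun x s)))"
    by (intro integral_add integrable_cmul int g h)
  finally show "apply_bcontfun (K (\<lambda>t. a * g t + b * h t) x) t = apply_bcontfun (a *\<^sub>R K g x + b *\<^sub>R K h x) t"
    by (simp add: apply_K g h L2_lincomb del: scaleR_scaleR)
qed

sublocale resolvent_family T K "\<lambda>f. M * L1_norm T f" "M * sqrt T"
proof (rule resolvent_family.intro)
  fix f h :: "real \<Rightarrow> real"
  assume f: "f \<in> L2 T"
  show "M * L1_norm T f \<le> M * sqrt T * L2_norm T f"
    using mult_left_mono[OF L1_norm_le_L2_norm[OF f T_pos] M_nonneg] by (simp add: mult.assoc)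
  assume h: "h \<in> L2 T"
  show "M * L1_norm T (\<lambda>t. f t + h t) \<le> M * L1_norm T f + M * L1_norm T h"
    using mult_left_mono[OF L1_norm_add[OF f h] M_nonneg] by (simp add: distrib_left)
qed (simp_all add: M_nonneg T_pos less_imp_le linear_K_L2 K_lincomb_L2 norm_K_L1 L1_norm_nonneg)

lemma res_integral_equation:
  assumes f: "f \<in> L2 T" and small: "M * L1_norm T f < 1" and t: "t \<in> {0..T}"
  shows "apply_bcontfun (res f x) t
       = apply_bcontfun x t + integral {0..t} (\<lambda>s. f s *\<^sub>R L s (apply_bcontfun (res f x) s))"
proof -
  have "apply_bcontfun (res f x) t = apply_bcontfun (x + K f (res f x)) t"
    using res_eq[OF f small, of x] by (rule arg_cong)
  then show ?thesis
    using t by (simp add: apply_K[OF f] clip_eq)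
qed

text \<open>After clipping, \<open>Y\<close> is a fixed point in the space of bounded continuous
  functions, where fixed points are unique. This identifies any continuous solution with the
  resolvent, however it was obtained.\<close>

lemma res_eq_solution:
  assumes f: "f \<in> L2 T" and small: "M * L1_norm T f < 1" and Y: "continuous_on {0..T} Y"
    and eq: "\<And>t. t \<in> {0..T} \<Longrightarrow> Y t = c + integral {0..t} (\<lambda>s. f s *\<^sub>R L s (Y s))"
    and t: "t \<in> {0..T}"
  shows "apply_bcontfun (res f (const_bcontfun c)) t = Y t"
proof -
  define Yb where "Yb = Bcontfun (\<lambda>t. Y (clip t))"
  have Yb: "apply_bcontfun Yb t = Y (clip t)" for t
    unfolding Yb_def using clipped_in_bcontfun[OF Y] by (simp add: Bcontfun_inverse)
  have "Yb = const_bcontfun c + K f Yb"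
  proof (rule bcontfun_eqI)
    fix t
    have "integral {0..clip t} (\<lambda>s. f s *\<^sub>R L s (Y s)) = integral {0..clip t} (\<lambda>s. f s *\<^sub>R L s (apply_bcontfun Yb s))"
      using clip_in[of t] by (intro integral_cong) (simp add: Yb clip_eq)
    then show "apply_bcontfun Yb t = apply_bcontfun (const_bcontfun c + K f Yb) t"
      using eq[OF clip_in[of t]] by (simp add: Yb apply_K[OF f])
  qed
  then have "res f (const_bcontfun c) = Yb"
    by (rule res_unique[OF f small])
  then show ?thesis using t by (simp add: Yb clip_eq)
qed

end

section \<open>Complex matrices and the interaction picture\<close>

lemma bounded_bilinear_matrix_mult:
  "bounded_bilinear (\<lambda>(A :: complex^'n^'m) (B :: complex^'k^'n). A ** B)"
  unfolding bilinear_conv_bounded_bilinear[symmetric] bilinear_def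
  by (auto intro!: linearI simp: vec_eq_iff matrix_matrix_mult_def sum.distrib scaleR_sum_right algebra_simps)

lemma matrix_mult_scaleR:
  fixes A :: "complex^'n^'m" and B :: "complex^'k^'n"
  shows "(r *\<^sub>R A) ** B = r *\<^sub>R (A ** B)" and "A ** (r *\<^sub>R B) = r *\<^sub>R (A ** B)"
  by (simp_all add: bounded_bilinear.scaleR_left[OF bounded_bilinear_matrix_mult]
      bounded_bilinear.scaleR_right[OF bounded_bilinear_matrix_mult])

lemma matrix_mult_diff:
  fixes A B :: "complex^'n^'m" and C D :: "complex^'k^'n"
  shows "(A - B) ** C = A ** C - B ** C" and "A ** (C - D) = A ** C - A ** D"
  by (simp_all add: bounded_bilinear.diff_left[OF bounded_bilinear_matrix_mult]
      bounded_bilinear.diff_right[OF bounded_bilinear_matrix_mult])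

lemma matrix_mult_add: "(A + B) ** C = A ** C + B ** C"
  for A B :: "complex^'n^'m" and C :: "complex^'k^'n"
  by (rule bounded_bilinear.add_left[OF bounded_bilinear_matrix_mult])

lemma matrix_mult_minus:
  fixes A :: "complex^'n^'m" and C :: "complex^'k^'n"
  shows "(- A) ** C = - (A ** C)" and "A ** (- C) = - (A ** C)"
  by (simp_all add: bounded_bilinear.minus_left[OF bounded_bilinear_matrix_mult]
      bounded_bilinear.minus_right[OF bounded_bilinear_matrix_mult])

lemma mat_mult_nth: "(mat c ** A) $ i $ j = c * A $ i $ j"
  for A :: "complex^'n^'m"
  by (simp add: mat_def matrix_matrix_mult_def if_distrib[of "\<lambda>x. x * _"] cong: if_cong)

lemma mult_mat_nth: "(A ** mat c) $ i $ j = c * A $ i $ j"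
  for A :: "complex^'n^'m"
  by (simp add: mat_def matrix_matrix_mult_def if_distrib[of "\<lambda>x. _ * x"] cong: if_cong)

lemma mat_commute: "mat c ** A = A ** mat c" for A :: "complex^'n^'n"
  by (simp add: vec_eq_iff mat_mult_nth mult_mat_nth)

lemma mat_minus_i_mult: "mat (- \<i>) ** A = - (mat \<i> ** A)" for A :: "complex^'n^'m"
  by (simp add: vec_eq_iff mat_mult_nth)

lemma mat_i_mat_i: "mat \<i> ** (mat \<i> ** A) = - A" for A :: "complex^'n^'m"
  by (simp add: vec_eq_iff mat_mult_nth mult.assoc[symmetric])

lemma adjoint_matrix_mult: "adjoint_matrix (A ** B) = adjoint_matrix B ** adjoint_matrix A"
  for A :: "complex^'n^'m" and B :: "complex^'k^'n"
  by (simp add: vec_eq_iff adjoint_matrix_def matrix_matrix_mult_def mult.commute)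

lemma adjoint_matrix_mat: "adjoint_matrix (mat c) = mat (cnj c)"
  by (auto simp: vec_eq_iff adjoint_matrix_def mat_def)

lemma adjoint_matrix_minus: "adjoint_matrix (- A) = - adjoint_matrix A"
  by (simp add: vec_eq_iff adjoint_matrix_def)

lemma adjoint_matrix_scaleR: "adjoint_matrix (r *\<^sub>R A) = r *\<^sub>R adjoint_matrix A"
  by (simp add: vec_eq_iff adjoint_matrix_def)

lemma adjoint_matrix_add: "adjoint_matrix (A + B) = adjoint_matrix A + adjoint_matrix B"
  by (simp add: vec_eq_iff adjoint_matrix_def)

text \<open>The adjoint is conjugate-linear over the complex numbers but linear over the reals. Real
  bilinearity is enough for the product rule and for absolute continuity of
  \<open>W ** \<rho> ** adjoint_matrix W\<close>.\<close>

lemma bounded_bilinear_sandwich: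
  "bounded_bilinear (\<lambda>(A :: complex^'n^'m) (B :: complex^'n^'k). A ** \<rho> ** adjoint_matrix B)"
proof -
  have "linear (\<lambda>B :: complex^'n^'k. adjoint_matrix B)"
    by (rule linearI) (simp_all add: adjoint_matrix_add adjoint_matrix_scaleR)
  then have adj: "bounded_linear (\<lambda>B :: complex^'n^'k. adjoint_matrix B)"
    by (rule linear_conv_bounded_linear[THEN iffD1])
  note bounded_bilinear.comp[OF bounded_bilinear_matrix_mult
      bounded_bilinear.bounded_linear_left[OF bounded_bilinear_matrix_mult, of \<rho>] adj]
  then show ?thesis .
qed

section \<open>Diagonal matrices, null sets and the interaction frame\<close>

definition diagonal_matrix :: "('n \<Rightarrow> complex) \<Rightarrow> complex^'n^'n" where
  "diagonal_matrix d = (\<chi> i j. if i = j then d i else 0)"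

lemma diagonal_matrix_mult_nth: "(diagonal_matrix d ** A) $ i $ j = d i * A $ i $ j"
  for A :: "complex^'m^'n"
  by (simp add: diagonal_matrix_def matrix_matrix_mult_def if_distrib[of "\<lambda>x. x * _"] cong: if_cong)

lemma mult_diagonal_matrix_nth: "(A ** diagonal_matrix d) $ i $ j = A $ i $ j * d j"
  for A :: "complex^'n^'m"
  by (simp add: diagonal_matrix_def matrix_matrix_mult_def if_distrib[of "\<lambda>x. _ * x"] cong: if_cong)

lemma diagonal_matrix_mult: "diagonal_matrix c ** diagonal_matrix d = diagonal_matrix (\<lambda>i. c i * d i)"
  by (simp add: vec_eq_iff diagonal_matrix_mult_nth) (simp add: diagonal_matrix_def)

lemma adjoint_diagonal_matrix: "adjoint_matrix (diagonal_matrix d) = diagonal_matrix (\<lambda>i. cnj (d i))"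
  by (auto simp: vec_eq_iff adjoint_matrix_def diagonal_matrix_def)

lemma AE_lebesgue_on_iff_negligible:
  "(AE t in lebesgue_on {a..b::real}. P t) \<longleftrightarrow> (\<exists>N. negligible N \<and> (\<forall>t\<in>{a..b} - N. P t))"
proof -
  have "(AE t in lebesgue_on {a..b}. P t) \<longleftrightarrow> (AE t in lebesgue. t \<in> {a..b} \<longrightarrow> P t)"
    by (subst AE_restrict_space_iff) auto
  also have "\<dots> \<longleftrightarrow> (\<exists>N\<in>null_sets lebesgue. {t \<in> space lebesgue. \<not> (t \<in> {a..b} \<longrightarrow> P t)} \<subseteq> N)"
    by (rule eventually_ae_filter)
  also have "\<dots> \<longleftrightarrow> (\<exists>N. negligible N \<and> (\<forall>t\<in>{a..b} - N. P t))"
    unfolding negligible_iff_null_sets Bex_def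
    by (intro arg_cong[where f = Ex] ext conj_cong refl) auto
  finally show ?thesis .
qed

lemma absolutely_continuous_on_if_vector_derivative:
  fixes E :: "real \<Rightarrow> 'a::euclidean_space"
  assumes der: "\<And>t. (E has_vector_derivative E' t) (at t)" and cont: "continuous_on {a..b} E'"
  shows "absolutely_continuous_on {a..b} E"
proof -
  have "bounded (E' ` {a..b})"
    by (rule compact_imp_bounded[OF compact_continuous_image[OF cont]]) simp
  then obtain C where C: "\<And>t. t \<in> {a..b} \<Longrightarrow> norm (E' t) \<le> C"
    unfolding bounded_iff by blast
  show ?thesis
  proof (rule absolutely_continuous_on_if_integral_bound)
    fix u v assume uv: "a \<le> u" "u \<le> v" "v \<le> b"
    have "(E' has_integral (E v - E u)) {u..v}"
      using uv der by (intro fundamental_theorem_of_calculus) (auto intro: has_vector_derivative_at_within)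
    then have "norm (E v - E u) \<le> C * (v - u)"
      using has_integral_bound_real[of C "{}" E' "E v - E u" u v] uv C order_trans[OF norm_ge_zero C, of a]
      by simp
    then show "norm (E v - E u) \<le> integral {u..v} (\<lambda>_. C)"
      using uv by (simp add: mult.commute)
  qed (simp_all add: integrable_const_ivl)
qed

lemma has_vector_derivative_vec_nth:
  fixes f :: "real \<Rightarrow> 'a::euclidean_space^'n"
  assumes "\<And>i. ((\<lambda>t. f t $ i) has_vector_derivative f' $ i) (at t within S)"
  shows "(f has_vector_derivative f') (at t within S)"
  unfolding has_vector_derivative_def
proof (subst has_derivative_componentwise_within, intro ballI)
  fix b :: "'a^'n" assume "b \<in> Basis"
  then obtain i u where b: "b = axis i u"
    by (auto simp: Basis_vec_def)
  show "((\<lambda>t. f t \<bullet> b) has_derivative (\<lambda>x. (x *\<^sub>R f') \<bullet> b)) (at t within S)"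
    using has_derivative_inner_left[OF assms[of i, unfolded has_vector_derivative_def], of u]
    by (simp add: b inner_axis)
qed

text \<open>The unitary group exp (i t H0) of the diagonal free Hamiltonian with entries
  \<open>h\<close>.\<close>

definition interaction_frame :: "('n \<Rightarrow> real) \<Rightarrow> real \<Rightarrow> complex^'n^'n" where
  "interaction_frame h t = diagonal_matrix (\<lambda>i. cis (h i * t))"

definition interaction_coupling :: "('n \<Rightarrow> real) \<Rightarrow> complex^'n^'n \<Rightarrow> real \<Rightarrow> complex^'n^'n" where
  "interaction_coupling h V t = interaction_frame h t ** V ** interaction_frame h (- t)"

lemma interaction_coupling_nth:
  "interaction_coupling h V t $ i $ j = cis ((h i - h j) * t) * V $ i $ j"
proof -
  have "cis (h i * t) * cis (h j * (- t)) = cis ((h i - h j) * t)"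
    by (simp add: cis_mult left_diff_distrib)
  then show ?thesis
    by (simp add: interaction_coupling_def interaction_frame_def mult_diagonal_matrix_nth
        diagonal_matrix_mult_nth mult_ac)
qed

lemma interaction_frame_inverse [simp]:
  "interaction_frame h t ** interaction_frame h (- t) = mat 1"
  "interaction_frame h (- t) ** interaction_frame h t = mat 1"
  by (simp_all add: interaction_frame_def diagonal_matrix_mult cis_mult)
    (simp_all add: diagonal_matrix_def mat_def)

lemma interaction_frame_zero [simp]: "interaction_frame h 0 = mat 1"
  by (simp add: interaction_frame_def diagonal_matrix_def mat_def)

lemma adjoint_interaction_frame: "adjoint_matrix (interaction_frame h t) = interaction_frame h (- t)"
  by (simp add: interaction_frame_def adjoint_diagonal_matrix cis_cnj)

text \<open>The factor \<open>s\<close> lets one statement serve for the passage to the interaction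
  picture (s = 1) and for the way back (s = -1).\<close>

lemma interaction_frame_has_vector_derivative:
  "((\<lambda>t. interaction_frame h (s * t)) has_vector_derivative
     s *\<^sub>R (interaction_frame h (s * t) ** (mat \<i> ** diagonal_matrix (\<lambda>i. of_real (h i))))) (at t)"
proof (intro has_vector_derivative_vec_nth)
  fix i j
  have "((\<lambda>t. exp (t *\<^sub>R (\<i> * of_real (h i * s)))) has_vector_derivative
      exp (t *\<^sub>R (\<i> * of_real (h i * s))) * (\<i> * of_real (h i * s))) (at t)"
    by (rule exp_scaleR_has_vector_derivative_right)
  moreover have "exp (t *\<^sub>R (\<i> * of_real (h i * s))) = cis (h i * (s * t))" for t
    by (simp add: cis_conv_exp scaleR_conv_of_real mult_ac)
  ultimately have "((\<lambda>t. cis (h i * (s * t))) has_vector_derivative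
      cis (h i * (s * t)) * (\<i> * of_real (h i * s))) (at t)"
    by simp
  then show "((\<lambda>t. interaction_frame h (s * t) $ i $ j) has_vector_derivative
     (s *\<^sub>R (interaction_frame h (s * t) ** (mat \<i> ** diagonal_matrix (\<lambda>i. of_real (h i))))) $ i $ j) (at t)"
    unfolding interaction_frame_def scaleR_vec_def vec_lambda_beta diagonal_matrix_mult_nth mat_mult_nth
    by (cases "i = j") (simp_all add: diagonal_matrix_def scaleR_conv_of_real mult_ac)
qed

lemma absolutely_continuous_interaction_frame:
  "absolutely_continuous_on {a..b} (\<lambda>t. interaction_frame h (s * t))"
proof (rule absolutely_continuous_on_if_vector_derivative[OF interaction_frame_has_vector_derivative])
  have "continuous_on {a..b} (\<lambda>t. interaction_frame h (s * t))"
    using interaction_frame_has_vector_derivative has_vector_derivative_continuous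
    by (blast intro: continuous_at_imp_continuous_on)
  then show "continuous_on {a..b} (\<lambda>t. s *\<^sub>R (interaction_frame h (s * t) ** (mat \<i> ** diagonal_matrix (\<lambda>i. of_real (h i)))))"
    by (intro continuous_intros bounded_bilinear.continuous_on[OF bounded_bilinear_matrix_mult])
qed

lemma continuous_interaction_coupling: "continuous_on S (interaction_coupling h V)"
proof -
  have "continuous_on S (\<lambda>t. \<chi> i j. cis ((h i - h j) * t) * V $ i $ j)"
    by (intro continuous_intros)
  moreover have "interaction_coupling h V = (\<lambda>t. \<chi> i j. cis ((h i - h j) * t) * V $ i $ j)"
    by (simp add: fun_eq_iff vec_eq_iff interaction_coupling_nth)
  ultimately show ?thesis by simp
qed

lemma absolutely_continuous_on_subset:
  "absolutely_continuous_on S g \<Longrightarrow> R \<subseteq> S \<Longrightarrow> absolutely_continuous_on R g"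
  unfolding absolutely_continuous_on_def by (meson subset_trans)

text \<open>The coupling is continuous, hence bounded on \<open>{0..T}\<close>. A common constant is
  taken, that of the commutator, so that a single smallness condition makes both equations
  contractive.\<close>

lemma interaction_bound_exists:
  fixes V :: "complex^'n^'n"
  obtains M where "0 \<le> M"
    "\<And>t (X :: complex^'n^'n). t \<in> {0..T} \<Longrightarrow> norm (mat \<i> ** (interaction_coupling h V t ** X)) \<le> M * norm X"
    "\<And>t X. t \<in> {0..T} \<Longrightarrow>
       norm (mat \<i> ** (interaction_coupling h V t ** X - X ** interaction_coupling h V t)) \<le> M * norm X"
proof -
  let ?B = "interaction_coupling h V"
  have "\<exists>k>0. \<forall>(A :: complex^'n^'n) (C :: complex^'n^'n). norm (A ** C) \<le> norm A * norm C * k"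
    by (rule bounded_bilinear.pos_bounded[OF bounded_bilinear_matrix_mult])
  then obtain k where k: "k > 0" "\<And>(A :: complex^'n^'n) (C :: complex^'n^'n). norm (A ** C) \<le> norm A * norm C * k"
    by metis
  have "bounded (?B ` {0..T})"
    by (rule compact_imp_bounded[OF compact_continuous_image[OF continuous_interaction_coupling]]) simp
  then obtain b where b: "\<And>t. t \<in> {0..T} \<Longrightarrow> norm (?B t) \<le> b"
    unfolding bounded_iff by blast
  define c where "c = max 0 b"
  have c: "c \<ge> 0" "\<And>t. t \<in> {0..T} \<Longrightarrow> norm (?B t) \<le> c"
    using b by (simp_all add: c_def le_max_iff_disj)
  define i where "i = norm (mat \<i> :: complex^'n^'n)"
  have left: "norm (?B t ** X) \<le> c * norm X * k" if t: "t \<in> {0..T}" for t and X :: "complex^'n^'n"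
  proof -
    have "norm (?B t ** X) \<le> norm (?B t) * norm X * k" by (rule k(2))
    also have "\<dots> \<le> c * norm X * k"
      using c(2)[OF t] k(1) by (intro mult_right_mono) auto
    finally show ?thesis .
  qed
  have right: "norm (X ** ?B t) \<le> norm X * c * k" if t: "t \<in> {0..T}" for t and X :: "complex^'n^'n"
  proof -
    have "norm (X ** ?B t) \<le> norm X * norm (?B t) * k" by (rule k(2))
    also have "\<dots> \<le> norm X * c * k"
      using c(2)[OF t] k(1) by (intro mult_right_mono mult_left_mono) auto
    finally show ?thesis .
  qed
  have i: "norm (mat \<i> ** Y) \<le> i * a * k" if a: "norm Y \<le> a" for Y :: "complex^'n^'n" and a
  proof -
    have "norm (mat \<i> ** Y) \<le> i * norm Y * k" unfolding i_def by (rule k(2))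
    also have "\<dots> \<le> i * a * k"
      using a k(1) by (intro mult_right_mono mult_left_mono) (auto simp: i_def)
    finally show ?thesis .
  qed
  show thesis
  proof (rule that[of "i * (c * k + c * k) * k"])
    show "0 \<le> i * (c * k + c * k) * k"
      using c k by (simp add: i_def)
    fix t and X :: "complex^'n^'n" assume t: "t \<in> {0..T}"
    have "norm (?B t ** X) \<le> c * norm X * k + norm X * c * k"
      by (rule order_trans[OF left[OF t]]) (use c(1) k(1) in simp)
    from i[OF this] show "norm (mat \<i> ** (?B t ** X)) \<le> i * (c * k + c * k) * k * norm X"
      by (simp only: distrib_left distrib_right mult_ac)
    have "norm (?B t ** X - X ** ?B t) \<le> c * norm X * k + norm X * c * k"
      by (rule norm_triangle_le_diff[OF add_mono[OF left[OF t] right[OF t]]])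
    from i[OF this] show "norm (mat \<i> ** (?B t ** X - X ** ?B t)) \<le> i * (c * k + c * k) * k * norm X"
      by (simp only: distrib_left distrib_right mult_ac)
  qed
qed

section \<open>The Schroedinger equation in the interaction picture\<close>

locale interaction =
  fixes h :: "'n::finite \<Rightarrow> real" and V :: "complex^'n^'n" and T M :: real
  assumes T_pos: "0 < T" and M_nonneg: "0 \<le> M" and hermitian: "adjoint_matrix V = V"
    and lin_bound: "t \<in> {0..T} \<Longrightarrow> norm (mat \<i> ** (interaction_coupling h V t ** X)) \<le> M * norm X"
    and comm_bound: "t \<in> {0..T} \<Longrightarrow>
       norm (mat \<i> ** (interaction_coupling h V t ** X - X ** interaction_coupling h V t)) \<le> M * norm X"
begin

abbreviation B :: "real \<Rightarrow> complex^'n^'n" where "B \<equiv> interaction_coupling h V"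
abbreviation E :: "real \<Rightarrow> complex^'n^'n" where "E \<equiv> interaction_frame h"
abbreviation H0 :: "complex^'n^'n" where "H0 \<equiv> diagonal_matrix (\<lambda>i. of_real (h i))"

definition lin_gen :: "real \<Rightarrow> complex^'n^'n \<Rightarrow> complex^'n^'n" where
  "lin_gen t X = - (mat \<i> ** (B t ** X))"

definition comm_gen :: "real \<Rightarrow> complex^'n^'n \<Rightarrow> complex^'n^'n" where
  "comm_gen t X = - (mat \<i> ** (B t ** X - X ** B t))"

lemma continuous_on_matrix_mult:
  fixes F G :: "real \<Rightarrow> complex^'n^'n"
  shows "continuous_on S F \<Longrightarrow> continuous_on S G \<Longrightarrow> continuous_on S (\<lambda>t. F t ** G t)"
  by (rule bounded_bilinear.continuous_on[OF bounded_bilinear_matrix_mult])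

sublocale lin: volterra T M lin_gen
proof (rule volterra.intro)
  show "linear (lin_gen t)" for t
    unfolding lin_gen_def
    by (rule linearI) (simp_all add: matrix_add_ldistrib matrix_mult_scaleR)
qed (auto simp: lin_gen_def T_pos M_nonneg lin_bound
      intro!: continuous_intros continuous_on_matrix_mult continuous_interaction_coupling)

sublocale comm: volterra T M comm_gen
proof (rule volterra.intro)
  show "linear (comm_gen t)" for t
    unfolding comm_gen_def
    by (rule linearI)
      (simp_all add: matrix_add_ldistrib matrix_mult_add matrix_mult_scaleR matrix_mult_diff algebra_simps)
qed (auto simp: comm_gen_def T_pos M_nonneg comm_bound
      intro!: continuous_intros continuous_on_matrix_mult continuous_interaction_coupling)

lemma adjoint_B: "adjoint_matrix (B t) = B t"
  by (simp add: interaction_coupling_def adjoint_matrix_mult adjoint_interaction_frame hermitian matrix_mul_assoc)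

lemma E_H0: "E t ** H0 = H0 ** E t"
  by (simp add: interaction_frame_def diagonal_matrix_mult mult.commute)

lemma B_mult_frame: "B t ** (E t ** X) = E t ** (V ** X)"
proof -
  have "B t ** (E t ** X) = E t ** V ** (E (- t) ** E t) ** X"
    by (simp only: interaction_coupling_def matrix_mul_assoc)
  then show ?thesis
    by (simp add: matrix_mul_assoc)
qed

lemma V_mult_frame: "V ** (E (- t) ** X) = E (- t) ** (B t ** X)"
proof -
  have "E (- t) ** (B t ** X) = (E (- t) ** E t) ** V ** E (- t) ** X"
    by (simp only: interaction_coupling_def matrix_mul_assoc)
  then show ?thesis
    by (simp add: matrix_mul_assoc)
qed

text \<open>The derivative of the frame contributes a term i H0 that cancels the free evolution, and
  moving the frame past \<open>V\<close> turns \<open>V\<close> into \<open>B t\<close>. Only the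
  term with the control survives.\<close>

lemma solution_in_interaction_picture:
  assumes U: "schroedinger_solution T H0 V f U"
  defines "W \<equiv> (\<lambda>t. E t ** U t)"
  shows "absolutely_continuous_on {0..T} W" and "W 0 = mat 1"
    and "\<exists>N. negligible N \<and>
      (\<forall>t\<in>{0..T} - N. (W has_vector_derivative f t *\<^sub>R lin_gen t (W t)) (at t within {0..T}))"
proof -
  have ac: "absolutely_continuous_on {0..T} U" and U0: "U 0 = mat 1"
    and ae: "AE t in lebesgue_on {0..T}. \<exists>U'. (U has_vector_derivative U') (at t within {0..T}) \<and>
        mat \<i> ** U' = (H0 + f t *\<^sub>R V) ** U t"
    using U by (auto simp: schroedinger_solution_def)
  show "absolutely_continuous_on {0..T} W"
    unfolding W_def
    using bounded_bilinear.absolutely_continuous_on_prod[OF bounded_bilinear_matrix_mult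
        absolutely_continuous_interaction_frame[of 0 T h 1] ac] by simp
  show "W 0 = mat 1"
    by (simp add: W_def U0)
  obtain N where N: "negligible N" and der: "\<And>t. t \<in> {0..T} - N \<Longrightarrow>
      \<exists>U'. (U has_vector_derivative U') (at t within {0..T}) \<and> mat \<i> ** U' = (H0 + f t *\<^sub>R V) ** U t"
    using ae unfolding AE_lebesgue_on_iff_negligible by blast
  have "(W has_vector_derivative f t *\<^sub>R lin_gen t (W t)) (at t within {0..T})" if t: "t \<in> {0..T} - N" for t
  proof -
    obtain U' where U': "(U has_vector_derivative U') (at t within {0..T})"
      and eq: "mat \<i> ** U' = (H0 + f t *\<^sub>R V) ** U t"
      using der[OF t] by blast
    have "(E has_vector_derivative E t ** (mat \<i> ** H0)) (at t within {0..T})"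
      using interaction_frame_has_vector_derivative[of h 1 t] by (simp add: has_vector_derivative_at_within)
    from bounded_bilinear.has_vector_derivative[OF bounded_bilinear_matrix_mult this U']
    have "(W has_vector_derivative E t ** U' + E t ** (mat \<i> ** H0) ** U t) (at t within {0..T})"
      unfolding W_def .
    moreover have "E t ** U' + E t ** (mat \<i> ** H0) ** U t = f t *\<^sub>R lin_gen t (W t)"
    proof -
      have "U' = - (mat \<i> ** ((H0 + f t *\<^sub>R V) ** U t))"
        using mat_i_mat_i[of U'] eq by (simp add: equation_minus_iff)
      then have "E t ** U' = - (E t ** (mat \<i> ** (H0 ** U t))) - f t *\<^sub>R (E t ** (mat \<i> ** (V ** U t)))"
        by (simp add: matrix_mult_minus matrix_mult_add matrix_mult_diff matrix_add_ldistrib matrix_mult_scaleR)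
      moreover have "E t ** (mat \<i> ** (V ** U t)) = mat \<i> ** (B t ** W t)"
        unfolding W_def B_mult_frame by (metis mat_commute matrix_mul_assoc)
      ultimately show ?thesis
        by (simp add: lin_gen_def matrix_mul_assoc)
    qed
    ultimately show ?thesis by simp
  qed
  with N show "\<exists>N. negligible N \<and>
      (\<forall>t\<in>{0..T} - N. (W has_vector_derivative f t *\<^sub>R lin_gen t (W t)) (at t within {0..T}))"
    by blast
qed

lemma integral_equation_if_AC:
  fixes Y :: "real \<Rightarrow> complex^'n^'n"
  assumes ac: "absolutely_continuous_on {0..T} Y" and N: "negligible N"
    and der: "\<And>t. t \<in> {0..T} - N \<Longrightarrow> (Y has_vector_derivative G t) (at t within {0..T})"
    and t: "t \<in> {0..T}"
  shows "Y t = Y 0 + integral {0..t} G"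
proof -
  have "(G has_integral (Y t - Y 0)) {0..t}"
  proof (rule fundamental_theorem_of_calculus_AC[OF _ _ N])
    show "absolutely_continuous_on {0..t} Y"
      by (rule absolutely_continuous_on_subset[OF ac]) (use t in auto)
    fix s assume "s \<in> {0..t} - N"
    then show "(Y has_vector_derivative G s) (at s within {0..t})"
      using t by (intro has_vector_derivative_within_subset[OF der]) auto
  qed (use t in auto)
  then show ?thesis
    by (simp add: integral_unique)
qed

lemma solution_eq_lin_res:
  assumes U: "schroedinger_solution T H0 V f U" and f: "f \<in> L2 T" and small: "M * L1_norm T f < 1"
    and t: "t \<in> {0..T}"
  shows "E t ** U t = apply_bcontfun (lin.res f (const_bcontfun (mat 1))) t"
proof -
  note W = solution_in_interaction_picture[OF U]
  obtain N where N: "negligible N" and der: "\<And>t. t \<in> {0..T} - N \<Longrightarrow>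
      ((\<lambda>t. E t ** U t) has_vector_derivative f t *\<^sub>R lin_gen t (E t ** U t)) (at t within {0..T})"
    using W(3) by blast
  show ?thesis
    by (rule lin.res_eq_solution[OF f small absolutely_continuous_on_imp_continuous_on[OF W(1)] _ t, symmetric])
      (use integral_equation_if_AC[OF W(1) N der] W(2) in simp)
qed

text \<open>In the product rule the left factor contributes - i f B Y, and the adjoint factor + i f
  Y B because \<open>B t\<close> is self-adjoint. Together they form the commutator with
  \<open>Y\<close>, so the equation closes in \<open>Y\<close> alone and its solution is the fixed
  point.\<close>

lemma solution_eq_comm_res:
  assumes U: "schroedinger_solution T H0 V f U" and f: "f \<in> L2 T" and small: "M * L1_norm T f < 1"
    and t: "t \<in> {0..T}"
  shows "(E t ** U t) ** \<rho> ** adjoint_matrix (E t ** U t) = apply_bcontfun (comm.res f (const_bcontfun \<rho>)) t"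
proof -
  define W where "W t = E t ** U t" for t
  define Y where "Y t = W t ** \<rho> ** adjoint_matrix (W t)" for t
  note W = solution_in_interaction_picture[OF U, folded W_def]
  obtain N where N: "negligible N" and der: "\<And>t. t \<in> {0..T} - N \<Longrightarrow>
      (W has_vector_derivative f t *\<^sub>R lin_gen t (W t)) (at t within {0..T})"
    using W(3) by blast
  have ac: "absolutely_continuous_on {0..T} Y"
    unfolding Y_def
    by (rule bounded_bilinear.absolutely_continuous_on_prod[OF bounded_bilinear_sandwich W(1) W(1)])
  have Y0: "Y 0 = \<rho>"
    by (simp add: Y_def W(2) adjoint_matrix_mat)
  have "(Y has_vector_derivative f t *\<^sub>R comm_gen t (Y t)) (at t within {0..T})" if "t \<in> {0..T} - N" for t
  proof -
    let ?G = "lin_gen t (W t)"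
    have "(Y has_vector_derivative W t ** \<rho> ** adjoint_matrix (f t *\<^sub>R ?G) + (f t *\<^sub>R ?G) ** \<rho> ** adjoint_matrix (W t))
        (at t within {0..T})"
      unfolding Y_def
      by (rule bounded_bilinear.has_vector_derivative[OF bounded_bilinear_sandwich der[OF that] der[OF that]])
    moreover have "adjoint_matrix ?G = adjoint_matrix (W t) ** B t ** mat \<i>"
      by (simp add: lin_gen_def adjoint_matrix_minus adjoint_matrix_mult adjoint_B adjoint_matrix_mat
          mat_minus_i_mult mat_commute[symmetric])
    moreover have "?G ** \<rho> ** adjoint_matrix (W t) = - (mat \<i> ** (B t ** Y t))"
      by (simp add: lin_gen_def Y_def matrix_mult_minus matrix_mul_assoc)
    moreover have "W t ** \<rho> ** (adjoint_matrix (W t) ** B t ** mat \<i>) = mat \<i> ** (Y t ** B t)"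
      unfolding mat_commute[of \<i> "Y t ** B t"] by (simp add: Y_def matrix_mul_assoc)
    ultimately show ?thesis
      by (simp add: comm_gen_def adjoint_matrix_scaleR matrix_mult_scaleR matrix_mult_diff algebra_simps)
  qed
  then have "Y t = apply_bcontfun (comm.res f (const_bcontfun \<rho>)) t"
    by (intro comm.res_eq_solution[OF f small absolutely_continuous_on_imp_continuous_on[OF ac] _ t, symmetric])
      (use integral_equation_if_AC[OF ac N] Y0 in simp)
  then show ?thesis
    by (simp add: Y_def W_def)
qed

text \<open>Gives meaning to the choice in \<open>propagator\<close> for small controls. The fixed
  point is absolutely continuous because its increments are bounded by integrals of a multiple of
  |f|, and it is differentiable almost everywhere as an indefinite integral; multiplication by
  \<open>E (- t)\<close> then undoes the change of picture.\<close>

lemma solution_exists: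
  assumes f: "f \<in> L2 T" and small: "M * L1_norm T f < 1"
  shows "\<exists>U. schroedinger_solution T H0 V f U"
proof -
  define Wb where "Wb = lin.res f (const_bcontfun (mat 1))"
  define W where "W = apply_bcontfun Wb"
  have contW: "continuous_on S W" for S
    by (simp add: W_def)
  have eqW: "W t = mat 1 + integral {0..t} (\<lambda>s. f s *\<^sub>R lin_gen s (W s))" if "t \<in> {0..T}" for t
    using lin.res_integral_equation[OF f small that, of "const_bcontfun (mat 1)"] by (simp add: W_def Wb_def)
  have int: "(\<lambda>s. f s *\<^sub>R lin_gen s (W s)) integrable_on {u..v}" if "0 \<le> u" "v \<le> T" for u v
    by (rule lin.kernel_integrable[OF f contW that])
  have bound: "norm (W s) \<le> norm Wb" for s
    by (simp add: W_def norm_bounded)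
  have acW: "absolutely_continuous_on {0..T} W"
  proof (rule absolutely_continuous_on_if_integral_bound)
    show "(\<lambda>s. M * norm Wb * \<bar>f s\<bar>) integrable_on {0..T}"
      by (intro integrable_on_mult_right L2_abs_integrable f)
    have "(\<lambda>s. (M * norm Wb)\<^sup>2 * (f s)\<^sup>2) integrable_on {0..T}"
      by (intro integrable_on_mult_right L2_integrable_square f)
    then show "(\<lambda>s. (M * norm Wb * \<bar>f s\<bar>)\<^sup>2) integrable_on {0..T}"
      by (simp add: power_mult_distrib)
    fix u v assume uv: "0 \<le> u" "u \<le> v" "v \<le> T"
    have "integral {0..u} (\<lambda>s. f s *\<^sub>R lin_gen s (W s)) + integral {u..v} (\<lambda>s. f s *\<^sub>R lin_gen s (W s))
        = integral {0..v} (\<lambda>s. f s *\<^sub>R lin_gen s (W s))"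
      using uv by (intro Henstock_Kurzweil_Integration.integral_combine int) auto
    then have "W v - W u = integral {u..v} (\<lambda>s. f s *\<^sub>R lin_gen s (W s))"
      using eqW[of u] eqW[of v] uv by (simp add: algebra_simps)
    then show "norm (W v - W u) \<le> integral {u..v} (\<lambda>s. M * norm Wb * \<bar>f s\<bar>)"
      using lin.norm_kernel_integral[OF f contW uv(1,3) bound] by simp
  qed
  obtain N where N: "negligible N" and derI: "\<And>t. t \<in> {0..T} - N \<Longrightarrow>
      ((\<lambda>x. integral {0..x} (\<lambda>s. f s *\<^sub>R lin_gen s (W s))) has_vector_derivative f t *\<^sub>R lin_gen t (W t)) (at t within {0..T})"
    by (rule indefinite_integral_has_derivative_AE[OF int[OF order_refl order_refl]]) blast
  have derW: "(W has_vector_derivative f t *\<^sub>R lin_gen t (W t)) (at t within {0..T})" if t: "t \<in> {0..T} - N" for t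
  proof -
    have "((\<lambda>x. mat 1 + integral {0..x} (\<lambda>s. f s *\<^sub>R lin_gen s (W s))) has_vector_derivative
        0 + f t *\<^sub>R lin_gen t (W t)) (at t within {0..T})"
      by (intro has_vector_derivative_add has_vector_derivative_const derI t)
    then have "((\<lambda>x. mat 1 + integral {0..x} (\<lambda>s. f s *\<^sub>R lin_gen s (W s))) has_vector_derivative
        f t *\<^sub>R lin_gen t (W t)) (at t within {0..T})"
      by simp
    then show ?thesis
      by (rule has_vector_derivative_transform[rotated 2]) (use t eqW in auto)
  qed
  define U where "U t = E (- t) ** W t" for t
  have "schroedinger_solution T H0 V f U"
    unfolding schroedinger_solution_def
  proof (intro conjI)
    show "absolutely_continuous_on {0..T} U"
      unfolding U_def
      using bounded_bilinear.absolutely_continuous_on_prod[OF bounded_bilinear_matrix_mult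
        absolutely_continuous_interaction_frame[of 0 T h "-1"] acW] by simp
    show "U 0 = mat 1"
      using eqW[of 0] T_pos by (simp add: U_def)
    have "\<exists>U'. (U has_vector_derivative U') (at t within {0..T}) \<and> mat \<i> ** U' = (H0 + f t *\<^sub>R V) ** U t"
      if t: "t \<in> {0..T} - N" for t
    proof (intro exI conjI)
      have "((\<lambda>t. E (- t)) has_vector_derivative - (E (- t) ** (mat \<i> ** H0))) (at t within {0..T})"
        using interaction_frame_has_vector_derivative[of h "-1" t] by (simp add: has_vector_derivative_at_within)
      from bounded_bilinear.has_vector_derivative[OF bounded_bilinear_matrix_mult this derW[OF t]]
      show "(U has_vector_derivative E (- t) ** (f t *\<^sub>R lin_gen t (W t)) + (- (E (- t) ** (mat \<i> ** H0))) ** W t)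
          (at t within {0..T})"
        unfolding U_def .
      have "E (- t) ** (mat \<i> ** H0) = mat \<i> ** (H0 ** E (- t))"
        by (metis E_H0 mat_commute matrix_mul_assoc)
      then have 1: "(- (E (- t) ** (mat \<i> ** H0))) ** W t = - (mat \<i> ** (H0 ** U t))"
        by (simp add: U_def matrix_mult_minus matrix_mul_assoc)
      have "E (- t) ** (mat \<i> ** (B t ** W t)) = mat \<i> ** (E (- t) ** (B t ** W t))"
        by (metis mat_commute matrix_mul_assoc)
      also have "\<dots> = mat \<i> ** (V ** U t)"
        by (simp only: U_def V_mult_frame)
      finally have 2: "E (- t) ** (f t *\<^sub>R lin_gen t (W t)) = - (f t *\<^sub>R (mat \<i> ** (V ** U t)))"
        by (simp add: lin_gen_def matrix_mult_minus matrix_mult_scaleR)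
      show "mat \<i> ** (E (- t) ** (f t *\<^sub>R lin_gen t (W t)) + (- (E (- t) ** (mat \<i> ** H0))) ** W t)
          = (H0 + f t *\<^sub>R V) ** U t"
        unfolding 1 2
        by (simp add: matrix_add_ldistrib matrix_mult_add matrix_mult_minus matrix_mult_diff matrix_mult_scaleR mat_i_mat_i)
    qed
    with N show "AE t in lebesgue_on {0..T}. \<exists>U'. (U has_vector_derivative U') (at t within {0..T}) \<and>
        mat \<i> ** U' = (H0 + f t *\<^sub>R V) ** U t"
      unfolding AE_lebesgue_on_iff_negligible by blast
  qed
  then show ?thesis by blast
qed

lemma propagator_solution:
  assumes "f \<in> L2 T" and "M * L1_norm T f < 1"
  shows "schroedinger_solution T H0 V f (propagator T H0 V f)"
  unfolding propagator_def using solution_exists[OF assms] by (rule someI_ex)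

text \<open>The change of picture conjugates by a diagonal unitary matrix. This leaves diagonal
  entries unchanged, and a diagonal observable sees only these.\<close>

lemma objective_eq_comm_res:
  assumes f: "f \<in> L2 T" and small: "M * L1_norm T f < 1"
  shows "objective T H0 V \<rho> (diagonal_matrix (\<lambda>i. of_real (c i))) f
       = (\<Sum>i\<in>UNIV. c i * Re (apply_bcontfun (comm.res f (const_bcontfun \<rho>)) T $ i $ i))"
proof -
  define P where "P = propagator T H0 V f T"
  have T: "T \<in> {0..T}" using T_pos by simp
  define X where "X = P ** \<rho> ** adjoint_matrix P"
  have "apply_bcontfun (comm.res f (const_bcontfun \<rho>)) T = E T ** X ** E (- T)"
    using solution_eq_comm_res[OF propagator_solution[OF assms] assms T, of \<rho>]
    by (simp add: X_def P_def adjoint_matrix_mult adjoint_interaction_frame matrix_mul_assoc)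
  then have "apply_bcontfun (comm.res f (const_bcontfun \<rho>)) T $ i $ i = X $ i $ i" for i
    by (simp add: interaction_frame_def mult_diagonal_matrix_nth diagonal_matrix_mult_nth)
      (simp add: mult.assoc mult.commute[of "X $ i $ i"] cis_mult flip: mult.assoc)
  then show ?thesis
    by (simp add: objective_def trace_def mult_diagonal_matrix_nth mult.commute flip: P_def X_def)
qed

lemma comm_res_eq_sandwich:
  assumes f: "f \<in> L2 T" and small: "M * L1_norm T f < 1"
  shows "apply_bcontfun (comm.res f (const_bcontfun \<rho>)) T
       = apply_bcontfun (lin.res f (const_bcontfun (mat 1))) T ** \<rho> **
         adjoint_matrix (apply_bcontfun (lin.res f (const_bcontfun (mat 1))) T)"
proof -
  have T: "T \<in> {0..T}" using T_pos by simp
  note P = propagator_solution[OF assms]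
  show ?thesis
    using solution_eq_comm_res[OF P assms T, of \<rho>] solution_eq_lin_res[OF P assms T] by simp
qed

text \<open>Commutators are traceless, so the integral term contributes nothing. For a rank-one
  projection \<rho> this becomes conservation of the norm of one column of \<open>W\<close>.\<close>

lemma trace_comm_res:
  assumes f: "f \<in> L2 T" and small: "M * L1_norm T f < 1"
  shows "trace (apply_bcontfun (comm.res f (const_bcontfun \<rho>)) T) = trace \<rho>"
proof -
  have T: "T \<in> {0..T}" using T_pos by simp
  let ?Y = "apply_bcontfun (comm.res f (const_bcontfun \<rho>))"
  let ?G = "\<lambda>s. f s *\<^sub>R comm_gen s (?Y s)"
  have "linear (trace :: complex^'n^'n \<Rightarrow> complex)"
    by (rule linearI) (simp_all add: trace_def sum.distrib scaleR_sum_right)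
  then have tr: "bounded_linear (trace :: complex^'n^'n \<Rightarrow> complex)"
    by (rule linear_conv_bounded_linear[THEN iffD1])
  have "?G integrable_on {0..T}"
    by (rule comm.kernel_integrable[OF f]) auto
  from integral_linear[OF this tr]
  have "trace (integral {0..T} ?G) = integral {0..T} (\<lambda>s. trace (?G s))"
    by (simp add: o_def)
  moreover have "trace (?G s) = 0" for s
  proof -
    have "trace (mat \<i> ** (B s ** X - X ** B s)) = \<i> * (trace (B s ** X) - trace (X ** B s))" for X
      by (simp add: trace_def mat_mult_nth sum_distrib_left sum_subtractf right_diff_distrib)
    then have "trace (mat \<i> ** (B s ** X - X ** B s)) = 0" for X
      unfolding trace_mul_sym[of "B s"] by simp
    then have "trace (comm_gen s X) = 0" for X
      by (simp add: comm_gen_def trace_def sum_negf)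
    then show ?thesis
      by (simp add: trace_def flip: scaleR_sum_right)
  qed
  moreover have "trace (\<rho> + X) = trace \<rho> + trace X" for X
    by (simp add: trace_def sum.distrib)
  ultimately show ?thesis
    using comm.res_integral_equation[OF f small T, of "const_bcontfun \<rho>"] by simp
qed

end

section \<open>A non-resonant second-order response\<close>

definition phase :: "real \<Rightarrow> real \<Rightarrow> complex" where
  "phase \<omega> t = exp (- (\<i> * of_real \<omega> * of_real t))"

lemma phase_eq_cis: "phase \<omega> t = cis (- (\<omega> * t))"
  by (simp add: phase_def cis_conv_exp mult.assoc)

lemma phase_mult: "phase \<omega> t * phase \<omega>' t = phase (\<omega> + \<omega>') t"
  by (simp add: phase_eq_cis cis_mult algebra_simps)

lemma phase_has_vector_derivative:
  "(phase \<omega> has_vector_derivative - (\<i> * of_real \<omega>) * phase \<omega> t) (at t within S)"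
proof -
  have "((\<lambda>t. exp (t *\<^sub>R (- (\<i> * of_real \<omega>)))) has_vector_derivative
      exp (t *\<^sub>R (- (\<i> * of_real \<omega>))) * (- (\<i> * of_real \<omega>))) (at t within S)"
    by (rule exp_scaleR_has_vector_derivative_right)
  moreover have "phase \<omega> = (\<lambda>t. exp (t *\<^sub>R (- (\<i> * of_real \<omega>))))"
    by (simp add: fun_eq_iff phase_def scaleR_conv_of_real mult_ac)
  ultimately show ?thesis
    by (simp add: mult.commute)
qed

lemma continuous_phase: "continuous_on S (phase \<omega>)"
  unfolding phase_def by (intro continuous_intros)

lemma restricted_continuous_in_L2:
  fixes p :: "real \<Rightarrow> real"
  assumes p: "continuous_on UNIV p"
  shows "(\<lambda>t. if t \<in> {0..\<tau>} then p t else 0) \<in> L2 T"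
proof -
  let ?d = "\<lambda>t. if t \<in> {0..\<tau>} then p t else 0"
  have "p \<in> borel_measurable borel"
    by (rule borel_measurable_continuous_onI[OF p])
  then have "?d \<in> borel_measurable borel"
    by measurable
  then have "?d \<in> borel_measurable lebesgue"
    by (simp add: measurable_completion)
  then have meas: "?d \<in> borel_measurable (lebesgue_on {0..T})"
    by (rule measurable_restrict_space1)
  have "bounded (p ` {0..\<tau>})"
    by (rule compact_imp_bounded[OF compact_continuous_image[OF continuous_on_subset[OF p]]]) auto
  then obtain C where "\<forall>x\<in>p ` {0..\<tau>}. norm x \<le> C"
    unfolding bounded_iff by blast
  then have C: "\<bar>p t\<bar> \<le> C" if "t \<in> {0..\<tau>}" for t
    using that by simp
  have fin: "finite_measure (lebesgue_on {0..T})"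
    by (rule finite_measureI) (simp add: space_restrict_space emeasure_restrict_space emeasure_lborel_Icc_eq)
  have "integrable (lebesgue_on {0..T}) (\<lambda>t. (?d t)\<^sup>2)"
  proof (rule finite_measure.integrable_const_bound[OF fin])
    have "norm ((?d t)\<^sup>2) \<le> C\<^sup>2" for t
      using C[of t] by (auto simp: abs_le_square_iff[symmetric])
    then show "AE t in lebesgue_on {0..T}. norm ((?d t)\<^sup>2) \<le> C\<^sup>2"
      by (intro always_eventually allI)
  qed (use meas in measurable)
  with meas show ?thesis
    by (simp add: L2_def)
qed

text \<open>To be read with a = g', b = g and x = (\<omega>1 + \<omega>2) t on a bump of length
  \<tau>. The main term a^2 has size \<tau>^6, and each correction carries at least one more factor
  \<tau>: 1 - cos x is at most |x|, the product a b has size \<tau>^7, and b^2 has size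
  \<tau>^8.\<close>

lemma trigonometric_weight_bound:
  fixes x a b c \<tau> :: real
  assumes x: "\<bar>x\<bar> \<le> c * \<tau>" and a: "\<bar>a\<bar> \<le> 2 * \<tau> ^ 3" and b: "\<bar>b\<bar> \<le> \<tau> ^ 4"
    and \<tau>: "0 \<le> \<tau>" "\<tau> \<le> 1" and c: "0 \<le> c"
  shows "cos x * (a\<^sup>2 - \<omega>\<^sup>2 * b\<^sup>2) + 2 * \<omega> * (sin x * (a * b)) \<ge> a\<^sup>2 - (4 * c + \<omega>\<^sup>2 + 4 * \<bar>\<omega>\<bar>) * \<tau> ^ 7"
proof -
  have p8: "\<tau> ^ 8 \<le> \<tau> ^ 7"
    using power_decreasing[of 7 8 \<tau>] \<tau> by simp
  have a2: "a\<^sup>2 \<le> 4 * \<tau> ^ 6"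
    using power_mono[OF a, of 2] by (simp add: power_mult_distrib flip: power_mult)
  have b2: "b\<^sup>2 \<le> \<tau> ^ 7"
    using power_mono[OF b, of 2] p8 by (simp flip: power_mult)
  have "\<bar>a * b\<bar> \<le> 2 * \<tau> ^ 3 * \<tau> ^ 4"
    unfolding abs_mult using a b \<tau> by (intro mult_mono) auto
  then have ab: "\<bar>a * b\<bar> \<le> 2 * \<tau> ^ 7"
    by (simp add: eval_nat_numeral mult_ac)
  have "1 - cos x \<le> \<bar>x\<bar>"
  proof -
    have "1 - cos x = 2 * \<bar>sin (x / 2)\<bar> * \<bar>sin (x / 2)\<bar>"
      using cos_double_sin[of "x / 2"] by (simp add: power2_eq_square abs_mult_self_eq)
    also have "\<dots> \<le> 2 * \<bar>x / 2\<bar> * 1"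
      by (intro mult_mono abs_sin_x_le_abs_x) auto
    finally show ?thesis by simp
  qed
  then have "(1 - cos x) * a\<^sup>2 \<le> c * \<tau> * (4 * \<tau> ^ 6)"
    using x a2 c \<tau> by (intro mult_mono) auto
  then have 1: "(1 - cos x) * a\<^sup>2 \<le> 4 * c * \<tau> ^ 7"
    by (simp add: eval_nat_numeral mult_ac)
  have "cos x * (\<omega>\<^sup>2 * b\<^sup>2) \<le> 1 * (\<omega>\<^sup>2 * b\<^sup>2)"
    by (intro mult_right_mono) auto
  also have "\<dots> \<le> \<omega>\<^sup>2 * \<tau> ^ 7"
    using b2 by (simp add: mult_left_mono)
  finally have 2: "cos x * (\<omega>\<^sup>2 * b\<^sup>2) \<le> \<omega>\<^sup>2 * \<tau> ^ 7" .
  have "\<bar>sin x * (a * b)\<bar> \<le> 1 * (2 * \<tau> ^ 7)"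
    unfolding abs_mult[of "sin x"] using ab by (intro mult_mono) auto
  then have "\<bar>2 * \<omega>\<bar> * \<bar>sin x * (a * b)\<bar> \<le> \<bar>2 * \<omega>\<bar> * (1 * (2 * \<tau> ^ 7))"
    by (rule mult_left_mono) simp
  also have "\<dots> = 4 * \<bar>\<omega>\<bar> * \<tau> ^ 7"
    by (simp add: abs_mult)
  finally have "- (4 * \<bar>\<omega>\<bar> * \<tau> ^ 7) \<le> 2 * \<omega> * (sin x * (a * b))"
    unfolding abs_mult[symmetric] by (rule abs_le_D2[THEN minus_le_iff[THEN iffD1]])
  moreover have "cos x * (a\<^sup>2 - \<omega>\<^sup>2 * b\<^sup>2) = a\<^sup>2 - (1 - cos x) * a\<^sup>2 - cos x * (\<omega>\<^sup>2 * b\<^sup>2)"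
    by (simp only: left_diff_distrib right_diff_distrib mult_1_left)
  moreover have "(4 * c + \<omega>\<^sup>2 + 4 * \<bar>\<omega>\<bar>) * \<tau> ^ 7 = 4 * c * \<tau> ^ 7 + \<omega>\<^sup>2 * \<tau> ^ 7 + 4 * \<bar>\<omega>\<bar> * \<tau> ^ 7"
    by (simp only: distrib_right)
  ultimately show ?thesis
    using 1 2 by linarith
qed

text \<open>Both integrals are reduced to the antiderivative \<Gamma> of the resonant integrand,
  which vanishes at both ends of the bump. The double integral becomes i (\<omega>1 - \<omega>2) / 2
  times an integral whose real part is bounded below by the integral of \<open>g1\<close> squared
  minus a term of higher order in \<tau>.\<close>

lemma anharmonic_witness:
  fixes \<omega>1 \<omega>2 T :: real
  assumes T: "T > 0" and anharmonic: "\<omega>1 \<noteq> \<omega>2"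
  obtains d where "d \<in> L2 T" and "integral {0..T} (\<lambda>s. phase \<omega>2 s * of_real (d s)) = 0"
    and "integral {0..T} (\<lambda>s. phase \<omega>1 s * of_real (d s) * integral {0..s} (\<lambda>r. phase \<omega>2 r * of_real (d r))) \<noteq> 0"
proof -
  define c where "c = \<bar>\<omega>1 + \<omega>2\<bar>"
  define N where "N = 4 * c + \<omega>2\<^sup>2 + 4 * \<bar>\<omega>2\<bar>"
  have N: "N \<ge> 0" by (simp add: N_def c_def)
  \<comment> \<open>Ensures \<tau> N < 1/100 < 2/105, where 2/105 comes from the integral of
    \<open>g1\<close> squared computed below.\<close>
  define \<tau> where "\<tau> = min (min T 1) (1 / (100 * (N + 1)))"
  have \<tau>: "0 < \<tau>" "\<tau> \<le> T" "\<tau> \<le> 1" "\<tau> * N < 2/105"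
  proof -
    show "0 < \<tau>" "\<tau> \<le> T" "\<tau> \<le> 1" using T N by (auto simp: \<tau>_def)
    have "\<tau> * N \<le> 1 / (100 * (N + 1)) * N"
      using N by (intro mult_right_mono) (auto simp: \<tau>_def)
    also have "\<dots> < 2/105" using N by (simp add: field_simps)
    finally show "\<tau> * N < 2/105" .
  qed
  \<comment> \<open>A quartic with double zeros at 0 and \<tau>, so \<open>g\<close> and its
    derivative \<open>g1\<close> vanish at both ends. Being a polynomial, it allows every integral
    and bound to be explicit.\<close>
  define g g1 g2 where "g t = t\<^sup>2 * (\<tau> - t)\<^sup>2" and "g1 t = 2 * (\<tau>\<^sup>2 * t - 3 * \<tau> * t\<^sup>2 + 2 * t ^ 3)"
    and "g2 t = 2 * (\<tau>\<^sup>2 - 6 * \<tau> * t + 6 * t\<^sup>2)" for t :: real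
  have der_g: "(g has_real_derivative g1 t) (at t within S)" for t S
    unfolding g_def g1_def
    by (auto intro!: derivative_eq_intros simp: power2_eq_square power3_eq_cube algebra_simps)
  have der_g1: "(g1 has_real_derivative g2 t) (at t within S)" for t S
    unfolding g1_def g2_def
    by (auto intro!: derivative_eq_intros simp: power2_eq_square power3_eq_cube algebra_simps)
  define p where "p t = g2 t + \<omega>2\<^sup>2 * g t" for t
  define d where "d t = (if t \<in> {0..\<tau>} then p t else 0)" for t
  have "continuous_on UNIV p"
    unfolding p_def g2_def g_def by (intro continuous_intros)
  then have L2: "d \<in> L2 T"
    unfolding d_def by (rule restricted_continuous_in_L2)
  define q where "q t = of_real (g1 t) + \<i> * of_real \<omega>2 * of_real (g t)" for t
  define \<Gamma> where "\<Gamma> t = phase \<omega>2 t * q t" for t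
  have der_q: "(q has_vector_derivative of_real (g2 t) + \<i> * of_real \<omega>2 * of_real (g1 t)) (at t within S)" for t S
    unfolding q_def
    by (intro has_vector_derivative_add has_vector_derivative_of_real has_vector_derivative_mult_right der_g der_g1)
  have der_\<Gamma>: "(\<Gamma> has_vector_derivative phase \<omega>2 t * of_real (p t)) (at t within S)" for t S
  proof -
    have "(\<Gamma> has_vector_derivative phase \<omega>2 t * (of_real (g2 t) + \<i> * of_real \<omega>2 * of_real (g1 t))
        + - (\<i> * of_real \<omega>2) * phase \<omega>2 t * q t) (at t within S)"
      unfolding \<Gamma>_def by (intro has_vector_derivative_mult phase_has_vector_derivative der_q)
    moreover have "phase \<omega>2 t * (of_real (g2 t) + \<i> * of_real \<omega>2 * of_real (g1 t))
        + - (\<i> * of_real \<omega>2) * phase \<omega>2 t * q t = phase \<omega>2 t * of_real (p t)"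
      by (simp add: q_def p_def algebra_simps power2_eq_square)
    ultimately show ?thesis by simp
  qed
  have \<Gamma>0: "\<Gamma> 0 = 0" and \<Gamma>\<tau>: "\<Gamma> \<tau> = 0"
    by (simp_all add: \<Gamma>_def q_def g_def g1_def power2_eq_square power3_eq_cube algebra_simps)
  have int_p: "integral {0..s} (\<lambda>r. phase \<omega>2 r * of_real (p r)) = \<Gamma> s" if "s \<in> {0..\<tau>}" for s
  proof -
    have "((\<lambda>r. phase \<omega>2 r * of_real (p r)) has_integral (\<Gamma> s - \<Gamma> 0)) {0..s}"
      using that by (intro fundamental_theorem_of_calculus der_\<Gamma>) auto
    then show ?thesis
      by (simp add: \<Gamma>0 integral_unique)
  qed
  have int_\<Gamma>: "integral {0..s} (\<lambda>r. phase \<omega>2 r * of_real (d r)) = \<Gamma> s" if "s \<in> {0..\<tau>}" for s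
  proof -
    have "integral {0..s} (\<lambda>r. phase \<omega>2 r * of_real (d r)) = integral {0..s} (\<lambda>r. phase \<omega>2 r * of_real (p r))"
      using that by (intro integral_cong) (auto simp: d_def)
    then show ?thesis
      by (simp add: int_p[OF that])
  qed
  have restrict: "integral {0..T} (\<lambda>s. F s * of_real (d s) * G s) = integral {0..\<tau>} (\<lambda>s. F s * of_real (p s) * G s)"
    for F G :: "real \<Rightarrow> complex"
  proof -
    have "integral {0..T} (\<lambda>s. F s * of_real (d s) * G s)
        = integral {0..T} (\<lambda>s. if s \<in> {0..\<tau>} then F s * of_real (p s) * G s else 0)"
      by (intro integral_cong) (auto simp: d_def)
    also have "\<dots> = integral ({0..\<tau>} \<inter> {0..T}) (\<lambda>s. F s * of_real (p s) * G s)"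
      by (rule integral_restrict_Int)
    also have "{0..\<tau>} \<inter> {0..T} = {0..\<tau>}"
      using \<tau> by auto
    finally show ?thesis .
  qed
  define \<Omega> where "\<Omega> = \<omega>1 - \<omega>2"
  \<comment> \<open>The real part of \<open>phase (\<omega>1 + \<omega>2) t * (q t)\<^sup>2\<close>,
    in the form that \<open>trigonometric_weight_bound\<close> estimates.\<close>
  define r where "r t = cos ((\<omega>1 + \<omega>2) * t) * ((g1 t)\<^sup>2 - \<omega>2\<^sup>2 * (g t)\<^sup>2)
      + 2 * \<omega>2 * (sin ((\<omega>1 + \<omega>2) * t) * (g1 t * g t))" for t
  have cont: "continuous_on S q" "continuous_on S g" "continuous_on S g1" "continuous_on S r" for S
    unfolding r_def q_def g_def g1_def by (intro continuous_intros)+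
  have q2: "phase \<Omega> t * (\<Gamma> t)\<^sup>2 = phase (\<omega>1 + \<omega>2) t * (q t)\<^sup>2" for t
  proof -
    have "phase \<Omega> t * (\<Gamma> t)\<^sup>2 = (phase \<Omega> t * phase \<omega>2 t * phase \<omega>2 t) * (q t)\<^sup>2"
      by (simp add: \<Gamma>_def power2_eq_square)
    then show ?thesis
      by (simp add: phase_mult \<Omega>_def)
  qed
  have Re_q2: "Re (phase (\<omega>1 + \<omega>2) t * (q t)\<^sup>2) = r t" for t
  proof -
    define X where "X = (\<omega>1 + \<omega>2) * t"
    have "phase (\<omega>1 + \<omega>2) t = Complex (cos X) (- sin X)"
      by (simp add: phase_eq_cis X_def complex_eq_iff)
    then show ?thesis
      unfolding r_def X_def[symmetric] by (simp add: q_def power2_eq_square algebra_simps)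
  qed
  have "integral {0..T} (\<lambda>s. phase \<omega>1 s * of_real (d s) * integral {0..s} (\<lambda>r. phase \<omega>2 r * of_real (d r)))
      = integral {0..\<tau>} (\<lambda>s. phase \<omega>1 s * of_real (p s) * \<Gamma> s)"
    unfolding restrict by (intro integral_cong) (simp add: int_\<Gamma>)
  also have "\<dots> = \<i> * of_real \<Omega> / 2 * integral {0..\<tau>} (\<lambda>s. phase (\<omega>1 + \<omega>2) s * (q s)\<^sup>2)"
  proof -
    \<comment> \<open>Integration by parts: differentiating \<Gamma>^2 / 2 reproduces the integrand,
      differentiating the slow phase gives the term with \<Omega>, and the boundary values are
      0.\<close>
    define \<Phi> where "\<Phi> t = phase \<Omega> t * ((\<Gamma> t)\<^sup>2 / 2)" for t
    have "(\<Phi> has_vector_derivative phase \<omega>1 t * of_real (p t) * \<Gamma> t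
        - \<i> * of_real \<Omega> / 2 * (phase (\<omega>1 + \<omega>2) t * (q t)\<^sup>2)) (at t within {0..\<tau>})" for t
    proof -
      let ?\<Gamma>' = "phase \<omega>2 t * of_real (p t)"
      have "((\<lambda>t. \<Gamma> t * \<Gamma> t) has_vector_derivative \<Gamma> t * ?\<Gamma>' + ?\<Gamma>' * \<Gamma> t) (at t within {0..\<tau>})"
        by (intro has_vector_derivative_mult der_\<Gamma>)
      then have "((\<lambda>t. (\<Gamma> t)\<^sup>2 / 2) has_vector_derivative (\<Gamma> t * ?\<Gamma>' + ?\<Gamma>' * \<Gamma> t) / 2) (at t within {0..\<tau>})"
        unfolding power2_eq_square by (rule has_vector_derivative_divide)
      then have "(\<Phi> has_vector_derivative phase \<Omega> t * ((\<Gamma> t * ?\<Gamma>' + ?\<Gamma>' * \<Gamma> t) / 2)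
          + - (\<i> * of_real \<Omega>) * phase \<Omega> t * ((\<Gamma> t)\<^sup>2 / 2)) (at t within {0..\<tau>})"
        unfolding \<Phi>_def by (intro has_vector_derivative_mult phase_has_vector_derivative)
      moreover have "phase \<omega>1 t = phase \<Omega> t * phase \<omega>2 t"
        by (simp add: phase_mult \<Omega>_def)
      then have "phase \<Omega> t * ((\<Gamma> t * ?\<Gamma>' + ?\<Gamma>' * \<Gamma> t) / 2) + - (\<i> * of_real \<Omega>) * phase \<Omega> t * ((\<Gamma> t)\<^sup>2 / 2)
          = phase \<omega>1 t * of_real (p t) * \<Gamma> t - \<i> * of_real \<Omega> / 2 * (phase (\<omega>1 + \<omega>2) t * (q t)\<^sup>2)"
        unfolding q2[symmetric] by (simp add: algebra_simps)
      ultimately show ?thesis by simp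
    qed
    then have 1: "((\<lambda>t. phase \<omega>1 t * of_real (p t) * \<Gamma> t
        - \<i> * of_real \<Omega> / 2 * (phase (\<omega>1 + \<omega>2) t * (q t)\<^sup>2)) has_integral (\<Phi> \<tau> - \<Phi> 0)) {0..\<tau>}"
      using \<tau> by (intro fundamental_theorem_of_calculus) auto
    have 2: "(\<lambda>s. \<i> * of_real \<Omega> / 2 * (phase (\<omega>1 + \<omega>2) s * (q s)\<^sup>2)) integrable_on {0..\<tau>}"
      by (intro integrable_continuous_real continuous_intros continuous_phase cont)
    from has_integral_add[OF 1 integrable_integral[OF 2]]
    have "((\<lambda>t. phase \<omega>1 t * of_real (p t) * \<Gamma> t) has_integral
        (\<Phi> \<tau> - \<Phi> 0 + integral {0..\<tau>} (\<lambda>s. \<i> * of_real \<Omega> / 2 * (phase (\<omega>1 + \<omega>2) s * (q s)\<^sup>2)))) {0..\<tau>}"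
      by simp
    then show ?thesis
      by (simp add: integral_unique \<Phi>_def \<Gamma>0 \<Gamma>\<tau>)
  qed
  also have "\<dots> \<noteq> 0"
  proof -
    have "Re (integral {0..\<tau>} (\<lambda>s. phase (\<omega>1 + \<omega>2) s * (q s)\<^sup>2)) = integral {0..\<tau>} r"
    proof -
      have "(\<lambda>s. phase (\<omega>1 + \<omega>2) s * (q s)\<^sup>2) integrable_on {0..\<tau>}"
        by (intro integrable_continuous_real continuous_intros continuous_phase cont)
      from integral_linear[OF this bounded_linear_Re] show ?thesis
        by (simp only: o_def Re_q2)
    qed
    moreover have "integral {0..\<tau>} r > 0"
    proof -
      \<comment> \<open>An explicit antiderivative of \<open>g1\<close> squared; between 0 and
        \<tau> it grows by 2/105 \<tau>^7.\<close>
      define G where "G t = 4 * (\<tau> ^ 4 * t ^ 3 / 3 - 3 * \<tau> ^ 3 * t ^ 4 / 2 + 13 * \<tau>\<^sup>2 * t ^ 5 / 5 - 2 * \<tau> * t ^ 6 + 4 * t ^ 7 / 7)" for t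
      have "(G has_real_derivative (g1 t)\<^sup>2) (at t within {0..\<tau>})" for t
        unfolding G_def g1_def
        by (auto intro!: derivative_eq_intros simp: eval_nat_numeral algebra_simps)
      then have "((\<lambda>t. (g1 t)\<^sup>2) has_integral (G \<tau> - G 0)) {0..\<tau>}"
        using \<tau> by (intro fundamental_theorem_of_calculus) (auto simp: has_real_derivative_iff_has_vector_derivative)
      moreover have "G \<tau> - G 0 = 2/105 * \<tau> ^ 7"
        by (simp add: G_def eval_nat_numeral algebra_simps)
      ultimately have "((\<lambda>t. (g1 t)\<^sup>2) has_integral 2/105 * \<tau> ^ 7) {0..\<tau>}"
        by simp
      from has_integral_diff[OF this has_integral_const_real[of "N * \<tau> ^ 7" 0 \<tau>]] \<tau>
      have low: "((\<lambda>t. (g1 t)\<^sup>2 - N * \<tau> ^ 7) has_integral (2/105 * \<tau> ^ 7 - \<tau> * (N * \<tau> ^ 7))) {0..\<tau>}"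
        by simp
      have "(g1 t)\<^sup>2 - N * \<tau> ^ 7 \<le> r t" if t: "t \<in> {0..\<tau>}" for t
      proof -
        have "\<bar>(\<omega>1 + \<omega>2) * t\<bar> \<le> c * \<tau>"
          unfolding abs_mult c_def using t by (intro mult_left_mono) auto
        moreover have "\<bar>g1 t\<bar> \<le> 2 * \<tau> ^ 3"
        proof -
          have "g1 t = 2 * (t * (\<tau> - t) * (\<tau> - 2 * t))"
            by (simp add: g1_def power2_eq_square power3_eq_cube algebra_simps)
          moreover have "\<bar>t * (\<tau> - t) * (\<tau> - 2 * t)\<bar> \<le> \<tau> * \<tau> * \<tau>"
            unfolding abs_mult using t \<tau> by (intro mult_mono) auto
          ultimately show ?thesis by (simp add: abs_mult power3_eq_cube)
        qed
        moreover have "\<bar>g t\<bar> \<le> \<tau> ^ 4"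
        proof -
          have "\<bar>g t\<bar> = t\<^sup>2 * (\<tau> - t)\<^sup>2" by (simp add: g_def)
          also have "\<dots> \<le> \<tau>\<^sup>2 * \<tau>\<^sup>2"
            using t \<tau> by (intro mult_mono power_mono) auto
          finally show ?thesis by (simp flip: power_add)
        qed
        ultimately show ?thesis
          unfolding r_def N_def using \<tau> by (intro trigonometric_weight_bound) (auto simp: c_def)
      qed
      then have "2/105 * \<tau> ^ 7 - \<tau> * (N * \<tau> ^ 7) \<le> integral {0..\<tau>} r"
        by (intro has_integral_le[OF low integrable_integral[OF integrable_continuous_real[OF cont(4)]]])
      moreover have "\<tau> * N * \<tau> ^ 7 < 2/105 * \<tau> ^ 7"
        using \<tau> by (intro mult_strict_right_mono) auto
      ultimately show ?thesis by (simp add: mult_ac)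
    qed
    ultimately have "integral {0..\<tau>} (\<lambda>s. phase (\<omega>1 + \<omega>2) s * (q s)\<^sup>2) \<noteq> 0"
      by force
    then show ?thesis
      using anharmonic by (simp add: \<Omega>_def)
  qed
  finally have "integral {0..T} (\<lambda>s. phase \<omega>1 s * of_real (d s) * integral {0..s} (\<lambda>r. phase \<omega>2 r * of_real (d r))) \<noteq> 0" .
  moreover have "integral {0..T} (\<lambda>s. phase \<omega>2 s * of_real (d s)) = 0"
    using restrict[of "phase \<omega>2" "\<lambda>_. 1"] int_p[of \<tau>] \<tau> \<Gamma>\<tau> by simp
  ultimately show thesis
    using that L2 by blast
qed

text \<open>With the control cos (\<omega> t) the integrand has real part cos^2 (\<omega> t), which
  is continuous and equals 1 at t = 0. It provides the direction in which the quadratic form of the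
  trap does not vanish.\<close>

lemma nonresonant_exists:
  assumes T: "T > 0"
  obtains d where "d \<in> L2 T" and "integral {0..T} (\<lambda>t. phase \<omega> t * of_real (d t)) \<noteq> 0"
proof -
  define d where "d t = (if t \<in> {0..T} then cos (\<omega> * t) else 0)" for t
  have L2: "d \<in> L2 T"
    unfolding d_def by (intro restricted_continuous_in_L2 continuous_intros)
  have "integral {0..T} (\<lambda>t. phase \<omega> t * of_real (d t)) \<noteq> 0"
  proof
    assume 0: "integral {0..T} (\<lambda>t. phase \<omega> t * of_real (d t)) = 0"
    have "integral {0..T} (\<lambda>t. phase \<omega> t * of_real (d t)) = integral {0..T} (\<lambda>t. phase \<omega> t * of_real (cos (\<omega> * t)))"
      by (intro integral_cong) (simp add: d_def)
    with 0 have 0: "integral {0..T} (\<lambda>t. phase \<omega> t * of_real (cos (\<omega> * t))) = 0"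
      by simp
    have Re: "Re \<circ> (\<lambda>t. phase \<omega> t * of_real (cos (\<omega> * t))) = (\<lambda>t. (cos (\<omega> * t))\<^sup>2)"
      by (simp add: fun_eq_iff phase_eq_cis power2_eq_square)
    have "(\<lambda>t. phase \<omega> t * of_real (cos (\<omega> * t))) integrable_on {0..T}"
      by (intro integrable_continuous_real continuous_intros continuous_phase)
    from integral_linear[OF this bounded_linear_Re]
    have "integral {0..T} (\<lambda>t. (cos (\<omega> * t))\<^sup>2) = 0"
      unfolding Re 0 by simp
    moreover have "(\<lambda>t. (cos (\<omega> * t))\<^sup>2) integrable_on {0..T}"
      by (intro integrable_continuous_real continuous_intros)
    ultimately have "((\<lambda>t. (cos (\<omega> * t))\<^sup>2) has_integral 0) (cbox 0 T)"
      by (simp add: has_integral_iff)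
    then have "(cos (\<omega> * 0))\<^sup>2 = 0"
      by (rule has_integral_0_cbox_imp_0[rotated 2]) (use T in \<open>auto intro!: continuous_intros\<close>)
    then show False by simp
  qed
  with L2 show thesis by (rule that)
qed

section \<open>The three-level ladder system\<close>

text \<open>Letting s tend to 0 from the right removes the constant coefficient; dividing by s then
  lowers \<open>N\<close> by one. It is the tool for comparing two expansions of s \<mapsto> J (s
  d).\<close>

lemma coeffs_eq_0_if_bigo:
  fixes e :: "nat \<Rightarrow> real"
  assumes "\<delta> > 0" and "\<And>s. 0 < s \<Longrightarrow> s < \<delta> \<Longrightarrow> \<bar>\<Sum>n<N. e n * s ^ n\<bar> \<le> C * s ^ N" and "n < N"
  shows "e n = 0"
  using assms(2,3)
proof (induction N arbitrary: e n)
  case (Suc N)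
  define P where "P s = (\<Sum>n<N. e (Suc n) * s ^ n)" for s
  have P: "(\<Sum>n<Suc N. e n * s ^ n) = e 0 + s * P s" for s
    by (simp only: sum.lessThan_Suc_shift P_def sum_distrib_left) (simp add: mult_ac)
  have 1: "((\<lambda>s. \<bar>e 0 + s * P s\<bar>) \<longlongrightarrow> \<bar>e 0 + 0 * P 0\<bar>) (at_right 0)"
    unfolding P_def by (intro tendsto_intros)
  have 2: "((\<lambda>s. C * s ^ Suc N) \<longlongrightarrow> C * 0 ^ Suc N) (at_right (0::real))"
    by (intro tendsto_intros)
  have 3: "eventually (\<lambda>s. \<bar>e 0 + s * P s\<bar> \<le> C * s ^ Suc N) (at_right 0)"
    unfolding eventually_at_right_field using Suc.prems(1)[unfolded P] \<open>\<delta> > 0\<close> by blast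
  have "\<bar>e 0 + 0 * P 0\<bar> \<le> C * 0 ^ Suc N"
    by (rule tendsto_le[OF trivial_limit_at_right_real 2 1 3])
  then have e0: "e 0 = 0" by simp
  have "\<bar>\<Sum>n<N. e (Suc n) * s ^ n\<bar> \<le> C * s ^ N" if s: "0 < s" "s < \<delta>" for s
  proof -
    have "s * \<bar>P s\<bar> \<le> s * (C * s ^ N)"
      using Suc.prems(1)[OF s] s unfolding P e0 by (simp add: abs_mult mult_ac)
    then show ?thesis using s by (simp add: P_def)
  qed
  then have "e (Suc k) = 0" if "k < N" for k
    using Suc.IH[of "\<lambda>n. e (Suc n)"] that by blast
  with e0 show ?case using Suc.prems(2) by (cases n) auto
qed simp

lemma abs_cmod_square_diff_le: "\<bar>(cmod x)\<^sup>2 - (cmod y)\<^sup>2\<bar> \<le> cmod (x - y) * (cmod x + cmod y)"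
proof -
  have "(cmod x)\<^sup>2 - (cmod y)\<^sup>2 = (cmod x - cmod y) * (cmod x + cmod y)"
    by (simp add: power2_eq_square algebra_simps)
  then have "\<bar>(cmod x)\<^sup>2 - (cmod y)\<^sup>2\<bar> = \<bar>cmod x - cmod y\<bar> * (cmod x + cmod y)"
    by (simp add: abs_mult)
  also have "\<dots> \<le> cmod (x - y) * (cmod x + cmod y)"
    by (intro mult_right_mono norm_triangle_ineq3) simp
  finally show ?thesis .
qed

definition three :: "'a \<Rightarrow> 'a \<Rightarrow> 'a \<Rightarrow> 3 \<Rightarrow> 'a" where
  "three a b c i = (if i = 1 then a else if i = 2 then b else c)"

lemma three_simps [simp]: "three a b c 1 = a" "three a b c 2 = b" "three a b c 3 = c"
  by (simp_all add: three_def)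

lemma diag3_eq: "diag3 a b c = diagonal_matrix (\<lambda>i. of_real (three a b c i))"
  by (simp add: vec_eq_iff forall_3 diag3_def diagonal_matrix_def)

lemma ladder_coupling_nth [simp]:
  "ladder_coupling v w $ 1 $ 1 = 0" "ladder_coupling v w $ 1 $ 2 = v" "ladder_coupling v w $ 1 $ 3 = 0"
  "ladder_coupling v w $ 2 $ 1 = cnj v" "ladder_coupling v w $ 2 $ 2 = 0" "ladder_coupling v w $ 2 $ 3 = w"
  "ladder_coupling v w $ 3 $ 1 = 0" "ladder_coupling v w $ 3 $ 2 = cnj w" "ladder_coupling v w $ 3 $ 3 = 0"
  by (simp_all add: ladder_coupling_def)

lemma hermitian_ladder_coupling: "adjoint_matrix (ladder_coupling v w) = ladder_coupling v w"
  by (simp add: vec_eq_iff forall_3 adjoint_matrix_def)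

locale ladder = interaction "three h1 h2 h3" "ladder_coupling v12 v23" T M
  for h1 h2 h3 :: real and v12 v23 :: complex and T M :: real +
  fixes l1 l2 l3 :: real
begin

definition J :: "(real \<Rightarrow> real) \<Rightarrow> real" where
  "J = objective T (diag3 h1 h2 h3) (ladder_coupling v12 v23) (diag3 0 0 1) (diag3 l1 l2 l3)"

definition obs :: "(real \<Rightarrow>\<^sub>C (complex^3^3)) \<Rightarrow> real" where
  "obs Y = (\<Sum>i\<in>UNIV. three l1 l2 l3 i * Re (apply_bcontfun Y T $ i $ i))"

definition rho :: "real \<Rightarrow>\<^sub>C (complex^3^3)" where
  "rho = const_bcontfun (diag3 0 0 1)"

text \<open>The n-th Taylor coefficient of s \<mapsto> J (s d) at 0, that is, the n-th differential
  on the diagonal divided by n!.\<close>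

definition coeff :: "nat \<Rightarrow> (real \<Rightarrow> real) \<Rightarrow> real" where
  "coeff n d = obs ((comm.K d ^^ n) rho)"

lemma bounded_linear_obs: "bounded_linear obs"
proof (rule bounded_linear_intro)
  show "obs (x + y) = obs x + obs y" for x y
    by (simp add: obs_def sum.distrib distrib_left)
  show "obs (r *\<^sub>R x) = r *\<^sub>R obs x" for r x
    by (simp add: obs_def sum_distrib_left mult_ac)
  fix x :: "real \<Rightarrow>\<^sub>C (complex^3^3)"
  have "\<bar>Re (apply_bcontfun x T $ i $ i)\<bar> \<le> norm x" for i :: 3
    using abs_Re_le_cmod[of "apply_bcontfun x T $ i $ i"] Finite_Cartesian_Product.norm_nth_le[of "apply_bcontfun x T $ i" i]
      Finite_Cartesian_Product.norm_nth_le[of "apply_bcontfun x T" i] norm_bounded[of x T] by linarith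
  then have "norm (obs x) \<le> (\<Sum>i\<in>UNIV. \<bar>three l1 l2 l3 i\<bar> * norm x)"
    unfolding obs_def by (intro sum_norm_le) (simp add: abs_mult mult_left_mono)
  then show "norm (obs x) \<le> norm x * (\<Sum>i\<in>UNIV. \<bar>three l1 l2 l3 i\<bar>)"
    by (simp add: sum_distrib_left mult.commute)
qed

lemma J_eq: "f \<in> L2 T \<Longrightarrow> M * L1_norm T f < 1 \<Longrightarrow> J f = obs (comm.res f rho)"
  unfolding J_def diag3_eq[of h1 h2 h3] diag3_eq[of l1 l2 l3] obs_def rho_def
  by (rule objective_eq_comm_res)

lemma has_frechet_differential_J:
  "has_frechet_differential T J n (\<lambda>_. 0) (\<lambda>hs. obs (comm.res_deriv n rho (\<lambda>_. 0) hs))"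
  by (rule comm.has_frechet_differential_res[OF bounded_linear_obs])
    (simp_all add: J_eq comm.\<nu>_zero)

lemma frechet_differential_J:
  assumes "d \<in> L2 T"
  shows "frechet_differential T J n (\<lambda>_. 0) (replicate n d) = fact n * coeff n d"
proof -
  have "replicate n d \<in> lists (L2 T)"
    using assms by (induction n) auto
  then show ?thesis
    using frechet_differential_eq[OF has_frechet_differential_J, of "replicate n d" n]
      comm.res_deriv_zero_diagonal[OF assms] linear_scale[OF bounded_linear.linear[OF bounded_linear_obs]]
    by (simp add: coeff_def)
qed

lemma coeff_scale: "d \<in> L2 T \<Longrightarrow> coeff n (\<lambda>t. s * d t) = s ^ n * coeff n d"
  unfolding coeff_def
  by (simp add: comm.K_power_scale linear_scale[OF bounded_linear.linear[OF bounded_linear_obs]])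

text \<open>The Neumann remainder contains n factors \<open>K d\<close>, each bounded by a multiple
  of the L2 norm of \<open>d\<close>. One constant thus covers all directions, so the Taylor
  remainder is small in norm and not merely along lines.\<close>

lemma J_expansion:
  "\<exists>C\<ge>0. \<forall>d\<in>L2 T. M * L1_norm T d < 1/2 \<longrightarrow> \<bar>J d - (\<Sum>i<n. coeff i d)\<bar> \<le> C * L2_norm T d ^ n"
proof -
  obtain c where c: "c \<ge> 0" "\<And>x. norm (obs x) \<le> norm x * c"
    using bounded_linear.nonneg_bounded[OF bounded_linear_obs] by blast
  show ?thesis
  proof (intro exI[of _ "(M * sqrt T) ^ n * (2 * norm rho) * c"] conjI ballI impI)
    show "0 \<le> (M * sqrt T) ^ n * (2 * norm rho) * c"
      using c M_nonneg T_pos by simp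
    fix d assume d: "d \<in> L2 T" and small: "M * L1_norm T d < 1/2"
    then have small1: "M * L1_norm T d < 1" by simp
    have "J d = obs ((\<Sum>i<n. (comm.K d ^^ i) rho) + (comm.K d ^^ n) (comm.res d rho))"
      using J_eq[OF d small1] comm.res_expansion[OF d small1, of rho n] by simp
    also have "\<dots> = (\<Sum>i<n. coeff i d) + obs ((comm.K d ^^ n) (comm.res d rho))"
      unfolding coeff_def
      by (simp add: linear_add[OF bounded_linear.linear[OF bounded_linear_obs]]
          linear_sum[OF bounded_linear.linear[OF bounded_linear_obs]])
    finally have "\<bar>J d - (\<Sum>i<n. coeff i d)\<bar> = norm (obs ((comm.K d ^^ n) (comm.res d rho)))"
      by simp
    also have "\<dots> \<le> norm ((comm.K d ^^ n) (comm.res d rho)) * c"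
      by (rule c)
    also have "\<dots> \<le> ((M * sqrt T * L2_norm T d) ^ n * norm (comm.res d rho)) * c"
      by (intro mult_right_mono comm.norm_K_power d c)
    also have "\<dots> \<le> ((M * sqrt T * L2_norm T d) ^ n * (2 * norm rho)) * c"
      using M_nonneg T_pos c by (intro mult_right_mono mult_left_mono comm.norm_res d small) auto
    finally show "\<bar>J d - (\<Sum>i<n. coeff i d)\<bar> \<le> (M * sqrt T) ^ n * (2 * norm rho) * c * L2_norm T d ^ n"
      by (simp add: power_mult_distrib mult_ac)
  qed
qed

section \<open>Dyson series of the interaction-picture evolution\<close>

definition w :: "nat \<Rightarrow> (real \<Rightarrow> real) \<Rightarrow> real \<Rightarrow> complex^3^3" where
  "w n d t = apply_bcontfun ((lin.K d ^^ n) (const_bcontfun (mat 1))) t"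

definition evol :: "(real \<Rightarrow> real) \<Rightarrow> complex^3^3" where
  "evol d = apply_bcontfun (lin.res d (const_bcontfun (mat 1))) T"

lemma J_eq_evol:
  assumes d: "d \<in> L2 T" and small: "M * L1_norm T d < 1"
  shows "J d = l3 + (l1 - l3) * (cmod (evol d $ 1 $ 3))\<^sup>2 + (l2 - l3) * (cmod (evol d $ 2 $ 3))\<^sup>2"
proof -
  define Y where "Y = apply_bcontfun (comm.res d rho) T"
  have "Y = evol d ** diag3 0 0 1 ** adjoint_matrix (evol d)"
    using comm_res_eq_sandwich[OF d small] by (simp add: Y_def rho_def evol_def)
  then have "Y $ i $ i = (\<Sum>k\<in>UNIV. (evol d ** diag3 0 0 1) $ i $ k * adjoint_matrix (evol d) $ k $ i)" for i
    by (simp add: matrix_matrix_mult_def)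
  then have Y: "Y $ i $ i = of_real ((cmod (evol d $ i $ 3))\<^sup>2)" for i
    unfolding diag3_eq mult_diagonal_matrix_nth
    by (simp add: sum_3 adjoint_matrix_def complex_norm_square[symmetric] del: of_real_power)
  \<comment> \<open>Since \<open>Y\<close> is the projection onto the third column of
    \<open>evol d\<close>, conservation of the trace says that this column has norm 1; the amplitude
    at level 3 can then be eliminated.\<close>
  have "trace Y = trace (diag3 0 0 1 :: complex^3^3)"
    using trace_comm_res[OF d small] by (simp add: Y_def rho_def)
  then have "of_real (\<Sum>i\<in>UNIV. (cmod (evol d $ i $ 3))\<^sup>2) = (1 :: complex)"
    by (simp add: trace_def Y diag3_eq diagonal_matrix_def sum_3)
  then have "(\<Sum>i\<in>UNIV. (cmod (evol d $ i $ 3))\<^sup>2) = 1"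
    using of_real_eq_1_iff by blast
  then have norm3: "(cmod (evol d $ 3 $ 3))\<^sup>2 = 1 - (cmod (evol d $ 1 $ 3))\<^sup>2 - (cmod (evol d $ 2 $ 3))\<^sup>2"
    by (simp add: sum_3)
  have "J d = (\<Sum>i\<in>UNIV. three l1 l2 l3 i * (cmod (evol d $ i $ 3))\<^sup>2)"
    by (simp only: J_eq[OF d small] obs_def Y_def[symmetric] Y Re_complex_of_real)
  then show ?thesis
    unfolding sum_3 three_simps norm3 by (simp add: algebra_simps)
qed

lemma evol_expansion:
  "\<exists>C\<ge>0. \<forall>d\<in>L2 T. M * L1_norm T d < 1/2 \<longrightarrow>
     cmod (evol d $ i $ j - (\<Sum>k<n. w k d T $ i $ j)) \<le> C * L2_norm T d ^ n"
proof -
  let ?one = "const_bcontfun (mat 1) :: real \<Rightarrow>\<^sub>C (complex^3^3)"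
  show ?thesis
  proof (intro exI[of _ "(M * sqrt T) ^ n * (2 * norm ?one)"] conjI ballI impI)
    show "0 \<le> (M * sqrt T) ^ n * (2 * norm ?one)"
      using M_nonneg T_pos by simp
    fix d assume d: "d \<in> L2 T" and small: "M * L1_norm T d < 1/2"
    define R where "R = (lin.K d ^^ n) (lin.res d ?one)"
    have "lin.res d ?one = (\<Sum>k<n. (lin.K d ^^ k) ?one) + R"
      unfolding R_def using small by (intro lin.res_expansion d) simp
    moreover have "apply_bcontfun (\<Sum>k<n. (lin.K d ^^ k) ?one) T = (\<Sum>k<n. w k d T)"
      by (induction n) (simp_all add: w_def)
    ultimately have "evol d - (\<Sum>k<n. w k d T) = apply_bcontfun R T"

      by (simp add: evol_def)
    moreover have "evol d $ i $ j - (\<Sum>k<n. w k d T $ i $ j) = (evol d - (\<Sum>k<n. w k d T)) $ i $ j"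
      by (simp add: sum_component)
    ultimately have "evol d $ i $ j - (\<Sum>k<n. w k d T $ i $ j) = apply_bcontfun R T $ i $ j"
      by simp
    then have "cmod (evol d $ i $ j - (\<Sum>k<n. w k d T $ i $ j)) \<le> norm R"
      using Finite_Cartesian_Product.norm_nth_le[of "apply_bcontfun R T $ i" j]
        Finite_Cartesian_Product.norm_nth_le[of "apply_bcontfun R T" i] norm_bounded[of R T] by simp
    also have "\<dots> \<le> (M * sqrt T * L2_norm T d) ^ n * norm (lin.res d ?one)"
      unfolding R_def by (rule lin.norm_K_power[OF d])
    also have "\<dots> \<le> (M * sqrt T * L2_norm T d) ^ n * (2 * norm ?one)"
      using M_nonneg T_pos by (intro mult_left_mono lin.norm_res d small) auto
    finally show "cmod (evol d $ i $ j - (\<Sum>k<n. w k d T $ i $ j)) \<le> (M * sqrt T) ^ n * (2 * norm ?one) * L2_norm T d ^ n"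
      by (simp add: power_mult_distrib mult_ac)
  qed
qed

lemma w_scale: "d \<in> L2 T \<Longrightarrow> w n (\<lambda>t. s * d t) t = s ^ n *\<^sub>R w n d t"
  unfolding w_def by (simp add: lin.K_power_scale)

lemma w_0: "w 0 d t = mat 1"
  by (simp add: w_def)

lemma w_Suc_nth:
  assumes d: "d \<in> L2 T" and t: "t \<in> {0..T}"
  shows "w (Suc n) d t $ i $ j =
    integral {0..t} (\<lambda>s. d s *\<^sub>R (- \<i> * (\<Sum>k\<in>UNIV. B s $ i $ k * w n d s $ k $ j)))"
proof -
  have "bounded_linear (\<lambda>X :: complex^3^3. X $ i $ j)"
    by (intro bounded_linear_compose[OF bounded_linear_vec_nth] bounded_linear_vec_nth)
  moreover have "(\<lambda>s. d s *\<^sub>R lin_gen s (w n d s)) integrable_on {0..t}"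
    unfolding w_def using t by (intro lin.kernel_integrable d) auto
  ultimately have "integral {0..t} (\<lambda>s. (d s *\<^sub>R lin_gen s (w n d s)) $ i $ j) = integral {0..t} (\<lambda>s. d s *\<^sub>R lin_gen s (w n d s)) $ i $ j"
    using integral_linear unfolding o_def by blast
  moreover have "w (Suc n) d t = integral {0..t} (\<lambda>s. d s *\<^sub>R lin_gen s (w n d s))"
    using lin.apply_K[OF d] t by (simp add: w_def lin.clip_eq)
  ultimately show ?thesis
    by (simp add: lin_gen_def mat_mult_nth matrix_matrix_mult_def[of "interaction_coupling _ _ _"])
qed

text \<open>The coupling connects level 2 with levels 1 and 3 only, so each order of the series
  switches between these two groups. Starting from level 3, odd orders end in level 2 and even
  orders in levels 1 and 3.\<close>

lemma w_parity:
  assumes d: "d \<in> L2 T"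
  shows "t \<in> {0..T} \<Longrightarrow> if even n then w n d t $ 2 $ 3 = 0 else w n d t $ 1 $ 3 = 0 \<and> w n d t $ 3 $ 3 = 0"
proof (induction n arbitrary: t)
  case 0
  show ?case by (simp add: w_0 mat_def)
next
  case (Suc n)
  have zero: "w (Suc n) d t $ i $ 3 = 0" if "\<And>s. s \<in> {0..t} \<Longrightarrow> (\<Sum>k\<in>UNIV. B s $ i $ k * w n d s $ k $ 3) = 0" for i
    unfolding w_Suc_nth[OF d Suc.prems] using that by (intro integral_unique has_integral_is_0) simp
  have IH: "if even n then w n d s $ 2 $ 3 = 0 else w n d s $ 1 $ 3 = 0 \<and> w n d s $ 3 $ 3 = 0" if "s \<in> {0..t}" for s
    using Suc.IH[of s] that Suc.prems by simp
  show ?case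
  proof (cases "even n")
    case True
    then show ?thesis
      using IH by (auto intro!: zero simp: sum_3 interaction_coupling_nth)
  next
    case False
    then show ?thesis
      using IH by (auto intro!: zero simp: sum_3 interaction_coupling_nth)
  qed
qed

lemma small_scale:
  assumes d: "d \<in> L2 T"
  obtains \<delta> where "0 < \<delta>" "\<delta> \<le> 1" "\<And>s. 0 < s \<Longrightarrow> s < \<delta> \<Longrightarrow> M * L1_norm T (\<lambda>t. s * d t) < 1/2"
proof
  let ?m = "M * L1_norm T d"
  have m: "0 \<le> ?m" using M_nonneg L1_norm_nonneg[OF d] by simp
  show "0 < min 1 (1 / (2 * (?m + 1)))" "min 1 (1 / (2 * (?m + 1))) \<le> 1" using m by auto
  fix s assume s: "0 < s" "s < min 1 (1 / (2 * (?m + 1)))"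
  have "s * ?m \<le> s * (?m + 1)" using s by simp
  also have "\<dots> < 1/2"
    using s m by (simp add: pos_less_divide_eq algebra_simps)
  finally show "M * L1_norm T (\<lambda>t. s * d t) < 1/2"
    using s by (simp add: L1_norm_scale mult_ac)
qed

text \<open>By parity the amplitude is s^2 times the second-order term up to an error of order s^4.
  Multiplied by the size s^2 of the amplitudes, that error changes the squared modulus only at order
  s^6.\<close>

lemma evol_1_3_asymptotics:
  assumes d: "d \<in> L2 T"
  shows "\<exists>A\<ge>0. \<forall>s. 0 < s \<longrightarrow> s \<le> 1 \<longrightarrow> M * L1_norm T (\<lambda>t. s * d t) < 1/2 \<longrightarrow>
    \<bar>(cmod (evol (\<lambda>t. s * d t) $ 1 $ 3))\<^sup>2 - s ^ 4 * (cmod (w 2 d T $ 1 $ 3))\<^sup>2\<bar> \<le> A * s ^ 6"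
proof -
  obtain C where C: "C \<ge> 0" "\<And>d. d \<in> L2 T \<Longrightarrow> M * L1_norm T d < 1/2 \<Longrightarrow>
      cmod (evol d $ 1 $ 3 - (\<Sum>k<4. w k d T $ 1 $ 3)) \<le> C * L2_norm T d ^ 4"
    using evol_expansion[where i = 1 and j = 3 and n = 4] by blast
  define a where "a = w 2 d T $ 1 $ 3"
  define A where "A = C * L2_norm T d ^ 4"
  have A: "A \<ge> 0" using C by (simp add: A_def)
  have T: "T \<in> {0..T}" using T_pos by simp
  show ?thesis
  proof (intro exI[of _ "A * (2 * cmod a + A)"] conjI allI impI)
    show "0 \<le> A * (2 * cmod a + A)" using A by simp
    fix s assume s: "0 < s" "s \<le> 1" and small: "M * L1_norm T (\<lambda>t. s * d t) < 1/2"
    define x where "x = evol (\<lambda>t. s * d t) $ 1 $ 3"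
    define y where "y = s\<^sup>2 *\<^sub>R a"
    have "(\<Sum>k<4. w k (\<lambda>t. s * d t) T $ 1 $ 3) = y"
    proof -
      have sum4: "(\<Sum>k<4. F k) = F 0 + F 1 + F 2 + F 3" for F :: "nat \<Rightarrow> complex"
        by (simp add: eval_nat_numeral)
      have "w 1 d T $ 1 $ 3 = 0" "w 3 d T $ 1 $ 3 = 0"
        using w_parity[OF d T, of 1] w_parity[OF d T, of 3] by simp_all
      then show ?thesis
        unfolding sum4 by (simp add: w_scale[OF d] y_def a_def w_0 mat_def del: One_nat_def)
    qed
    moreover have "L2_norm T (\<lambda>t. s * d t) ^ 4 = s ^ 4 * L2_norm T d ^ 4"
      using s by (simp add: L2_norm_scale power_mult_distrib)
    ultimately have xy: "cmod (x - y) \<le> A * s ^ 4"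
      using C(2)[OF L2_scale[OF d] small] by (simp add: x_def A_def mult_ac)
    have y: "cmod y = s\<^sup>2 * cmod a"
      by (simp add: y_def)
    have "A * s ^ 4 \<le> A * s\<^sup>2"
      using A s by (intro mult_left_mono power_decreasing) auto
    then have "cmod x \<le> s\<^sup>2 * cmod a + A * s\<^sup>2"
      using xy y norm_triangle_ineq2[of x y] by linarith
    then have "cmod x + cmod y \<le> s\<^sup>2 * (2 * cmod a + A)"
      using y by (simp add: algebra_simps)
    then have "cmod (x - y) * (cmod x + cmod y) \<le> (A * s ^ 4) * (s\<^sup>2 * (2 * cmod a + A))"
      using xy by (intro mult_mono) (use A in auto)
    also have "\<dots> = A * (2 * cmod a + A) * s ^ 6"
      by (simp add: eval_nat_numeral mult_ac)
    finally have "\<bar>(cmod x)\<^sup>2 - (cmod y)\<^sup>2\<bar> \<le> A * (2 * cmod a + A) * s ^ 6"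
      using abs_cmod_square_diff_le[of x y] by linarith
    moreover have "(cmod y)\<^sup>2 = s ^ 4 * (cmod a)\<^sup>2"
      by (simp add: y power_mult_distrib flip: power_mult)
    ultimately show "\<bar>(cmod (evol (\<lambda>t. s * d t) $ 1 $ 3))\<^sup>2 - s ^ 4 * (cmod (w 2 d T $ 1 $ 3))\<^sup>2\<bar>
        \<le> A * (2 * cmod a + A) * s ^ 6"
      by (simp only: x_def a_def)
  qed
qed

text \<open>The amplitude is s b1 + s^3 b3 up to an error of order s^5, which enters the squared
  modulus multiplied by a factor of order s. The cross term is of order s^4, and |b3|^2 goes into
  the error of order s^6.\<close>

lemma evol_2_3_asymptotics:
  assumes d: "d \<in> L2 T"
  defines "b1 \<equiv> w 1 d T $ 2 $ 3" and "b3 \<equiv> w 3 d T $ 2 $ 3"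
  shows "\<exists>A\<ge>0. \<forall>s. 0 < s \<longrightarrow> s \<le> 1 \<longrightarrow> M * L1_norm T (\<lambda>t. s * d t) < 1/2 \<longrightarrow>
    \<bar>(cmod (evol (\<lambda>t. s * d t) $ 2 $ 3))\<^sup>2 - (s\<^sup>2 * (cmod b1)\<^sup>2 + s ^ 4 * (2 * Re (b1 * cnj b3)))\<bar> \<le> A * s ^ 6"
proof -
  obtain C where C: "C \<ge> 0" "\<And>d. d \<in> L2 T \<Longrightarrow> M * L1_norm T d < 1/2 \<Longrightarrow>
      cmod (evol d $ 2 $ 3 - (\<Sum>k<5. w k d T $ 2 $ 3)) \<le> C * L2_norm T d ^ 5"
    using evol_expansion[where i = 2 and j = 3 and n = 5] by blast
  define A where "A = C * L2_norm T d ^ 5"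
  have A: "A \<ge> 0" using C by (simp add: A_def)
  have T: "T \<in> {0..T}" using T_pos by simp
  define D where "D = 2 * cmod b1 + 2 * cmod b3 + A"
  have D: "D \<ge> 0" using A by (simp add: D_def)
  show ?thesis
  proof (intro exI[of _ "A * D + (cmod b3)\<^sup>2"] conjI allI impI)
    show "0 \<le> A * D + (cmod b3)\<^sup>2" using A D by simp
    fix s assume s: "0 < s" "s \<le> 1" and small: "M * L1_norm T (\<lambda>t. s * d t) < 1/2"
    define x where "x = evol (\<lambda>t. s * d t) $ 2 $ 3"
    define y where "y = s *\<^sub>R b1 + s ^ 3 *\<^sub>R b3"
    have "(\<Sum>k<5. w k (\<lambda>t. s * d t) T $ 2 $ 3) = y"
    proof -
      have sum5: "(\<Sum>k<5. F k) = F 0 + F 1 + F 2 + F 3 + F 4" for F :: "nat \<Rightarrow> complex"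
        by (simp add: eval_nat_numeral)
      have "w 2 d T $ 2 $ 3 = 0" "w 4 d T $ 2 $ 3 = 0"
        using w_parity[OF d T, of 2] w_parity[OF d T, of 4] by simp_all
      then show ?thesis
        unfolding sum5 by (simp add: w_scale[OF d] y_def b1_def b3_def w_0 mat_def del: One_nat_def)
    qed
    moreover have "L2_norm T (\<lambda>t. s * d t) ^ 5 = s ^ 5 * L2_norm T d ^ 5"
      using s by (simp add: L2_norm_scale power_mult_distrib)
    ultimately have xy: "cmod (x - y) \<le> A * s ^ 5"
      using C(2)[OF L2_scale[OF d] small] by (simp add: x_def A_def mult_ac)
    have "s ^ 3 * cmod b3 \<le> s * cmod b3"
      using power_decreasing[of 1 3 s] s by (intro mult_right_mono) auto
    then have y: "cmod y \<le> s * cmod b1 + s * cmod b3"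
      unfolding y_def using norm_triangle_ineq[of "s *\<^sub>R b1" "s ^ 3 *\<^sub>R b3"] s by simp
    have "A * s ^ 5 \<le> A * s"
      using power_decreasing[of 1 5 s] A s by (intro mult_left_mono) auto
    then have "cmod x \<le> s * cmod b1 + s * cmod b3 + A * s"
      using xy y norm_triangle_ineq2[of x y] by linarith
    then have "cmod x + cmod y \<le> s * D"
      using y by (simp add: D_def algebra_simps)
    then have "cmod (x - y) * (cmod x + cmod y) \<le> (A * s ^ 5) * (s * D)"
      using xy by (intro mult_mono) (use A s in auto)
    also have "\<dots> = A * D * s ^ 6"
      by (simp add: eval_nat_numeral mult_ac)
    finally have "\<bar>(cmod x)\<^sup>2 - (cmod y)\<^sup>2\<bar> \<le> A * D * s ^ 6"
      using abs_cmod_square_diff_le[of x y] by linarith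
    moreover have "(cmod y)\<^sup>2 = s\<^sup>2 * (cmod b1)\<^sup>2 + s ^ 4 * (2 * Re (b1 * cnj b3)) + (cmod b3)\<^sup>2 * s ^ 6"
      unfolding y_def cmod_power2 by (simp add: eval_nat_numeral algebra_simps)
    moreover have "0 \<le> (cmod b3)\<^sup>2 * s ^ 6"
      by simp
    moreover have "(A * D + (cmod b3)\<^sup>2) * s ^ 6 = A * D * s ^ 6 + (cmod b3)\<^sup>2 * s ^ 6"
      by (simp only: distrib_right)
    ultimately show "\<bar>(cmod (evol (\<lambda>t. s * d t) $ 2 $ 3))\<^sup>2 - (s\<^sup>2 * (cmod b1)\<^sup>2 + s ^ 4 * (2 * Re (b1 * cnj b3)))\<bar>
        \<le> (A * D + (cmod b3)\<^sup>2) * s ^ 6"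
      unfolding x_def by linarith
  qed
qed

text \<open>The resolvent for \<sigma> and the Dyson amplitudes both expand s \<mapsto> J (s d) up
  to order s^6, so their coefficients below order 6 agree. The odd ones vanish because both squared
  amplitudes are even up to that order.\<close>

lemma coeff_eq:
  assumes d: "d \<in> L2 T"
  defines "b1 \<equiv> w 1 d T $ 2 $ 3" and "b3 \<equiv> w 3 d T $ 2 $ 3" and "a2 \<equiv> w 2 d T $ 1 $ 3"
  shows "coeff 0 d = l3" "coeff 1 d = 0" "coeff 2 d = (l2 - l3) * (cmod b1)\<^sup>2" "coeff 3 d = 0"
    "coeff 4 d = (l1 - l3) * (cmod a2)\<^sup>2 + (l2 - l3) * (2 * Re (b1 * cnj b3))" "coeff 5 d = 0"
proof -
  define q where "q n = (if n = 0 then l3 else if n = 2 then (l2 - l3) * (cmod b1)\<^sup>2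
    else if n = 4 then (l1 - l3) * (cmod a2)\<^sup>2 + (l2 - l3) * (2 * Re (b1 * cnj b3)) else 0)" for n :: nat
  obtain \<delta> where \<delta>: "0 < \<delta>" "\<delta> \<le> 1" "\<And>s. 0 < s \<Longrightarrow> s < \<delta> \<Longrightarrow> M * L1_norm T (\<lambda>t. s * d t) < 1/2"
    using small_scale[OF d] by blast
  obtain C where C: "\<And>d. d \<in> L2 T \<Longrightarrow> M * L1_norm T d < 1/2 \<Longrightarrow>
      \<bar>J d - (\<Sum>i<6. coeff i d)\<bar> \<le> C * L2_norm T d ^ 6"
    using J_expansion[of 6] by blast
  obtain A where A: "\<And>s. 0 < s \<Longrightarrow> s \<le> 1 \<Longrightarrow> M * L1_norm T (\<lambda>t. s * d t) < 1/2 \<Longrightarrow>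
      \<bar>(cmod (evol (\<lambda>t. s * d t) $ 1 $ 3))\<^sup>2 - s ^ 4 * (cmod a2)\<^sup>2\<bar> \<le> A * s ^ 6"
    using evol_1_3_asymptotics[OF d] unfolding a2_def by blast
  obtain A' where A': "\<And>s. 0 < s \<Longrightarrow> s \<le> 1 \<Longrightarrow> M * L1_norm T (\<lambda>t. s * d t) < 1/2 \<Longrightarrow>
      \<bar>(cmod (evol (\<lambda>t. s * d t) $ 2 $ 3))\<^sup>2 - (s\<^sup>2 * (cmod b1)\<^sup>2 + s ^ 4 * (2 * Re (b1 * cnj b3)))\<bar> \<le> A' * s ^ 6"
    using evol_2_3_asymptotics[OF d] unfolding b1_def b3_def by blast
  have "coeff n d - q n = 0" if "n < 6" for n
  proof (rule coeffs_eq_0_if_bigo[OF \<delta>(1) _ that])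
    fix s assume s: "0 < s" "s < \<delta>"
    note small = \<delta>(3)[OF s]
    have s1: "s \<le> 1" using s \<delta> by simp
    define u where "u = (cmod (evol (\<lambda>t. s * d t) $ 1 $ 3))\<^sup>2"
    define v where "v = (cmod (evol (\<lambda>t. s * d t) $ 2 $ 3))\<^sup>2"
    define u' where "u' = s ^ 4 * (cmod a2)\<^sup>2"
    define v' where "v' = s\<^sup>2 * (cmod b1)\<^sup>2 + s ^ 4 * (2 * Re (b1 * cnj b3))"
    define S where "S = (\<Sum>i<6. coeff i d * s ^ i)"
    have 1: "J (\<lambda>t. s * d t) = l3 + (l1 - l3) * u + (l2 - l3) * v"
      unfolding u_def v_def using small by (intro J_eq_evol L2_scale d) simp
    have "(\<Sum>i<6. coeff i (\<lambda>t. s * d t)) = S"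
      unfolding S_def by (intro sum.cong) (simp_all add: coeff_scale[OF d] mult.commute)
    then have 2: "\<bar>J (\<lambda>t. s * d t) - S\<bar> \<le> C * L2_norm T d ^ 6 * s ^ 6"
      using C[OF L2_scale[OF d] small] s by (simp add: L2_norm_scale power_mult_distrib mult_ac)
    have "(\<Sum>n<6. q n * s ^ n) = q 0 + q 1 * s + q 2 * s\<^sup>2 + q 3 * s ^ 3 + q 4 * s ^ 4 + q 5 * s ^ 5"
      by (simp add: eval_nat_numeral)
    also have "\<dots> = l3 + (l1 - l3) * u' + (l2 - l3) * v'"
      unfolding q_def u'_def v'_def by (simp add: algebra_simps)
    finally have "(\<Sum>n<6. (coeff n d - q n) * s ^ n) = S - (l3 + (l1 - l3) * u' + (l2 - l3) * v')"
      by (simp only: left_diff_distrib sum_subtractf S_def)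
    also have "\<dots> = (l1 - l3) * (u - u') + (l2 - l3) * (v - v') - (J (\<lambda>t. s * d t) - S)"
      unfolding 1 by (simp only: right_diff_distrib)
    also have "\<bar>\<dots>\<bar> \<le> \<bar>(l1 - l3) * (u - u')\<bar> + \<bar>(l2 - l3) * (v - v')\<bar> + \<bar>J (\<lambda>t. s * d t) - S\<bar>"
      by (rule order_trans[OF abs_triangle_ineq4 add_right_mono[OF abs_triangle_ineq]])
    also have "\<dots> \<le> \<bar>l1 - l3\<bar> * (A * s ^ 6) + \<bar>l2 - l3\<bar> * (A' * s ^ 6) + C * L2_norm T d ^ 6 * s ^ 6"
    proof (intro add_mono 2)
      show "\<bar>(l1 - l3) * (u - u')\<bar> \<le> \<bar>l1 - l3\<bar> * (A * s ^ 6)"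
        unfolding abs_mult u_def u'_def by (intro mult_left_mono A[OF s(1) s1 small]) simp
      show "\<bar>(l2 - l3) * (v - v')\<bar> \<le> \<bar>l2 - l3\<bar> * (A' * s ^ 6)"
        unfolding abs_mult v_def v'_def by (intro mult_left_mono A'[OF s(1) s1 small]) simp
    qed
    also have "\<dots> = (\<bar>l1 - l3\<bar> * A + \<bar>l2 - l3\<bar> * A' + C * L2_norm T d ^ 6) * s ^ 6"
      by (simp only: distrib_right mult.assoc)
    finally show "\<bar>\<Sum>n<6. (coeff n d - q n) * s ^ n\<bar>
        \<le> (\<bar>l1 - l3\<bar> * A + \<bar>l2 - l3\<bar> * A' + C * L2_norm T d ^ 6) * s ^ 6" .
  qed
  then have "coeff n d = q n" if "n < 6" for n
    using that by force
  then show "coeff 0 d = l3" "coeff 1 d = 0" "coeff 2 d = (l2 - l3) * (cmod b1)\<^sup>2" "coeff 3 d = 0"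
    "coeff 4 d = (l1 - l3) * (cmod a2)\<^sup>2 + (l2 - l3) * (2 * Re (b1 * cnj b3))" "coeff 5 d = 0"
    by (simp_all add: q_def)
qed

section \<open>Explicit first- and second-order amplitudes\<close>

lemma w_1_eq:
  assumes d: "d \<in> L2 T" and t: "t \<in> {0..T}"
  shows "w 1 d t $ 2 $ 3 = - \<i> * v23 * integral {0..t} (\<lambda>s. phase (h3 - h2) s * of_real (d s))"
proof -
  have "w 1 d t $ 2 $ 3 = integral {0..t} (\<lambda>s. d s *\<^sub>R (- \<i> * (cis ((h2 - h3) * s) * v23)))"
    using w_Suc_nth[OF d t, of 0 2 3] by (simp add: sum_3 interaction_coupling_nth w_0 mat_def)
  also have "\<dots> = integral {0..t} (\<lambda>s. - \<i> * v23 * (phase (h3 - h2) s * of_real (d s)))"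
  proof (rule integral_cong)
    fix s
    have "cis ((h2 - h3) * s) = phase (h3 - h2) s"
      by (simp add: phase_eq_cis flip: mult_minus_left)
    then show "d s *\<^sub>R (- \<i> * (cis ((h2 - h3) * s) * v23)) = - \<i> * v23 * (phase (h3 - h2) s * of_real (d s))"
      by (simp add: scaleR_conv_of_real)
  qed
  finally show ?thesis by simp
qed

lemma w_2_eq:
  assumes d: "d \<in> L2 T"
  shows "w 2 d T $ 1 $ 3 = - (v12 * v23) * integral {0..T} (\<lambda>s. phase (h2 - h1) s * of_real (d s) *
    integral {0..s} (\<lambda>r. phase (h3 - h2) r * of_real (d r)))"
proof -
  have T: "T \<in> {0..T}" using T_pos by simp
  let ?G = "\<lambda>s. integral {0..s} (\<lambda>r. phase (h3 - h2) r * of_real (d r))"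
  have "w 2 d T $ 1 $ 3 = integral {0..T} (\<lambda>s. d s *\<^sub>R (- \<i> * (cis ((h1 - h2) * s) * v12 * w 1 d s $ 2 $ 3)))"
    using w_Suc_nth[OF d T, of 1 1 3] by (simp add: sum_3 interaction_coupling_nth numeral_2_eq_2)
  also have "\<dots> = integral {0..T} (\<lambda>s. - (v12 * v23) * (phase (h2 - h1) s * of_real (d s) * ?G s))"
  proof (rule integral_cong)
    fix s assume s: "s \<in> {0..T}"
    have "cis ((h1 - h2) * s) = phase (h2 - h1) s"
      by (simp add: phase_eq_cis flip: mult_minus_left)
    then show "d s *\<^sub>R (- \<i> * (cis ((h1 - h2) * s) * v12 * w 1 d s $ 2 $ 3))
        = - (v12 * v23) * (phase (h2 - h1) s * of_real (d s) * ?G s)"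
      unfolding w_1_eq[OF d s] scaleR_conv_of_real by (simp add: algebra_simps)
  qed
  finally show ?thesis by simp
qed

text \<open>The resonance condition uses the Lebesgue integral and the Dyson terms the gauge
  integral. They agree because an integrable control times a bounded continuous phase is Lebesgue
  integrable.\<close>

lemma phase_integral_L2:
  assumes d: "d \<in> L2 T"
  shows "(LINT t|lebesgue_on {0..T}. exp (- (\<i> * of_real \<omega> * of_real t)) * of_real (d t))
    = integral {0..T} (\<lambda>t. phase \<omega> t * of_real (d t))"
proof -
  have "(\<lambda>t. d t *\<^sub>R phase \<omega> t) absolutely_integrable_on {0..T}"
  proof (rule absolutely_integrable_bounded_measurable_product[where h = "\<lambda>y r. r *\<^sub>R y"])
    show "bilinear (\<lambda>(y :: complex) (r :: real). r *\<^sub>R y)"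
      unfolding bilinear_conv_bounded_bilinear by (rule bounded_bilinear.flip[OF bounded_bilinear_scaleR])
    show "phase \<omega> \<in> borel_measurable (lebesgue_on {0..T})"
      by (rule continuous_imp_measurable_on_sets_lebesgue[OF continuous_phase]) simp
    show "bounded (phase \<omega> ` {0..T})"
      by (rule compact_imp_bounded[OF compact_continuous_image[OF continuous_phase]]) simp
  qed (use d L2_absolutely_integrable in auto)
  then have "integrable (lebesgue_on {0..T}) (\<lambda>t. phase \<omega> t * of_real (d t))"
    by (simp add: set_integrable_eq scaleR_conv_of_real mult.commute)
  from lebesgue_integral_eq_integral[OF this] show ?thesis
    by (simp add: phase_def)
qed

lemma resonance_free_iff:
  assumes d: "d \<in> L2 T" and v23: "v23 \<noteq> 0"
  shows "d \<in> resonance_free T (h3 - h2) \<longleftrightarrow> w 1 d T $ 2 $ 3 = 0"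
proof -
  have T: "T \<in> {0..T}" using T_pos by simp
  show ?thesis
    unfolding w_1_eq[OF d T] resonance_free_def using d v23 phase_integral_L2[OF d, of "h3 - h2"] by simp
qed

section \<open>Taylor expansion of the objective and the trap property\<close>

lemma smallo_if_power_bound:
  assumes "\<And>d. d \<in> L2 T \<Longrightarrow> M * L1_norm T d < 1/2 \<Longrightarrow> \<bar>F d\<bar> \<le> C * L2_norm T d ^ Suc n"
  shows "F \<in> o[L2_nhds_zero T](\<lambda>d. L2_norm T d ^ n)"
proof (rule landau_o.smallI)
  fix c :: real assume c: "c > 0"
  have "\<forall>\<^sub>F d in L2_nhds_zero T. M * L1_norm T (\<lambda>t. 0 + d t) < 1/2"
    by (rule comm.eventually_\<nu>_less) (simp_all add: comm.\<nu>_zero)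
  moreover have "\<forall>\<^sub>F d in L2_nhds_zero T. L2_norm T d < c / (\<bar>C\<bar> + 1)"
    unfolding eventually_L2_nhds_zero using c by (intro exI[of _ "c / (\<bar>C\<bar> + 1)"]) auto
  ultimately show "\<forall>\<^sub>F d in L2_nhds_zero T. norm (F d) \<le> c * norm (L2_norm T d ^ n)"
    using comm.eventually_in_L2
  proof eventually_elim
    case (elim d)
    have "C * L2_norm T d \<le> (\<bar>C\<bar> + 1) * L2_norm T d"
      by (intro mult_right_mono) auto
    also have "\<dots> \<le> c"
      using elim(2) by (simp add: pos_less_divide_eq mult.commute)
    finally have "C * L2_norm T d * L2_norm T d ^ n \<le> c * L2_norm T d ^ n"
      by (rule mult_right_mono) simp
    then show ?case
      using assms[OF elim(3)] elim(1) by (simp add: mult.assoc)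
  qed
qed

lemma J_zero: "J (\<lambda>_. 0) = l3"
  using J_eq[OF L2_zero] coeff_eq(1)[OF L2_zero] by (simp add: comm.\<nu>_zero comm.res_zero coeff_def)

lemma frechet_differential_2_J: "d \<in> L2 T \<Longrightarrow> frechet_differential T J 2 (\<lambda>_. 0) [d, d] = 2 * coeff 2 d"
  using frechet_differential_J[of d 2] by (simp add: numeral_2_eq_2)

lemma frechet_differential_4_J: "d \<in> L2 T \<Longrightarrow> frechet_differential T J 4 (\<lambda>_. 0) [d, d, d, d] = 24 * coeff 4 d"
  using frechet_differential_J[of d 4] by (simp add: numeral_eq_Suc fact_numeral)

text \<open>The cubic coefficient vanishes by parity, so only the quadratic form is left and its
  sign decides the condition on the remainder.\<close>

lemma trap_remainder_J:
  assumes d: "d \<in> L2 T"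
  shows "trap_remainder T J 3 (\<lambda>_. 0) d = coeff 2 d"
proof -
  have "{2..3::nat} = {2, 3}" by auto
  then show ?thesis
    by (simp add: trap_remainder_def frechet_differential_J[OF d] coeff_eq(4)[OF d] del: replicate.simps)
qed

lemma coeff_2_nonpos: "d \<in> L2 T \<Longrightarrow> l2 < l3 \<Longrightarrow> coeff 2 d \<le> 0"
  by (simp add: coeff_eq mult_nonpos_nonneg)

lemma J_taylor_5:
  "(\<lambda>d. J d - (J (\<lambda>_. 0) + 1 / 2 * frechet_differential T J 2 (\<lambda>_. 0) [d, d]
      + 1 / fact 4 * frechet_differential T J 4 (\<lambda>_. 0) [d, d, d, d])) \<in> o[L2_nhds_zero T](\<lambda>d. L2_norm T d ^ 5)"
proof -
  obtain C where C: "\<And>d. d \<in> L2 T \<Longrightarrow> M * L1_norm T d < 1/2 \<Longrightarrow>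
      \<bar>J d - (\<Sum>i<6. coeff i d)\<bar> \<le> C * L2_norm T d ^ 6"
    using J_expansion[of 6] by blast
  have sum6: "(\<Sum>i<6. F i) = F 0 + F 1 + F 2 + F 3 + F 4 + F 5" for F :: "nat \<Rightarrow> real"
    by (simp add: eval_nat_numeral)
  show ?thesis
  proof (rule smallo_if_power_bound[of _ C])
    fix d assume d: "d \<in> L2 T" and small: "M * L1_norm T d < 1/2"
    have "(\<Sum>i<6. coeff i d) = J (\<lambda>_. 0) + 1 / 2 * frechet_differential T J 2 (\<lambda>_. 0) [d, d]
      + 1 / fact 4 * frechet_differential T J 4 (\<lambda>_. 0) [d, d, d, d]"
      unfolding sum6 coeff_eq(1,2,4,6)[OF d] frechet_differential_2_J[OF d] frechet_differential_4_J[OF d] J_zero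
      by (simp add: fact_numeral)
    then show "\<bar>J d - (J (\<lambda>_. 0) + 1 / 2 * frechet_differential T J 2 (\<lambda>_. 0) [d, d]
      + 1 / fact 4 * frechet_differential T J 4 (\<lambda>_. 0) [d, d, d, d])\<bar> \<le> C * L2_norm T d ^ Suc 5"
      using C[OF d small] by simp
  qed
qed

lemma J_taylor_3:
  "(\<lambda>d. J d - (J (\<lambda>_. 0) + trap_remainder T J 3 (\<lambda>_. 0) d)) \<in> o[L2_nhds_zero T](\<lambda>d. L2_norm T d ^ 3)"
proof -
  obtain C where C: "\<And>d. d \<in> L2 T \<Longrightarrow> M * L1_norm T d < 1/2 \<Longrightarrow>
      \<bar>J d - (\<Sum>i<4. coeff i d)\<bar> \<le> C * L2_norm T d ^ 4"
    using J_expansion[of 4] by blast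
  have sum4: "(\<Sum>i<4. F i) = F 0 + F 1 + F 2 + F 3" for F :: "nat \<Rightarrow> real"
    by (simp add: eval_nat_numeral)
  show ?thesis
  proof (rule smallo_if_power_bound[of _ C])
    fix d assume d: "d \<in> L2 T" and small: "M * L1_norm T d < 1/2"
    have "(\<Sum>i<4. coeff i d) = J (\<lambda>_. 0) + trap_remainder T J 3 (\<lambda>_. 0) d"
      unfolding sum4 coeff_eq(1,2,4)[OF d] trap_remainder_J[OF d] J_zero by simp
    then show "\<bar>J d - (J (\<lambda>_. 0) + trap_remainder T J 3 (\<lambda>_. 0) d)\<bar> \<le> C * L2_norm T d ^ Suc 3"
      using C[OF d small] by simp
  qed
qed

text \<open>Along s d the coefficients of orders 1 to 3 vanish, so J (s d) exceeds its value at 0 by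
  s^4 times the positive fourth coefficient, up to an error of order s^5.\<close>

lemma not_maximum_if_coeff_4_pos:
  assumes d: "d \<in> L2 T" and c2: "coeff 2 d = 0" and c4: "coeff 4 d > 0"
  shows "\<exists>g\<in>L2 T. J (\<lambda>_. 0) < J g"
proof -
  obtain \<delta> where \<delta>: "0 < \<delta>" "\<delta> \<le> 1" "\<And>s. 0 < s \<Longrightarrow> s < \<delta> \<Longrightarrow> M * L1_norm T (\<lambda>t. s * d t) < 1/2"
    using small_scale[OF d] by blast
  obtain C where C: "C \<ge> 0" "\<And>d. d \<in> L2 T \<Longrightarrow> M * L1_norm T d < 1/2 \<Longrightarrow>
      \<bar>J d - (\<Sum>i<5. coeff i d)\<bar> \<le> C * L2_norm T d ^ 5"
    using J_expansion[of 5] by blast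
  have sum5: "(\<Sum>i<5. F i) = F 0 + F 1 + F 2 + F 3 + F 4" for F :: "nat \<Rightarrow> real"
    by (simp add: eval_nat_numeral)
  define A where "A = C * L2_norm T d ^ 5"
  have A: "A \<ge> 0" using C(1) by (simp add: A_def)
  \<comment> \<open>The first bound keeps s d in the range of the expansion; the second makes the
    error at most half of the quartic gain.\<close>
  define s where "s = min (\<delta> / 2) (coeff 4 d / (2 * (A + 1)))"
  have s: "0 < s" "s < \<delta>" using \<delta>(1) A c4 by (auto simp: s_def)
  have "A * s \<le> (A + 1) * s" using s by simp
  also have "\<dots> \<le> (A + 1) * (coeff 4 d / (2 * (A + 1)))"
    using A by (intro mult_left_mono) (auto simp: s_def)
  also have "\<dots> = coeff 4 d / 2" using A by (simp add: divide_simps)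
  finally have As: "A * s < coeff 4 d" using c4 by linarith
  have sd: "(\<lambda>t. s * d t) \<in> L2 T" by (rule L2_scale[OF d])
  have "(\<Sum>i<5. coeff i (\<lambda>t. s * d t)) = l3 + s ^ 4 * coeff 4 d"
    unfolding sum5 coeff_scale[OF d] coeff_eq(1,2,4)[OF d] c2 by simp
  then have "\<bar>J (\<lambda>t. s * d t) - (l3 + s ^ 4 * coeff 4 d)\<bar> \<le> s ^ 4 * (A * s)"
    using C(2)[OF sd \<delta>(3)[OF s]] s(1)
    by (simp add: L2_norm_scale power_mult_distrib A_def power_Suc2[of _ 4, simplified] mult_ac)
  moreover have "s ^ 4 * (A * s) < s ^ 4 * coeff 4 d"
    using As s by simp
  ultimately have "J (\<lambda>_. 0) < J (\<lambda>t. s * d t)"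
    unfolding J_zero by linarith
  with sd show ?thesis by blast
qed

lemma anharmonic_direction:
  assumes "v12 \<noteq> 0" and "v23 \<noteq> 0" and "l3 < l1" and "h2 - h1 \<noteq> h3 - h2"
  obtains d where "d \<in> resonance_free T (h3 - h2)" and "coeff 4 d > 0"
proof -
  obtain d where d: "d \<in> L2 T"
    and res: "integral {0..T} (\<lambda>s. phase (h3 - h2) s * of_real (d s)) = 0"
    and nz: "integral {0..T} (\<lambda>s. phase (h2 - h1) s * of_real (d s) *
      integral {0..s} (\<lambda>r. phase (h3 - h2) r * of_real (d r))) \<noteq> 0"
    using anharmonic_witness[OF T_pos assms(4)] by blast
  have T: "T \<in> {0..T}" using T_pos by simp
  have b1: "w 1 d T $ 2 $ 3 = 0"
    by (simp only: w_1_eq[OF d T] res mult_zero_right)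
  have "w 2 d T $ 1 $ 3 \<noteq> 0"
    using nz assms(1,2) by (simp add: w_2_eq[OF d])
  then have "coeff 4 d > 0"
    using assms(3) unfolding coeff_eq(5)[OF d] b1 by simp
  moreover have "d \<in> resonance_free T (h3 - h2)"
    using resonance_free_iff[OF d assms(2)] b1 by blast
  ultimately show thesis by (rule that[rotated])
qed

lemma coeff_resonance_free:
  assumes v23: "v23 \<noteq> 0" and d: "d \<in> resonance_free T (h3 - h2)"
  shows "coeff 2 d = 0" and "l3 < l1 \<Longrightarrow> coeff 4 d \<ge> 0"
proof -
  have L2: "d \<in> L2 T" using d by (simp add: resonance_free_def)
  have "w 1 d T $ 2 $ 3 = 0" using resonance_free_iff[OF L2 v23] d by blast
  then show "coeff 2 d = 0" and "l3 < l1 \<Longrightarrow> coeff 4 d \<ge> 0"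
    using coeff_eq(3,5)[OF L2] by simp_all
qed

lemma coeff_2_neg:
  assumes v23: "v23 \<noteq> 0" and l: "l2 < l3" and d: "d \<in> L2 T - resonance_free T (h3 - h2)"
  shows "coeff 2 d < 0"
proof -
  have "w 1 d T $ 2 $ 3 \<noteq> 0" using resonance_free_iff[OF _ v23] d by blast
  then show ?thesis
    using coeff_eq(3)[of d] d l by (simp add: mult_neg_pos)
qed

text \<open>The improvement that excludes a maximum is a fourth-order effect, invisible to the
  third-order remainder, which is a nonpositive quadratic form and nonzero at the direction from
  \<open>nonresonant_exists\<close>.\<close>

lemma is_trap_J:
  assumes "v12 \<noteq> 0" and "v23 \<noteq> 0" and "l3 < l1" and "l2 < l3" and "h2 - h1 \<noteq> h3 - h2"
  shows "is_trap T J 3 (\<lambda>_. 0)"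
  unfolding is_trap_def
proof (intro conjI)
  obtain d where d: "d \<in> resonance_free T (h3 - h2)" "coeff 4 d > 0"
    using anharmonic_direction assms by blast
  then have "\<exists>g\<in>L2 T. J (\<lambda>_. 0) < J g"
    by (intro not_maximum_if_coeff_4_pos[of d] coeff_resonance_free(1) assms) (auto simp: resonance_free_def)
  then show "\<not> (\<forall>g\<in>L2 T. J g \<le> J (\<lambda>_. 0))"
    by (meson not_le)
  show "\<forall>j\<le>3. frechet_differentiable T J j (\<lambda>_. 0)"
    unfolding frechet_differentiable_def using has_frechet_differential_J by blast
  show "(\<lambda>d. J (\<lambda>t. 0 + d t) - (J (\<lambda>_. 0) + trap_remainder T J 3 (\<lambda>_. 0) d)) \<in> o[L2_nhds_zero T](\<lambda>d. L2_norm T d ^ 3)"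
    using J_taylor_3 by simp
  obtain d' where d': "d' \<in> L2 T" "integral {0..T} (\<lambda>t. phase (h3 - h2) t * of_real (d' t)) \<noteq> 0"
    using nonresonant_exists[OF T_pos] by blast
  then have "d' \<in> L2 T - resonance_free T (h3 - h2)"
    unfolding resonance_free_def Diff_iff mem_Collect_eq phase_integral_L2[OF d'(1)] by simp
  from coeff_2_neg[OF assms(2,4) this] show "\<exists>d\<in>L2 T. trap_remainder T J 3 (\<lambda>_. 0) d \<noteq> 0"
    using d'(1) trap_remainder_J by (metis less_irrefl)
  show "\<forall>d\<in>L2 T. \<exists>\<epsilon>>0. \<forall>s\<in>{- \<epsilon><..<\<epsilon>}. trap_remainder T J 3 (\<lambda>_. 0) (\<lambda>t. s * d t) \<le> 0"
  \<comment> \<open>Any radius would do: the remainder is nonpositive on all of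
    \<open>L2 T\<close>.\<close>
  proof (intro ballI exI[of _ 1] conjI)
    fix d and s :: real assume "d \<in> L2 T"
    then show "trap_remainder T J 3 (\<lambda>_. 0) (\<lambda>t. s * d t) \<le> 0"
      using trap_remainder_J coeff_2_nonpos[OF _ assms(4)] L2_scale by metis
  qed simp
qed simp

end

theorem theorem3:
  fixes h1 h2 h3 l1 l2 l3 T :: real and v12 v23 :: complex
  assumes "v12 \<noteq> 0" and "v23 \<noteq> 0" and "l1 > l3" and "l3 > l2" and "T > 0"
  defines "\<omega>1 \<equiv> h2 - h1" and "\<omega>2 \<equiv> h3 - h2"
  defines "J \<equiv> objective T (diag3 h1 h2 h3) (ladder_coupling v12 v23) (diag3 0 0 1) (diag3 l1 l2 l3)"
  defines "H1 \<equiv> resonance_free T \<omega>2"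
  defines "f0 \<equiv> (\<lambda>_. 0)"
  shows
    "(\<forall>j\<le>5. frechet_differentiable T J j f0) \<and>
     (\<lambda>d. J (\<lambda>t. f0 t + d t) - (J f0 + 1 / 2 * frechet_differential T J 2 f0 [d, d]
                               + 1 / fact 4 * frechet_differential T J 4 f0 [d, d, d, d]))
        \<in> o[L2_nhds_zero T](\<lambda>d. L2_norm T d ^ 5) \<and>
     (\<forall>d\<in>L2 T - H1. frechet_differential T J 2 f0 [d, d] < 0) \<and>
     (\<forall>d\<in>H1. frechet_differential T J 2 f0 [d, d] = 0 \<and>
             frechet_differential T J 4 f0 [d, d, d, d] \<ge> 0) \<and>
     (\<omega>1 \<noteq> \<omega>2 \<longrightarrow>
        (\<omega>2 = 0 \<longrightarrow> (\<exists>d\<in>H1. frechet_differential T J 4 f0 [d, d, d, d] > 0)) \<and>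
        (\<bar>\<omega>2\<bar> > 0 \<and> T \<ge> 2 * pi / \<bar>\<omega>2\<bar> \<longrightarrow>
           (\<exists>d\<in>H1. frechet_differential T J 4 f0 [d, d, d, d] > 0)) \<and>
        (\<omega>2 = 0 \<or> (\<bar>\<omega>2\<bar> > 0 \<and> T \<ge> 2 * pi / \<bar>\<omega>2\<bar>) \<longrightarrow> is_trap T J 3 f0))"
proof -
  obtain M where M: "0 \<le> M"
    "\<And>t (X :: complex^3^3). t \<in> {0..T} \<Longrightarrow>
       norm (mat \<i> ** (interaction_coupling (three h1 h2 h3) (ladder_coupling v12 v23) t ** X)) \<le> M * norm X"
    "\<And>t X. t \<in> {0..T} \<Longrightarrow>
       norm (mat \<i> ** (interaction_coupling (three h1 h2 h3) (ladder_coupling v12 v23) t ** X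
         - X ** interaction_coupling (three h1 h2 h3) (ladder_coupling v12 v23) t)) \<le> M * norm X"
    by (rule interaction_bound_exists[where h = "three h1 h2 h3" and V = "ladder_coupling v12 v23" and T = T])
      (rule that)
  interpret ladder: ladder h1 h2 h3 v12 v23 T M l1 l2 l3
    by (rule ladder.intro, rule interaction.intro) (use assms(5) M hermitian_ladder_coupling in auto)
  have J: "J = ladder.J"
    by (simp only: J_def ladder.J_def)
  have H1_L2: "d \<in> L2 T" if "d \<in> H1" for d
    using that by (simp add: H1_def resonance_free_def)
  note fd = ladder.frechet_differential_2_J ladder.frechet_differential_4_J
  have pos: "\<exists>d\<in>H1. frechet_differential T J 4 f0 [d, d, d, d] > 0" if ne: "\<omega>1 \<noteq> \<omega>2"
  proof -
    obtain d where d: "d \<in> H1" "ladder.coeff 4 d > 0"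
      using ladder.anharmonic_direction[OF assms(1-3)] ne unfolding H1_def \<omega>1_def \<omega>2_def by blast
    then show ?thesis
      using fd(2)[OF H1_L2[OF d(1)]] unfolding J f0_def by (intro bexI[of _ d]) simp_all
  qed
  have trap: "is_trap T J 3 f0" if "\<omega>1 \<noteq> \<omega>2"
    using ladder.is_trap_J[OF assms(1-4)] that unfolding J f0_def \<omega>1_def \<omega>2_def by blast
  show ?thesis
  proof (intro conjI impI ballI)
    show "\<forall>j\<le>5. frechet_differentiable T J j f0"
      unfolding frechet_differentiable_def J f0_def using ladder.has_frechet_differential_J by blast
    show "(\<lambda>d. J (\<lambda>t. f0 t + d t) - (J f0 + 1 / 2 * frechet_differential T J 2 f0 [d, d]
                               + 1 / fact 4 * frechet_differential T J 4 f0 [d, d, d, d]))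
        \<in> o[L2_nhds_zero T](\<lambda>d. L2_norm T d ^ 5)"
      using ladder.J_taylor_5 unfolding J f0_def by simp
    show "frechet_differential T J 2 f0 [d, d] < 0" if "d \<in> L2 T - H1" for d
      using ladder.coeff_2_neg[OF assms(2,4), of d] fd(1)[of d] that unfolding J f0_def H1_def \<omega>2_def by simp
    show "frechet_differential T J 2 f0 [d, d] = 0" "frechet_differential T J 4 f0 [d, d, d, d] \<ge> 0" if "d \<in> H1" for d
      using ladder.coeff_resonance_free[OF assms(2), of d] fd[OF H1_L2[OF that]] assms(3) that
      unfolding J f0_def H1_def \<omega>2_def by simp_all
  qed (use pos trap in blast)+
qed

end
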